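(* Let $0\le\lambda<1$. Let $(\mathbf x_i,\mathbf y_i,\mathbf s_i)$, $i=1,\dots,n$, be i.i.d. copies of $(X,Y,S)$. Assume that $k_S$ and $k_Y$ are bounded by one and that $f_j^2(\mathbf x_i)\le M$ for all $j=1,\dots,r$, all $i=1,\dots,n$, and all $\mathbf f=(f_1,\dots,f_r)\in\mathcal A_r$. Then, for any $n>1$ and $0<\delta<1$, with probability at least $1-\delta$, $$\Big|\sup_{\mathbf f\in\mathcal A_r}J(\mathbf f,\lambda)-\sup_{\mathbf f\in\mathcal A_r}J^{\mathrm{emp}}(\mathbf f,\lambda)\Big|\le rM\sqrt{\frac{\log(6/\delta)}{0.22^2\,n}}+\mathcal O\Big(\frac1n\Big).$$
   Context: $(X,Y,S)$ is a joint random variable with $X\in\mathbb R^{d_X}$, and $Y$, $S$ valued in $\mathbb R^{d_Y}$, $\mathbb R^{d_S}$ (or in finite sets). $(\mathcal H_X,k_X)$ is a universal RKHS of real functions on $\mathbb R^{d_X}$; $(\mathcal H_Y,k_Y)$ and $(\mathcal H_S,k_S)$ are separable RKHSs on the ranges of $Y$ and $S$, with countable orthonormal bases $\mathcal U_Y$, $\mathcal U_S$. The kernel functions are bounded, with $\mathbb E[k_U(U,U)]<\infty$ for $U=X,Y,S$. For $\mathbf f=(f_1,\dots,f_r)$ with $f_j\in\mathcal H_X$ and $U\in\{Y,S\}$, $$\mathrm{Dep}(\mathbf f(X),U):=\sum_{j=1}^r\sum_{\beta\in\mathcal U_U}\mathrm{Cov}^2(f_j(X),\beta(U)),$$ and $\mathrm{Dep}^{\mathrm{emp}}(\mathbf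 f(X),U)$ is the same expression with $\mathrm{Cov}(f_j(X),\beta(U))$ replaced by the empirical covariance $\frac1n\sum_if_j(\mathbf x_i)\beta(\mathbf u_i)-\frac1{n^2}\sum_i\sum_kf_j(\mathbf x_i)\beta(\mathbf u_k)$ (where $\mathbf u_i$ is $\mathbf y_i$ or $\mathbf s_i$). Then $$J(\mathbf f,\lambda):=(1-\lambda)\mathrm{Dep}(\mathbf f(X),Y)-\lambda\,\mathrm{Dep}(\mathbf f(X),S),$$ $$J^{\mathrm{emp}}(\mathbf f,\lambda):=(1-\lambda)\mathrm{Dep}^{\mathrm{emp}}(\mathbf f(X),Y)-\lambda\,\mathrm{Dep}^{\mathrm{emp}}(\mathbf f(X),S).$$ With a regularization parameter $\gamma>0$, $$\mathcal A_r:=\{(f_1,\dots,f_r)\,:\, f_i\in\mathcal H_X,\ \mathrm{Cov}(f_i(X),f_j(X))+\gamma\langle f_i,f_j\rangle_{\mathcal H_X}=\delta_{i,j}\ \text{for all }1\le i,j\le r\}.$$ *)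

theory Defs
  imports "HOL-Probability.Probability"
begin

(* A reproducing kernel Hilbert space of real functions on D.  HOL functions are total, so a
   function on D is represented by its extension by 0 outside D; this makes equality of the
   representatives the same as equality on D. *)
locale rkhs =
  fixes D :: "'a set"
    and H :: "('a \<Rightarrow> real) set"
    and ip :: "('a \<Rightarrow> real) \<Rightarrow> ('a \<Rightarrow> real) \<Rightarrow> real"
    and k :: "'a \<Rightarrow> 'a \<Rightarrow> real"
  assumes zero_outside: "f \<in> H \<Longrightarrow> x \<notin> D \<Longrightarrow> f x = 0"
    and zero_mem: "(\<lambda>x. 0) \<in> H"
    and add_mem: "f \<in> H \<Longrightarrow> g \<in> H \<Longrightarrow> (\<lambda>x. f x + g x) \<in> H"
    and scale_mem: "f \<in> H \<Longrightarrow> (\<lambda>x. c * f x) \<in> H"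
    and ip_commute: "f \<in> H \<Longrightarrow> g \<in> H \<Longrightarrow> ip f g = ip g f"
    and ip_add: "f \<in> H \<Longrightarrow> g \<in> H \<Longrightarrow> h \<in> H \<Longrightarrow> ip (\<lambda>x. f x + g x) h = ip f h + ip g h"
    and ip_scale: "f \<in> H \<Longrightarrow> g \<in> H \<Longrightarrow> ip (\<lambda>x. c * f x) g = c * ip f g"
    and ip_nonneg: "f \<in> H \<Longrightarrow> 0 \<le> ip f f"
    and ip_definite: "f \<in> H \<Longrightarrow> ip f f = 0 \<Longrightarrow> f = (\<lambda>x. 0)"
    and complete:
      "(\<And>m. F m \<in> H) \<Longrightarrow>
       (\<And>e. e > 0 \<Longrightarrow>
          \<exists>N. \<forall>m\<ge>N. \<forall>n\<ge>N. sqrt (ip (\<lambda>x. F m x - F n x) (\<lambda>x. F m x - F n x)) < e) \<Longrightarrow>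
       \<exists>f\<in>H. (\<lambda>m. sqrt (ip (\<lambda>x. F m x - f x) (\<lambda>x. F m x - f x))) \<longlonglongrightarrow> 0"
    and kernel_mem: "x \<in> D \<Longrightarrow> k x \<in> H"
    and reproducing: "f \<in> H \<Longrightarrow> x \<in> D \<Longrightarrow> f x = ip f (k x)"

(* Universality on a non-compact domain: a subspace of C(X) that is dense for uniform
   convergence on compact sets. *)
definition universal_rkhs :: "('a::topological_space \<Rightarrow> real) set \<Rightarrow> bool" where
  "universal_rkhs H \<longleftrightarrow>
     (\<forall>f\<in>H. continuous_on UNIV f) \<and>
     (\<forall>K g e. compact K \<and> continuous_on K g \<and> e > 0 \<longrightarrow>
        (\<exists>f\<in>H. \<forall>x\<in>K. \<bar>f x - g x\<bar> < e))"

(* Orthonormal basis in the Hilbert space sense: the finite linear span of B is dense in H.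
   Hence H is separable if and only if it has a countable such B. *)
definition orthonormal_basis ::
  "('a \<Rightarrow> real) set \<Rightarrow> (('a \<Rightarrow> real) \<Rightarrow> ('a \<Rightarrow> real) \<Rightarrow> real) \<Rightarrow> ('a \<Rightarrow> real) set \<Rightarrow> bool" where
  "orthonormal_basis H ip B \<longleftrightarrow>
     B \<subseteq> H \<and>
     (\<forall>\<beta>\<in>B. \<forall>\<beta>'\<in>B. ip \<beta> \<beta>' = (if \<beta> = \<beta>' then 1 else 0)) \<and>
     (\<forall>f\<in>H. \<forall>e>0. \<exists>T c. finite T \<and> T \<subseteq> B \<and>
        sqrt (ip (\<lambda>x. f x - (\<Sum>\<beta>\<in>T. c \<beta> * \<beta> x)) (\<lambda>x. f x - (\<Sum>\<beta>\<in>T. c \<beta> * \<beta> x))) < e)"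

definition cov :: "'w measure \<Rightarrow> ('w \<Rightarrow> real) \<Rightarrow> ('w \<Rightarrow> real) \<Rightarrow> real" where
  "cov P A B =
     (\<integral>\<omega>. (A \<omega> - (\<integral>\<omega>'. A \<omega>' \<partial>P)) * (B \<omega> - (\<integral>\<omega>'. B \<omega>' \<partial>P)) \<partial>P)"

definition emp_cov ::
  "nat \<Rightarrow> (nat \<Rightarrow> 'x) \<Rightarrow> (nat \<Rightarrow> 'u) \<Rightarrow> ('x \<Rightarrow> real) \<Rightarrow> ('u \<Rightarrow> real) \<Rightarrow> real" where
  "emp_cov n x u f \<beta> =
     1 / real n * (\<Sum>i<n. f (x i) * \<beta> (u i))
     - 1 / (real n)\<^sup>2 * (\<Sum>i<n. \<Sum>l<n. f (x i) * \<beta> (u l))"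

(* A tuple (f_1, ..., f_r) is a function on the index set {..<r}. *)
definition Dep ::
  "'w measure \<Rightarrow> nat \<Rightarrow> (nat \<Rightarrow> 'x \<Rightarrow> real) \<Rightarrow> ('w \<Rightarrow> 'x) \<Rightarrow> ('u \<Rightarrow> real) set \<Rightarrow> ('w \<Rightarrow> 'u) \<Rightarrow> real" where
  "Dep P r f X B U =
     (\<Sum>j<r. \<Sum>\<^sub>\<infinity>\<beta>\<in>B. (cov P (\<lambda>\<omega>. f j (X \<omega>)) (\<lambda>\<omega>. \<beta> (U \<omega>)))\<^sup>2)"

definition Dep_emp ::
  "nat \<Rightarrow> nat \<Rightarrow> (nat \<Rightarrow> 'x \<Rightarrow> real) \<Rightarrow> (nat \<Rightarrow> 'x) \<Rightarrow> ('u \<Rightarrow> real) set \<Rightarrow> (nat \<Rightarrow> 'u) \<Rightarrow> real" where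
  "Dep_emp n r f x B u = (\<Sum>j<r. \<Sum>\<^sub>\<infinity>\<beta>\<in>B. (emp_cov n x u (f j) \<beta>)\<^sup>2)"

definition J ::
  "'w measure \<Rightarrow> ('w \<Rightarrow> 'x) \<Rightarrow> ('w \<Rightarrow> 'y) \<Rightarrow> ('w \<Rightarrow> 's) \<Rightarrow>
   ('y \<Rightarrow> real) set \<Rightarrow> ('s \<Rightarrow> real) set \<Rightarrow> nat \<Rightarrow> (nat \<Rightarrow> 'x \<Rightarrow> real) \<Rightarrow> real \<Rightarrow> real" where
  "J P X Y S BY BS r f lam = (1 - lam) * Dep P r f X BY Y - lam * Dep P r f X BS S"

definition J_emp ::
  "nat \<Rightarrow> (nat \<Rightarrow> 'x) \<Rightarrow> (nat \<Rightarrow> 'y) \<Rightarrow> (nat \<Rightarrow> 's) \<Rightarrow>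
   ('y \<Rightarrow> real) set \<Rightarrow> ('s \<Rightarrow> real) set \<Rightarrow> nat \<Rightarrow> (nat \<Rightarrow> 'x \<Rightarrow> real) \<Rightarrow> real \<Rightarrow> real" where
  "J_emp n x y s BY BS r f lam =
     (1 - lam) * Dep_emp n r f x BY y - lam * Dep_emp n r f x BS s"

definition admissible ::
  "'w measure \<Rightarrow> ('w \<Rightarrow> 'x) \<Rightarrow> ('x \<Rightarrow> real) set \<Rightarrow> (('x \<Rightarrow> real) \<Rightarrow> ('x \<Rightarrow> real) \<Rightarrow> real) \<Rightarrow>
   real \<Rightarrow> nat \<Rightarrow> (nat \<Rightarrow> 'x \<Rightarrow> real) set" where
  "admissible P X H ip \<gamma> r =
     {f \<in> {..<r} \<rightarrow>\<^sub>E H. \<forall>i<r. \<forall>j<r.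
        cov P (\<lambda>\<omega>. f i (X \<omega>)) (\<lambda>\<omega>. f j (X \<omega>)) + \<gamma> * ip (f i) (f j)
          = (if i = j then 1 else 0)}"

definition iid_copies ::
  "'w measure \<Rightarrow> 'a measure \<Rightarrow> nat \<Rightarrow> ('w \<Rightarrow> 'a) \<Rightarrow> (nat \<Rightarrow> 'w \<Rightarrow> 'a) \<Rightarrow> bool" where
  "iid_copies P N n Z z \<longleftrightarrow>
     prob_space.indep_vars P (\<lambda>_. N) z {..<n} \<and>
     (\<forall>i<n. distr P N (z i) = distr P N Z)"

end

theory Submission
  imports Defs
begin

text \<open>
  The difference of the suprema is at most the supremum of \<open>\<bar>J - J_emp\<bar>\<close> over the admissible
  tuples, and this random variable Z is controlled by McDiarmid's inequality. After dividing the
  functions by \<open>sqrt M\<close>, replacing one sample changes a single empirical dependence term by at most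
  \<open>5.2 / n + 8 / n\<^sup>2\<close>. The expectation of Z is at most \<open>r (2.6 / sqrt n + 2 / n)\<close>: expanding
  the admissible functions in a basis that is orthonormal for the form
  \<open>Cov (f X) (g X) + \<gamma> \<langle>f, g\<rangle>\<close>, the deviation is dominated, uniformly over its unit ball, by
  Hilbert-Schmidt norms of centred sample means. The hypothesis on M says exactly that the squares
  of such a basis sum to at most M on the support of X, because every unit vector belongs to an
  admissible tuple. For \<open>n \<ge> 100\<close> the two contributions fit under \<open>sqrt (ln (6 / \<delta>) / (0.22\<^sup>2 n))\<close>;
  for smaller n the term \<open>C / n\<close> exceeds the trivial bound.

  The argument is run on finite families of functions and of basis elements. It passes to a countable
  family, which suffices because the functions are continuous, as a limit superior of events.
\<close>

section \<open>McDiarmid's inequality\<close>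

text \<open>Concentration for one fixed tuple is not enough: the supremum runs over an
  infinite-dimensional set. A uniform bound is possible because features enter the estimates only
  through a pointwise bound on the sum of their squares, so that their number never appears.

  The 6 in the logarithm is not spent on a union bound. One variable carries both dependence terms
  and both signs, so McDiarmid costs only ln (1/\<delta>), and ln 6 is left to pay for the
  expectation. Up to lower order the requirement is (2.6 + 5.2 w)^2 \<le> (ln 6 + 2 w^2) / 0.22^2
  with w = sqrt (ln (1/\<delta>) / 2). The sharp bounded difference is essential: bounding the range
  of a summand and the covariance separately gives 8 / n, and 64 w^2 exceeds 2 w^2 / 0.22^2, about
  41.3 w^2, for large w.

  The lower-order part 8 / n^2 of the bounded difference yields a term that grows with ln
  (1/\<delta>). C / n cannot absorb it, since C serves every \<delta>; it has to fit under the
  radius, which leaves room only for large n.\<close>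

lemma bounded_differences_mgf:
  fixes M :: "'a measure" and g :: "('i \<Rightarrow> 'a) \<Rightarrow> real"
  assumes M: "prob_space M" and "finite I" and s: "s > 0"
    and "g \<in> borel_measurable (Pi\<^sub>M I (\<lambda>_. M))"
    and "\<And>z. z \<in> space (Pi\<^sub>M I (\<lambda>_. M)) \<Longrightarrow> \<bar>g z\<bar> \<le> K"
    and "\<And>z i w. z \<in> space (Pi\<^sub>M I (\<lambda>_. M)) \<Longrightarrow> i \<in> I \<Longrightarrow> w \<in> space M
           \<Longrightarrow> \<bar>g (z(i := w)) - g z\<bar> \<le> c"
  shows "(\<integral>\<^sup>+z. ennreal (exp (s * (g z - (\<integral>z. g z \<partial>Pi\<^sub>M I (\<lambda>_. M))))) \<partial>Pi\<^sub>M I (\<lambda>_. M))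
           \<le> ennreal (exp (s^2 * c^2 * real (card I) / 8))"
  using assms(2,4,5,6)
proof (induction I arbitrary: g rule: finite_induct)
  case empty
  interpret E: prob_space "Pi\<^sub>M ({} :: 'i set) (\<lambda>_. M)" using M by (intro prob_space_PiM) auto
  have sp: "space (Pi\<^sub>M ({} :: 'i set) (\<lambda>_. M)) = {\<lambda>_. undefined}" by (simp add: space_PiM)
  have "(\<integral>z. g z \<partial>Pi\<^sub>M ({} :: 'i set) (\<lambda>_. M)) = (\<integral>z. g (\<lambda>_. undefined) \<partial>Pi\<^sub>M ({} :: 'i set) (\<lambda>_. M))"
    by (intro Bochner_Integration.integral_cong refl) (simp add: sp)
  also have "\<dots> = g (\<lambda>_. undefined)" by (simp add: E.prob_space)
  finally have eq: "(\<integral>z. g z \<partial>Pi\<^sub>M ({} :: 'i set) (\<lambda>_. M)) = g (\<lambda>_. undefined)" .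
  have "(\<integral>\<^sup>+z. ennreal (exp (s * (g z - (\<integral>z. g z \<partial>Pi\<^sub>M ({} :: 'i set) (\<lambda>_. M))))) \<partial>Pi\<^sub>M ({} :: 'i set) (\<lambda>_. M))
      = (\<integral>\<^sup>+z. 1 \<partial>Pi\<^sub>M ({} :: 'i set) (\<lambda>_. M))"
    by (rule nn_integral_cong) (auto simp: sp eq)
  also have "\<dots> = 1" by (simp add: E.emeasure_space_1)
  finally show ?case by simp
next
  case (insert i I)
  let ?Q = "Pi\<^sub>M I (\<lambda>_. M)" and ?Q' = "Pi\<^sub>M (insert i I) (\<lambda>_. M)"
  interpret M: prob_space M by fact
  interpret PS: product_sigma_finite "\<lambda>_::'i. M" ..
  interpret E: prob_space "?Q" using M by (intro prob_space_PiM) auto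
  interpret E': prob_space "?Q'" using M by (intro prob_space_PiM) auto
  note gm[measurable] = insert.prems(1)
  have upd: "z(i := w) \<in> space (?Q')"
    if "z \<in> space (?Q)" "w \<in> space M" for z w
    using that by (auto simp: space_PiM PiE_def extensional_def)
  have upm[measurable]: "(\<lambda>w. g (z(i := w))) \<in> borel_measurable M"
    if "z \<in> space (?Q)" for z
    using measurable_comp[OF measurable_component_update gm, OF that insert.hyps(2)]
    unfolding comp_def .
  have upd_m[measurable]: "(\<lambda>(z, w). g (z(i := w))) \<in> borel_measurable (?Q \<Otimes>\<^sub>M M)"
    using measurable_comp[OF measurable_add_dim gm] by (simp add: comp_def case_prod_beta')
  \<comment> \<open>\<open>h\<close> is the conditional expectation of \<open>g\<close> given the
    coordinates in \<open>I\<close>. It inherits the bound and the bounded differences, so the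
    induction hypothesis applies to it, and \<open>g - h\<close> is left to Hoeffding's lemma in the
    single coordinate \<open>i\<close>.\<close>
  define h where "h z = (\<integral>w. g (z(i := w)) \<partial>M)" for z
  have hm[measurable]: "h \<in> borel_measurable (?Q)"
    unfolding h_def using upd_m by (intro M.borel_measurable_lebesgue_integral) auto
  have intg: "integrable M (\<lambda>w. g (z(i := w)))" if "z \<in> space (?Q)" for z
    using that insert.prems(2)[OF upd[OF that]]
    by (intro M.integrable_const_bound[where B = K] AE_I2) (simp_all del: fun_upd_apply)
  have hb: "\<bar>h z\<bar> \<le> K" if z: "z \<in> space (?Q)" for z
  proof -
    have "\<bar>h z\<bar> \<le> (\<integral>w. \<bar>g (z(i := w))\<bar> \<partial>M)"
      unfolding h_def by (rule integral_abs_bound)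
    also have "\<dots> \<le> (\<integral>w. K \<partial>M)"
      using insert.prems(2)[OF upd[OF z]] intg[OF z]
      by (intro integral_mono) (auto simp del: fun_upd_apply)
    finally show ?thesis by (simp add: M.prob_space)
  qed
  have hd: "\<bar>h (z(j := w)) - h z\<bar> \<le> c"
    if z: "z \<in> space (?Q)" and j: "j \<in> I" and w: "w \<in> space M" for z j w
  proof -
    have z': "z(j := w) \<in> space (?Q)"
      using z j w by (auto simp: space_PiM PiE_def extensional_def)
    have ji: "j \<noteq> i" using j insert.hyps by auto
    have "\<bar>h (z(j := w)) - h z\<bar> = \<bar>\<integral>v. g ((z(j := w))(i := v)) - g (z(i := v)) \<partial>M\<bar>"
      unfolding h_def using intg[OF z] intg[OF z'] by simp
    also have "\<dots> \<le> (\<integral>v. \<bar>g ((z(j := w))(i := v)) - g (z(i := v))\<bar> \<partial>M)"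
      by (rule integral_abs_bound)
    also have "\<dots> \<le> (\<integral>v. c \<partial>M)"
    proof (intro integral_mono)
      show "\<bar>g ((z(j := w))(i := v)) - g (z(i := v))\<bar> \<le> c" if v: "v \<in> space M" for v
        using insert.prems(3)[OF upd[OF z v], of j w] j w ji by (simp add: fun_upd_twist del: fun_upd_apply)
    qed (use intg[OF z] intg[OF z'] in \<open>auto simp del: fun_upd_apply\<close>)
    finally show ?thesis by (simp add: M.prob_space)
  qed
  have ig: "integrable (?Q') g"
    using insert.prems(2) by (intro E'.integrable_const_bound[where B = K] AE_I2) auto
  have Eg: "(\<integral>z. g z \<partial>?Q') = (\<integral>z. h z \<partial>?Q)"
    unfolding h_def by (rule PS.product_integral_insert[OF insert.hyps ig])
  define e where "e = (\<integral>z. h z \<partial>?Q)"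
  have hoeff: "(\<integral>\<^sup>+w. ennreal (exp (s * (g (z(i := w)) - h z))) \<partial>M) \<le> ennreal (exp (s^2 * c^2 / 8))"
    if z: "z \<in> space (?Q)" for z
  proof -
    \<comment> \<open>Hoeffding's lemma asks for an interval, whereas only the oscillation in
      coordinate \<open>i\<close> is bounded by \<open>c\<close>. Starting at the infimum, the
      values lie in an interval of length \<open>c\<close>, whatever the other coordinates
      are.\<close>
    define a where "a = (INF w\<in>space M. g (z(i := w)))"
    have bdd: "bdd_below ((\<lambda>w. g (z(i := w))) ` space M)"
      using insert.prems(2)[OF upd[OF z]] by (intro bdd_belowI2[where m = "- K"]) (force simp: abs_le_iff simp del: fun_upd_apply)
    have osc: "g (z(i := w)) - c \<le> g (z(i := v))" if "w \<in> space M" "v \<in> space M" for v w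
      using insert.prems(3)[OF upd[OF z, of v], of i w] that by (simp add: abs_le_iff del: fun_upd_apply)
    have up: "g (z(i := w)) \<le> a + c" if "w \<in> space M" for w
    proof -
      have "g (z(i := w)) - c \<le> a"
        unfolding a_def using osc[OF that] M.not_empty by (intro cINF_greatest) auto
      then show ?thesis by simp
    qed
    have lo: "a \<le> g (z(i := w))" if "w \<in> space M" for w
      unfolding a_def by (rule cINF_lower[OF bdd that])
    interpret ib: interval_bounded_random_variable M "\<lambda>w. g (z(i := w))" a "a + c"
      by unfold_locales (use upm[OF z] up lo in \<open>auto simp del: fun_upd_apply\<close>)
    show ?thesis using ib.Hoeffdings_lemma_nn_integral[OF s] unfolding h_def by simp
  qed
  have "(\<integral>\<^sup>+z. ennreal (exp (s * (g z - e))) \<partial>?Q')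
      = (\<integral>\<^sup>+z. (\<integral>\<^sup>+w. ennreal (exp (s * (g (z(i := w)) - e))) \<partial>M) \<partial>?Q)"
    by (rule PS.product_nn_integral_insert[OF insert.hyps]) measurable
  also have "\<dots> = (\<integral>\<^sup>+z. ennreal (exp (s * (h z - e))) * (\<integral>\<^sup>+w. ennreal (exp (s * (g (z(i := w)) - h z))) \<partial>M) \<partial>?Q)"
  proof (rule nn_integral_cong)
    fix z assume z: "z \<in> space (?Q)"
    note [measurable] = upm[OF z]
    show "(\<integral>\<^sup>+w. ennreal (exp (s * (g (z(i := w)) - e))) \<partial>M)
        = ennreal (exp (s * (h z - e))) * (\<integral>\<^sup>+w. ennreal (exp (s * (g (z(i := w)) - h z))) \<partial>M)"
      by (subst nn_integral_cmult[symmetric]) 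
         (auto simp: ennreal_mult[symmetric] exp_add[symmetric] algebra_simps)
  qed
  also have "\<dots> \<le> (\<integral>\<^sup>+z. ennreal (exp (s * (h z - e))) * ennreal (exp (s^2 * c^2 / 8)) \<partial>?Q)"
    by (intro nn_integral_mono mult_left_mono hoeff) auto
  also have "\<dots> = (\<integral>\<^sup>+z. ennreal (exp (s * (h z - e))) \<partial>?Q) * ennreal (exp (s^2 * c^2 / 8))"
    by (rule nn_integral_multc) measurable
  also have "\<dots> \<le> ennreal (exp (s^2 * c^2 * real (card I) / 8)) * ennreal (exp (s^2 * c^2 / 8))"
    using insert.IH[OF hm hb hd] unfolding e_def by (intro mult_right_mono) auto
  also have "\<dots> = ennreal (exp (s^2 * c^2 * real (card (insert i I)) / 8))"
    using insert.hyps by (simp add: ennreal_mult[symmetric] exp_add[symmetric] algebra_simps add_divide_distrib)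
  finally show ?case unfolding Eg e_def .
qed

abbreviation samples :: "nat \<Rightarrow> 'a measure \<Rightarrow> (nat \<Rightarrow> 'a) measure" where
  "samples n M \<equiv> Pi\<^sub>M {..<n} (\<lambda>_. M)"

lemma mcdiarmid_inequality:
  fixes M :: "'a measure" and g :: "(nat \<Rightarrow> 'a) \<Rightarrow> real"
  assumes M: "prob_space M" and n: "n > 0" and c: "c > 0" and t: "t > 0"
    and gm: "g \<in> borel_measurable (samples n M)"
    and gb: "\<And>z. z \<in> space (samples n M) \<Longrightarrow> \<bar>g z\<bar> \<le> K"
    and gd: "\<And>z i w. z \<in> space (samples n M) \<Longrightarrow> i < n \<Longrightarrow> w \<in> space M
           \<Longrightarrow> \<bar>g (z(i := w)) - g z\<bar> \<le> c"
  shows "measure (samples n M) {z \<in> space (samples n M).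
           g z \<ge> (\<integral>z. g z \<partial>samples n M) + t} \<le> exp (- 2 * t^2 / (real n * c^2))"
proof -
  let ?Q = "samples n M"
  interpret Q: prob_space ?Q using M by (intro prob_space_PiM) auto
  note gm[measurable]
  define e where "e = (\<integral>z. g z \<partial>?Q)"
  \<comment> \<open>Chernoff's method: this \<open>s\<close> minimises the exponent - s t + s^2 c^2
    n / 8.\<close>
  define s where "s = 4 * t / (real n * c^2)"
  have s: "s > 0" using n c t by (simp add: s_def)
  have "emeasure ?Q {z \<in> space ?Q. g z \<ge> e + t}
      \<le> emeasure ?Q {z \<in> space ?Q. 1 \<le> ennreal (exp (- s * t)) * ennreal (exp (s * (g z - e)))}"
    using s by (intro emeasure_mono)
      (auto simp: ennreal_mult[symmetric] exp_add[symmetric] ennreal_ge_1 simp flip: ennreal_1 distrib_left algebra_simps)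
  also have "\<dots> \<le> ennreal (exp (- s * t)) * (\<integral>\<^sup>+z. ennreal (exp (s * (g z - e))) \<partial>?Q)"
  proof -
    have "emeasure ?Q {z \<in> space ?Q. 1 \<le> ennreal (exp (- s * t)) * ennreal (exp (s * (g z - e)))}
      \<le> ennreal (exp (- s * t)) * (\<integral>\<^sup>+z. ennreal (exp (s * (g z - e))) * indicator (space ?Q) z \<partial>?Q)"
      using nn_integral_Markov_inequality[of "\<lambda>z. ennreal (exp (s * (g z - e)))" "space ?Q" ?Q "ennreal (exp (- s * t))"] by simp
    also have "(\<integral>\<^sup>+z. ennreal (exp (s * (g z - e))) * indicator (space ?Q) z \<partial>?Q) = (\<integral>\<^sup>+z. ennreal (exp (s * (g z - e))) \<partial>?Q)"
      by (rule nn_integral_cong) auto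
    finally show ?thesis .
  qed
  also have "\<dots> \<le> ennreal (exp (- s * t)) * ennreal (exp (s^2 * c^2 * real n / 8))"
    using bounded_differences_mgf[OF M _ s gm gb, of c] gd unfolding e_def
    by (intro mult_left_mono) auto
  also have "\<dots> = ennreal (exp (- 2 * t^2 / (real n * c^2)))"
  proof -
    have "- s * t + s^2 * c^2 * real n / 8 = - 2 * t^2 / (real n * c^2)"
      using n c by (simp add: s_def field_simps power2_eq_square)
    then show ?thesis by (simp add: ennreal_mult[symmetric] exp_add[symmetric])
  qed
  finally show ?thesis unfolding e_def by (simp add: Q.emeasure_eq_measure)
qed

section \<open>Empirical covariances\<close>

text \<open>Integrating out one coordinate at a time, the cross term between the inserted coordinate
  and the rest vanishes because \<open>h\<close> is centred.\<close>

lemma PiM_second_moment: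
  fixes M :: "'a measure" and h :: "'a \<Rightarrow> real"
  assumes M: "prob_space M" and "finite I"
    and hm[measurable]: "h \<in> borel_measurable M" and hb: "\<And>x. x \<in> space M \<Longrightarrow> \<bar>h x\<bar> \<le> K"
    and h0: "(\<integral>x. h x \<partial>M) = 0"
  shows "(\<integral>z. (\<Sum>i\<in>I. h (z i))^2 \<partial>Pi\<^sub>M I (\<lambda>_. M)) = real (card I) * (\<integral>x. (h x)^2 \<partial>M)"
  using assms(2)
proof (induction I rule: finite_induct)
  case empty
  then show ?case by simp
next
  case (insert i I)
  let ?Q = "Pi\<^sub>M I (\<lambda>_. M)" and ?Q' = "Pi\<^sub>M (insert i I) (\<lambda>_. M)"
  interpret M: prob_space M by fact
  interpret PS: product_sigma_finite "\<lambda>_::'b. M" ..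
  interpret E: prob_space "?Q" using M by (intro prob_space_PiM) auto
  interpret E': prob_space "?Q'" using M by (intro prob_space_PiM) auto
  have Sm: "(\<lambda>z. \<Sum>j\<in>J. h (z j)) \<in> borel_measurable (Pi\<^sub>M J (\<lambda>_. M))" for J
    by measurable
  have Sb: "(\<Sum>j\<in>J. h (z j))^2 \<le> (real (card J) * K)^2" if "z \<in> space (Pi\<^sub>M J (\<lambda>_. M))" for z J
  proof -
    have "\<bar>\<Sum>j\<in>J. h (z j)\<bar> \<le> (\<Sum>j\<in>J. \<bar>h (z j)\<bar>)" by (rule sum_abs)
    also have "\<dots> \<le> (\<Sum>j\<in>J. K)" using that hb by (intro sum_mono) (auto simp: space_PiM)
    finally show ?thesis by (intro abs_le_square_iff[THEN iffD1]) simp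
  qed
  have Si: "integrable (Pi\<^sub>M J (\<lambda>_. M)) (\<lambda>z. (\<Sum>j\<in>J. h (z j))^2)" for J :: "'b set"
  proof -
    interpret F: prob_space "Pi\<^sub>M J (\<lambda>_. M)" using M by (intro prob_space_PiM) auto
    show ?thesis using Sb
      by (intro F.integrable_const_bound[where B = "(real (card J) * K)^2"] AE_I2 borel_measurable_power Sm) auto
  qed
  have hi: "integrable M h" using hb by (intro M.integrable_const_bound[where B = K] AE_I2) auto
  have hi2: "integrable M (\<lambda>x. (h x)^2)"
  proof (intro M.integrable_const_bound[where B = "K^2"] AE_I2)
    fix x assume "x \<in> space M"
    then have "\<bar>h x\<bar> \<le> \<bar>K\<bar>" using hb[of x] by linarith
    then show "norm ((h x)^2) \<le> K^2" by (simp add: abs_le_square_iff)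
  qed simp
  have "(\<integral>z. (\<Sum>j\<in>insert i I. h (z j))^2 \<partial>?Q')
      = (\<integral>z. (\<integral>w. (\<Sum>j\<in>insert i I. h ((z(i := w)) j))^2 \<partial>M) \<partial>?Q)"
    by (rule PS.product_integral_insert[OF insert.hyps Si])
  also have "\<dots> = (\<integral>z. (\<Sum>j\<in>I. h (z j))^2 + (\<integral>x. (h x)^2 \<partial>M) \<partial>?Q)"
  proof (rule Bochner_Integration.integral_cong[OF refl])
    fix z
    have "(\<integral>w. (\<Sum>j\<in>insert i I. h ((z(i := w)) j))^2 \<partial>M)
        = (\<integral>w. (\<Sum>j\<in>I. h (z j))^2 + 2 * (\<Sum>j\<in>I. h (z j)) * h w + (h w)^2 \<partial>M)"
    proof (rule Bochner_Integration.integral_cong[OF refl])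
      fix w
      have "(\<Sum>j\<in>I. h ((z(i := w)) j)) = (\<Sum>j\<in>I. h (z j))"
        using insert.hyps by (intro sum.cong) auto
      then show "(\<Sum>j\<in>insert i I. h ((z(i := w)) j))^2
          = (\<Sum>j\<in>I. h (z j))^2 + 2 * (\<Sum>j\<in>I. h (z j)) * h w + (h w)^2"
        using insert.hyps by (simp add: power2_eq_square algebra_simps)
    qed
    also have "\<dots> = (\<Sum>j\<in>I. h (z j))^2 + (\<integral>x. (h x)^2 \<partial>M)"
      using hi hi2 h0 by (simp add: M.prob_space)
    finally show "(\<integral>w. (\<Sum>j\<in>insert i I. h ((z(i := w)) j))^2 \<partial>M) = \<dots>" .
  qed
  also have "\<dots> = real (card (insert i I)) * (\<integral>x. (h x)^2 \<partial>M)"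
    using insert Si[of I] by (simp add: E.prob_space algebra_simps)
  finally show ?case .
qed

abbreviation emp_dep :: "nat \<Rightarrow> (nat \<Rightarrow> 'x) \<Rightarrow> (nat \<Rightarrow> 'u) \<Rightarrow> ('x \<Rightarrow> real) \<Rightarrow> ('b \<Rightarrow> 'u \<Rightarrow> real) \<Rightarrow> 'b set \<Rightarrow> real" where
  "emp_dep n x u f b T \<equiv> (\<Sum>\<beta>\<in>T. (emp_cov n x u f (b \<beta>))^2)"

abbreviation pop_dep :: "'a measure \<Rightarrow> ('a \<Rightarrow> real) \<Rightarrow> ('b \<Rightarrow> 'a \<Rightarrow> real) \<Rightarrow> 'b set \<Rightarrow> real" where
  "pop_dep M f b T \<equiv> (\<Sum>\<beta>\<in>T. (cov M f (b \<beta>))^2)"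

text \<open>The offsets are free. With the sample means the correction term disappears; with the
  population means the first term becomes an average of independent summands; with the means of an
  older sample only one summand changes when a point is replaced.\<close>

lemma emp_cov_centered:
  assumes n: "n > 0"
  shows "emp_cov n x u f g = (\<Sum>i<n. (f (x i) - a) * (g (u i) - b)) / real n
     - ((\<Sum>i<n. f (x i)) / real n - a) * ((\<Sum>i<n. g (u i)) / real n - b)"
proof -
  have centered: "(\<Sum>i<n. (f (x i) - a) * (g (u i) - b))
      = (\<Sum>i<n. f (x i) * g (u i)) - a * (\<Sum>i<n. g (u i)) - b * (\<Sum>i<n. f (x i)) + real n * a * b"
    by (simp add: algebra_simps sum.distrib sum_subtractf sum_distrib_left)
  have prod: "(\<Sum>i<n. \<Sum>l<n. f (x i) * g (u l)) = (\<Sum>i<n. f (x i)) * (\<Sum>i<n. g (u i))"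
    by (simp add: sum_product)
  show ?thesis using n unfolding emp_cov_def centered prod
    by (simp add: field_simps power2_eq_square)
qed

lemma emp_cov_commute: "emp_cov n x u f g = emp_cov n u x g f"
proof -
  have "(\<Sum>i<n. \<Sum>l<n. f (x i) * g (u l)) = (\<Sum>i<n. \<Sum>l<n. g (u i) * f (x l))"
    by (subst sum.swap) (simp add: mult.commute)
  then show ?thesis unfolding emp_cov_def by (simp add: mult.commute)
qed

lemma emp_cov_sum_right:
  "emp_cov n x u f (\<lambda>v. \<Sum>\<beta>\<in>T. c \<beta> * b \<beta> v) = (\<Sum>\<beta>\<in>T. c \<beta> * emp_cov n x u f (b \<beta>))"
proof -
  have 1: "(\<Sum>i<n. f (x i) * (\<Sum>\<beta>\<in>T. c \<beta> * b \<beta> (u i))) = (\<Sum>\<beta>\<in>T. c \<beta> * (\<Sum>i<n. f (x i) * b \<beta> (u i)))"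
    by (simp add: sum_distrib_left mult.left_commute) (rule sum.swap)
  have "(\<Sum>i<n. \<Sum>l<n. f (x i) * (\<Sum>\<beta>\<in>T. c \<beta> * b \<beta> (u l)))
      = (\<Sum>i<n. \<Sum>\<beta>\<in>T. \<Sum>l<n. c \<beta> * (f (x i) * b \<beta> (u l)))"
    by (simp add: sum_distrib_left mult.left_commute) (intro sum.cong refl sum.swap)
  also have "\<dots> = (\<Sum>\<beta>\<in>T. c \<beta> * (\<Sum>i<n. \<Sum>l<n. f (x i) * b \<beta> (u l)))"
    by (subst sum.swap) (simp add: sum_distrib_left)
  finally show ?thesis unfolding emp_cov_def 1
    by (simp add: sum_distrib_left sum_subtractf right_diff_distrib mult.left_commute)
qed

lemma emp_cov_sum_left:
  "emp_cov n x u (\<lambda>v. \<Sum>m\<in>T. c m * e m v) g = (\<Sum>m\<in>T. c m * emp_cov n x u (e m) g)"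
  using emp_cov_sum_right[of n u x g c e T] by (simp add: emp_cov_commute[of n x u])

text \<open>Cauchy-Schwarz bounds the squared covariance by a product of two empirical variances.
  Since the values lie in [-1, 1], each variance is at most 1 minus the squared mean, and the other
  factor is at most 1. Large means thus force small covariances.\<close>

lemma emp_cov_sq_le:
  assumes n: "n > 0" and f: "\<And>i. i < n \<Longrightarrow> \<bar>f (x i)\<bar> \<le> 1" and g: "\<And>i. i < n \<Longrightarrow> \<bar>g (u i)\<bar> \<le> 1"
  shows "(emp_cov n x u f g)^2 \<le> 1 - ((\<Sum>i<n. f (x i)) / real n)^2"
    and "(emp_cov n x u f g)^2 \<le> 1 - ((\<Sum>i<n. g (u i)) / real n)^2"
proof -
  define a b where "a = (\<Sum>i<n. f (x i)) / real n" and "b = (\<Sum>i<n. g (u i)) / real n"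
  have var: "0 \<le> (\<Sum>i<n. (h i - c)^2) / real n \<and> (\<Sum>i<n. (h i - c)^2) / real n \<le> 1 - c^2"
    if h: "\<And>i. i < n \<Longrightarrow> \<bar>h i\<bar> \<le> 1" and c: "c = (\<Sum>i<n. h i) / real n" for h :: "nat \<Rightarrow> real" and c
  proof -
    have s: "(\<Sum>i<n. h i) = real n * c" using n c by simp
    have "(\<Sum>i<n. (h i - c)^2) = (\<Sum>i<n. (h i)^2) - 2 * c * (\<Sum>i<n. h i) + real n * c^2"
      by (simp add: power2_diff sum.distrib sum_subtractf sum_distrib_left mult_ac)
    also have "\<dots> \<le> real n - real n * c^2"
    proof -
      have "(\<Sum>i<n. (h i)^2) \<le> (\<Sum>i<n. 1)"
        using h by (intro sum_mono) (simp add: abs_square_le_1)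
      then show ?thesis unfolding s by (simp add: power2_eq_square)
    qed
    finally show ?thesis using n by (simp add: field_simps sum_nonneg)
  qed
  have va: "0 \<le> (\<Sum>i<n. (f (x i) - a)^2) / real n \<and> (\<Sum>i<n. (f (x i) - a)^2) / real n \<le> 1 - a^2"
    by (rule var) (auto simp: f a_def)
  have vb: "0 \<le> (\<Sum>i<n. (g (u i) - b)^2) / real n \<and> (\<Sum>i<n. (g (u i) - b)^2) / real n \<le> 1 - b^2"
    by (rule var) (auto simp: g b_def)
  have "emp_cov n x u f g = (\<Sum>i<n. (f (x i) - a) * (g (u i) - b)) / real n"
    by (subst emp_cov_centered[OF n, of _ _ _ _ a b]) (simp add: a_def)
  then have "(emp_cov n x u f g)^2
      \<le> ((\<Sum>i<n. (f (x i) - a)^2) / real n) * ((\<Sum>i<n. (g (u i) - b)^2) / real n)"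
    using divide_right_mono[OF Cauchy_Schwarz_ineq_sum[of "\<lambda>i. f (x i) - a" "\<lambda>i. g (u i) - b" "{..<n}"],
        of "(real n)^2"]
    by (simp only: power_divide times_divide_times_eq) (simp add: power2_eq_square)
  then have le: "(emp_cov n x u f g)^2 \<le> (1 - a^2) * (1 - b^2)"
    using va vb mult_mono[of "(\<Sum>i<n. (f (x i) - a)^2) / real n" "1 - a^2"
        "(\<Sum>i<n. (g (u i) - b)^2) / real n" "1 - b^2"] by linarith
  have "0 \<le> 1 - a^2" "0 \<le> 1 - b^2" using va vb by linarith+
  then have "(1 - a^2) * (1 - b^2) \<le> 1 - a^2" "(1 - a^2) * (1 - b^2) \<le> 1 - b^2"
    by (simp_all add: mult_left_le mult_left_le_one_le)
  with le show "(emp_cov n x u f g)^2 \<le> 1 - ((\<Sum>i<n. f (x i)) / real n)^2"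
    "(emp_cov n x u f g)^2 \<le> 1 - ((\<Sum>i<n. g (u i)) / real n)^2"
    unfolding a_def b_def by linarith+
qed

text \<open>The expression is bilinear in p and q, so its extremes over the square sit at corners:
  at most 1 + \<bar>a + b\<bar> + a b and at least - 1 - \<bar>a - b\<bar> + a b. As \<bar>a +
  b\<bar> + \<bar>a - b\<bar> = 2 max \<bar>a\<bar> \<bar>b\<bar>, the range is 2 (1 + m), where
  bounding the two products by their size would give 2 (1 + m)^2.\<close>

lemma product_oscillation:
  fixes p q p' q' a b m :: real
  assumes "\<bar>p\<bar> \<le> 1" "\<bar>q\<bar> \<le> 1" "\<bar>p'\<bar> \<le> 1" "\<bar>q'\<bar> \<le> 1" "\<bar>a\<bar> \<le> m" "\<bar>b\<bar> \<le> m" "m \<le> 1"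
  shows "(p - a) * (q - b) - (p' - a) * (q' - b) \<le> 2 * (1 + m)"
proof -
  have up: "p * q - b * p - a * q \<le> 1 + \<bar>a + b\<bar>" 
  proof -
    have "p * (q - b) \<le> \<bar>q - b\<bar>"
      using mult_right_mono[of "\<bar>p\<bar>" 1 "\<bar>q - b\<bar>"] assms(1) abs_ge_self[of "p * (q - b)"] by (simp add: abs_mult)
    moreover have "\<bar>q - b\<bar> - a * q \<le> 1 + \<bar>a + b\<bar>"
    proof (cases "q \<ge> b")
      case True
      have "q * (1 - a) \<le> 1 * (1 - a)" using assms by (intro mult_right_mono) auto
      then show ?thesis using True by (simp add: algebra_simps)
    next
      case False
      have "- q * (1 + a) \<le> 1 * (1 + a)" using assms by (intro mult_right_mono) auto
      then show ?thesis using False by (simp add: algebra_simps)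
    qed
    ultimately show ?thesis by (simp add: algebra_simps)
  qed
  have lo: "p' * q' - b * p' - a * q' \<ge> - 1 - \<bar>a - b\<bar>"
  proof -
    have "p' * (q' - b) \<ge> - \<bar>q' - b\<bar>"
      using mult_right_mono[of "\<bar>p'\<bar>" 1 "\<bar>q' - b\<bar>"] assms(3) abs_ge_minus_self[of "p' * (q' - b)"] by (simp add: abs_mult)
    moreover have "- \<bar>q' - b\<bar> - a * q' \<ge> - 1 - \<bar>a - b\<bar>"
    proof (cases "q' \<ge> b")
      case True
      have "q' * (1 + a) \<le> 1 * (1 + a)" using assms by (intro mult_right_mono) auto
      then show ?thesis using True by (simp add: algebra_simps)
    next
      case False
      have "- q' * (1 - a) \<le> 1 * (1 - a)" using assms by (intro mult_right_mono) auto
      then show ?thesis using False by (simp add: algebra_simps)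
    qed
    ultimately show ?thesis by (simp add: algebra_simps)
  qed
  have "\<bar>a + b\<bar> + \<bar>a - b\<bar> \<le> 2 * m" using assms by linarith
  with up lo show ?thesis by (simp add: algebra_simps)
qed

text \<open>Both covariances are centred at the means of the old sample. Then only summand
  \<open>k\<close> changes, which costs its oscillation over n, and the new sample has a product of
  two mean shifts of size at most 2 / n each, which gives 4 / n^2.\<close>

lemma emp_cov_update_diff:
  assumes n: "n > 0" and k: "k < n"
    and f: "\<And>i. i < n \<Longrightarrow> \<bar>f (x i)\<bar> \<le> 1" "\<bar>f w\<bar> \<le> 1"
    and g: "\<And>i. i < n \<Longrightarrow> \<bar>g (u i)\<bar> \<le> 1" "\<bar>g v\<bar> \<le> 1"
    and m: "\<bar>(\<Sum>i<n. f (x i)) / real n\<bar> \<le> m" "\<bar>(\<Sum>i<n. g (u i)) / real n\<bar> \<le> m" "m \<le> 1"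
  shows "emp_cov n x u f g - emp_cov n (x(k := w)) (u(k := v)) f g \<le> 2 * (1 + m) / real n + 4 / (real n)^2"
proof -
  define a b where "a = (\<Sum>i<n. f (x i)) / real n" and "b = (\<Sum>i<n. g (u i)) / real n"
  have upd: "(\<Sum>i<n. h ((x(k := w)) i) ((u(k := v)) i)) = (\<Sum>i<n. h (x i) (u i)) + h w v - h (x k) (u k)"
    for h :: "_ \<Rightarrow> _ \<Rightarrow> real"
  proof -
    have "(\<Sum>i\<in>{..<n} - {k}. h ((x(k := w)) i) ((u(k := v)) i)) = (\<Sum>i\<in>{..<n} - {k}. h (x i) (u i))"
      by (intro sum.cong) auto
    then show ?thesis
      using k sum.remove[of "{..<n}" k "\<lambda>i. h ((x(k := w)) i) ((u(k := v)) i)"]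
        sum.remove[of "{..<n}" k "\<lambda>i. h (x i) (u i)"] by simp
  qed
  have e1: "emp_cov n x u f g = (\<Sum>i<n. (f (x i) - a) * (g (u i) - b)) / real n"
    by (subst emp_cov_centered[OF n, of _ _ _ _ a b]) (simp add: a_def)
  have "(\<Sum>i<n. f ((x(k := w)) i)) = real n * a + f w - f (x k)"
    using upd[of "\<lambda>p q. f p"] n by (simp add: a_def del: fun_upd_apply)
  then have fa: "(\<Sum>i<n. f ((x(k := w)) i)) / real n - a = (f w - f (x k)) / real n"
    using n by (simp add: field_simps)
  have "(\<Sum>i<n. g ((u(k := v)) i)) = real n * b + g v - g (u k)"
    using upd[of "\<lambda>p q. g q"] n by (simp add: b_def del: fun_upd_apply)
  then have gb: "(\<Sum>i<n. g ((u(k := v)) i)) / real n - b = (g v - g (u k)) / real n"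
    using n by (simp add: field_simps)
  have e2: "emp_cov n (x(k := w)) (u(k := v)) f g
      = ((\<Sum>i<n. (f (x i) - a) * (g (u i) - b)) + (f w - a) * (g v - b) - (f (x k) - a) * (g (u k) - b)) / real n
        - (f w - f (x k)) / real n * ((g v - g (u k)) / real n)"
    by (subst emp_cov_centered[OF n, of _ _ _ _ a b])
       (simp only: fa gb upd[of "\<lambda>p q. (f p - a) * (g q - b)"])
  have "emp_cov n x u f g - emp_cov n (x(k := w)) (u(k := v)) f g
      = ((f (x k) - a) * (g (u k) - b) - (f w - a) * (g v - b)) / real n
        + (f w - f (x k)) * (g v - g (u k)) / (real n)^2"
    unfolding e1 e2 using n by (simp add: field_simps power2_eq_square)
  also have "\<dots> \<le> 2 * (1 + m) / real n + 4 / (real n)^2"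
  proof (intro add_mono divide_right_mono)
    show "(f (x k) - a) * (g (u k) - b) - (f w - a) * (g v - b) \<le> 2 * (1 + m)"
      using f g k m by (intro product_oscillation) (auto simp: a_def b_def)
    have "\<bar>f w - f (x k)\<bar> * \<bar>g v - g (u k)\<bar> \<le> 2 * 2"
      using f(1)[OF k] f(2) g(1)[OF k] g(2) by (intro mult_mono) auto
    then show "(f w - f (x k)) * (g v - g (u k)) \<le> 4"
      using abs_ge_self[of "(f w - f (x k)) * (g v - g (u k))"] by (simp add: abs_mult)
  qed auto
  finally show ?thesis .
qed

text \<open>The maximum is 27/16 = 1.6875, at m = 1/2, which is why (m - 1/2)^2 factors out. It is
  rounded up to 1.69 for its rational root 1.3, the source of both 2.6 = 2 * 1.3 and 5.2 = 4 *
  1.3.\<close>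

lemma mean_polynomial_bound:
  fixes m :: real
  assumes "0 \<le> m" "m \<le> 1"
  shows "(1 + m)^2 * (1 - m^2) \<le> 1.69"
proof -
  have "27/16 - (1 + m)^2 * (1 - m^2) = (m - 1/2)^2 * (m^2 + 3 * m + 11/4)"
    by (simp add: power2_eq_square field_simps)
  also have "\<dots> \<ge> 0" using assms by (intro mult_nonneg_nonneg) auto
  finally show ?thesis by simp
qed

section \<open>Reduction of a family of features to a single direction\<close>

lemma combination_abs_le_1:
  fixes c :: "'b \<Rightarrow> real"
  assumes "(\<Sum>\<beta>\<in>T. (c \<beta>)^2) \<le> 1" "(\<Sum>\<beta>\<in>T. (b \<beta>)^2) \<le> 1"
  shows "\<bar>\<Sum>\<beta>\<in>T. c \<beta> * b \<beta>\<bar> \<le> 1"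
proof -
  have "(\<Sum>\<beta>\<in>T. c \<beta> * b \<beta>)^2 \<le> (\<Sum>\<beta>\<in>T. (c \<beta>)^2) * (\<Sum>\<beta>\<in>T. (b \<beta>)^2)"
    by (rule Cauchy_Schwarz_ineq_sum)
  also have "\<dots> \<le> 1" using assms by (simp add: mult_le_one sum_nonneg)
  finally show ?thesis by (simp add: abs_square_le_1)
qed

text \<open>The Euclidean norm is attained as an inner product with a unit vector. Hence the norm of
  a vector of covariances with features is one covariance with a unit combination of them, which is
  again bounded by 1, and scalar estimates carry over to families.\<close>

lemma unit_direction:
  fixes c :: "'b \<Rightarrow> real"
  assumes "finite T" and ne: "(\<Sum>\<beta>\<in>T. (c \<beta>)^2) \<noteq> 0"
  obtains d where "(\<Sum>\<beta>\<in>T. (d \<beta>)^2) = 1" "(\<Sum>\<beta>\<in>T. d \<beta> * c \<beta>) = sqrt (\<Sum>\<beta>\<in>T. (c \<beta>)^2)"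
    "\<And>\<beta>. c \<beta> = sqrt (\<Sum>\<beta>\<in>T. (c \<beta>)^2) * d \<beta>"
proof
  let ?s = "\<Sum>\<beta>\<in>T. (c \<beta>)^2"
  have s: "?s > 0" using ne sum_nonneg[of T "\<lambda>\<beta>. (c \<beta>)^2"] by fastforce
  show "(\<Sum>\<beta>\<in>T. (c \<beta> / sqrt ?s)^2) = 1"
    using s by (simp add: power_divide flip: sum_divide_distrib)
  have "(\<Sum>\<beta>\<in>T. c \<beta> / sqrt ?s * c \<beta>) = ?s / sqrt ?s"
    by (simp add: power2_eq_square sum_divide_distrib)
  then show "(\<Sum>\<beta>\<in>T. c \<beta> / sqrt ?s * c \<beta>) = sqrt ?s" using s by (simp add: real_div_sqrt)
  show "c \<beta> = sqrt ?s * (c \<beta> / sqrt ?s)" for \<beta> using s by simp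
qed

lemma emp_dep_le_1:
  assumes n: "n > 0" and T: "finite T"
    and f: "\<And>i. i < n \<Longrightarrow> \<bar>f (x i)\<bar> \<le> 1"
    and b: "\<And>i. i < n \<Longrightarrow> (\<Sum>\<beta>\<in>T. (b \<beta> (u i))^2) \<le> 1"
  shows "emp_dep n x u f b T \<le> 1"
proof (cases "emp_dep n x u f b T = 0")
  case False
  let ?s = "\<Sum>\<beta>\<in>T. (emp_cov n x u f (b \<beta>))^2"
  obtain d where d: "(\<Sum>\<beta>\<in>T. (d \<beta>)^2) = 1" "(\<Sum>\<beta>\<in>T. d \<beta> * emp_cov n x u f (b \<beta>)) = sqrt ?s"
    using unit_direction[OF T False] by metis
  have "emp_cov n x u f (\<lambda>v. \<Sum>\<beta>\<in>T. d \<beta> * b \<beta> v) = sqrt ?s"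
    unfolding emp_cov_sum_right d(2) ..
  moreover have "(emp_cov n x u f (\<lambda>v. \<Sum>\<beta>\<in>T. d \<beta> * b \<beta> v))^2
      \<le> 1 - ((\<Sum>i<n. f (x i)) / real n)^2"
    using f d(1) b by (intro emp_cov_sq_le n combination_abs_le_1) auto
  ultimately have "?s \<le> 1 - ((\<Sum>i<n. f (x i)) / real n)^2" by (simp add: sum_nonneg)
  then show ?thesis by (smt (verit) zero_le_power2)
qed simp

text \<open>The constant 5.2 exceeds the maximum \<open>3 * sqrt 3\<close> of \<open>4 (1 + m) sqrt (1 - m^2)\<close>: a large
  mean m of the sample widens the range of a summand but shrinks the covariance.\<close>

lemma emp_dep_update_diff:
  assumes n: "n > 0" and k: "k < n" and T: "finite T"
    and f: "\<And>i. i < n \<Longrightarrow> \<bar>f (x i)\<bar> \<le> 1" "\<bar>f w\<bar> \<le> 1"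
    and b: "\<And>i. i < n \<Longrightarrow> (\<Sum>\<beta>\<in>T. (b \<beta> (u i))^2) \<le> 1" "(\<Sum>\<beta>\<in>T. (b \<beta> v)^2) \<le> 1"
  shows "emp_dep n x u f b T - emp_dep n (x(k := w)) (u(k := v)) f b T
     \<le> 5.2 / real n + 8 / (real n)^2"
proof (cases "emp_dep n x u f b T = 0")
  case True
  have "0 \<le> emp_dep n (x(k := w)) (u(k := v)) f b T" by (intro sum_nonneg) simp
  moreover have "0 \<le> 5.2 / real n + 8 / (real n)^2" by simp
  ultimately show ?thesis unfolding True by linarith
next
  case False
  define \<rho> where "\<rho> = sqrt (emp_dep n x u f b T)"
  \<comment> \<open>\<open>d\<close> is the direction of the old covariance vector and is kept for
    the new sample. There the projection \<open>\<rho>'\<close> on \<open>d\<close> bounds the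
    length of the new vector only from below, which is the side that an upper bound on old minus new
    requires.\<close>
  obtain d where d: "(\<Sum>\<beta>\<in>T. (d \<beta>)^2) = 1" "(\<Sum>\<beta>\<in>T. d \<beta> * emp_cov n x u f (b \<beta>)) = \<rho>"
    "\<And>\<beta>. emp_cov n x u f (b \<beta>) = \<rho> * d \<beta>"
    using unit_direction[OF T False, folded \<rho>_def] by blast
  define g where "g v = (\<Sum>\<beta>\<in>T. d \<beta> * b \<beta> v)" for v
  have g1: "\<bar>g (u i)\<bar> \<le> 1" if "i < n" for i
    unfolding g_def using d(1) b(1)[OF that] by (intro combination_abs_le_1) auto
  have g2: "\<bar>g v\<bar> \<le> 1"
    unfolding g_def using d(1) b(2) by (intro combination_abs_le_1) auto
  have r1: "emp_cov n x u f g = \<rho>" unfolding g_def emp_cov_sum_right d(2) ..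
  define \<rho>' where "\<rho>' = emp_cov n (x(k := w)) (u(k := v)) f g"
  have r2: "\<rho>' = (\<Sum>\<beta>\<in>T. d \<beta> * emp_cov n (x(k := w)) (u(k := v)) f (b \<beta>))"
    unfolding \<rho>'_def g_def emp_cov_sum_right ..
  have rho0: "\<rho> \<ge> 0" by (simp add: \<rho>_def sum_nonneg)
  define m where "m = max \<bar>(\<Sum>i<n. f (x i)) / real n\<bar> \<bar>(\<Sum>i<n. g (u i)) / real n\<bar>"
  have rhom: "\<rho>^2 \<le> 1 - m^2"
    using emp_cov_sq_le[OF n, of f x g u] f(1) g1 unfolding r1 m_def max_def by (auto simp del: abs_divide)
  have m0: "0 \<le> m" by (simp add: m_def le_max_iff_disj)
  have "m^2 \<le> 1" using rhom zero_le_power2[of \<rho>] by linarith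
  then have m1: "m \<le> 1" using m0 by (simp add: abs_square_le_1)
  have "(\<rho> * (1 + m))^2 \<le> (1 + m)^2 * (1 - m^2)"
    using mult_left_mono[OF rhom, of "(1 + m)^2"] by (simp add: power_mult_distrib mult.commute)
  also have "\<dots> \<le> 1.3^2" using mean_polynomial_bound[OF m0 m1] by (simp add: power2_eq_square)
  finally have rm: "\<rho> * (1 + m) \<le> 1.3" by (rule power2_le_imp_le) simp
  have "\<rho>^2 \<le> 1" using rhom by (smt (verit) zero_le_power2)
  then have rho1: "\<rho> \<le> 1" using rho0 by (simp add: abs_square_le_1)
  have diff: "\<rho> - \<rho>' \<le> 2 * (1 + m) / real n + 4 / (real n)^2"
    unfolding \<rho>'_def r1[symmetric]
    by (rule emp_cov_update_diff) (use n k f g1 g2 m1 in \<open>auto simp: m_def\<close>)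
  have "emp_dep n x u f b T - emp_dep n (x(k := w)) (u(k := v)) f b T
      = (\<Sum>\<beta>\<in>T. (\<rho> * d \<beta>)^2 - (emp_cov n (x(k := w)) (u(k := v)) f (b \<beta>))^2)"
    by (simp add: sum_subtractf d(3))
  \<comment> \<open>The square lies above its tangent at the old value: p^2 - e^2 \<le> 2 p (p - e).
    Summation turns the right-hand side into 2 * \<open>\<rho>\<close> * (\<open>\<rho>\<close> -
    \<open>\<rho>'\<close>), so the factor \<open>\<rho>\<close>, small when the means are large, is
    retained.\<close>
  also have "\<dots> \<le> (\<Sum>\<beta>\<in>T. 2 * \<rho> * (\<rho> * (d \<beta>)^2 - d \<beta> * emp_cov n (x(k := w)) (u(k := v)) f (b \<beta>)))"
  proof (rule sum_mono)
    fix \<beta>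
    let ?e = "emp_cov n (x(k := w)) (u(k := v)) f (b \<beta>)"
    have "0 \<le> (\<rho> * d \<beta> - ?e)^2" by simp
    then show "(\<rho> * d \<beta>)^2 - ?e^2 \<le> 2 * \<rho> * (\<rho> * (d \<beta>)^2 - d \<beta> * ?e)"
      by (simp add: power2_eq_square algebra_simps)
  qed
  also have "\<dots> = 2 * \<rho> * (\<rho> * (\<Sum>\<beta>\<in>T. (d \<beta>)^2) - \<rho>')"
    unfolding r2 by (simp add: sum_distrib_left sum_subtractf right_diff_distrib)
  also have "\<dots> = 2 * \<rho> * (\<rho> - \<rho>')" by (simp add: d(1))
  also have "\<dots> \<le> 2 * \<rho> * (2 * (1 + m) / real n + 4 / (real n)^2)"
    using diff rho0 by (intro mult_left_mono) auto
  also have "\<dots> = 4 * (\<rho> * (1 + m)) / real n + 8 * \<rho> / (real n)^2"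
    by (simp add: algebra_simps)
  also have "\<dots> \<le> 4 * 1.3 / real n + 8 * 1 / (real n)^2"
    using rm rho1 by (intro add_mono divide_right_mono mult_left_mono) auto
  finally show ?thesis by simp
qed

section \<open>Covariances with finite families of features\<close>

lemma (in prob_space) integrable_bounded:
  assumes "f \<in> borel_measurable M" "\<And>z. z \<in> space M \<Longrightarrow> \<bar>f z\<bar> \<le> (K :: real)"
  shows "integrable M f"
  using assms by (intro integrable_const_bound[where B = K] AE_I2) auto

lemma (in prob_space) cov_eq:
  assumes "integrable M f" "integrable M g" "integrable M (\<lambda>z. f z * g z)"
  shows "cov M f g = (\<integral>z. f z * g z \<partial>M) - expectation f * expectation g"
proof -
  have "cov M f g = (\<integral>z. f z * g z - expectation f * g z - expectation g * f z
      + expectation f * expectation g \<partial>M)"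
    unfolding cov_def by (intro Bochner_Integration.integral_cong refl) (simp add: algebra_simps)
  also have "\<dots> = (\<integral>z. f z * g z \<partial>M) - expectation f * expectation g"
    using assms by (simp add: prob_space)
  finally show ?thesis .
qed

lemma cov_commute: "cov M f g = cov M g f"
  unfolding cov_def by (simp add: mult.commute)

lemma (in prob_space) cov_sum_right:
  assumes "finite T" and f: "f \<in> borel_measurable M" "\<And>z. z \<in> space M \<Longrightarrow> \<bar>f z\<bar> \<le> K"
    and b: "\<And>\<beta>. \<beta> \<in> T \<Longrightarrow> b \<beta> \<in> borel_measurable M"
      "\<And>\<beta> z. \<beta> \<in> T \<Longrightarrow> z \<in> space M \<Longrightarrow> \<bar>b \<beta> z\<bar> \<le> L"
  shows "cov M f (\<lambda>z. \<Sum>\<beta>\<in>T. c \<beta> * b \<beta> z) = (\<Sum>\<beta>\<in>T. c \<beta> * cov M f (b \<beta>))"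
proof -
  have fi: "integrable M f" by (rule integrable_bounded[OF f])
  have bi: "integrable M (b \<beta>)" if "\<beta> \<in> T" for \<beta>
    by (rule integrable_bounded[OF b(1)[OF that] b(2)[OF that]])
  have fbi: "integrable M (\<lambda>z. f z * b \<beta> z)" if T: "\<beta> \<in> T" for \<beta>
  proof (rule integrable_bounded[where K = "K * L"])
    show "(\<lambda>z. f z * b \<beta> z) \<in> borel_measurable M" using f b T by measurable
    show "\<bar>f z * b \<beta> z\<bar> \<le> K * L" if z: "z \<in> space M" for z
      unfolding abs_mult using f(2)[OF z] b(2)[OF T z] by (intro mult_mono) auto
  qed
  have "cov M f (\<lambda>z. \<Sum>\<beta>\<in>T. c \<beta> * b \<beta> z)
      = (\<integral>z. f z * (\<Sum>\<beta>\<in>T. c \<beta> * b \<beta> z) \<partial>M) - expectation f * (\<integral>z. (\<Sum>\<beta>\<in>T. c \<beta> * b \<beta> z) \<partial>M)"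
    using fi bi fbi by (intro cov_eq) (auto simp: sum_distrib_left mult.left_commute)
  also have "\<dots> = (\<Sum>\<beta>\<in>T. c \<beta> * ((\<integral>z. f z * b \<beta> z \<partial>M) - expectation f * expectation (b \<beta>)))"
    using bi fbi
    by (simp add: sum_distrib_left mult.left_commute sum_subtractf right_diff_distrib)
  also have "\<dots> = (\<Sum>\<beta>\<in>T. c \<beta> * cov M f (b \<beta>))"
    by (intro sum.cong refl) (simp only: cov_eq[OF fi bi fbi])
  finally show ?thesis .
qed

lemma (in prob_space) cov_sum_left:
  assumes "finite T" and "f \<in> borel_measurable M" "\<And>z. z \<in> space M \<Longrightarrow> \<bar>f z\<bar> \<le> K"
    and "\<And>\<beta>. \<beta> \<in> T \<Longrightarrow> b \<beta> \<in> borel_measurable M"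
      "\<And>\<beta> z. \<beta> \<in> T \<Longrightarrow> z \<in> space M \<Longrightarrow> \<bar>b \<beta> z\<bar> \<le> L"
  shows "cov M (\<lambda>z. \<Sum>\<beta>\<in>T. c \<beta> * b \<beta> z) f = (\<Sum>\<beta>\<in>T. c \<beta> * cov M (b \<beta>) f)"
  using cov_sum_right[OF assms, where c = c] by (simp only: cov_commute[of M _ f])

lemma (in prob_space) cov_abs_le_1:
  assumes f: "f \<in> borel_measurable M" "\<And>z. z \<in> space M \<Longrightarrow> \<bar>f z\<bar> \<le> 1"
    and g: "g \<in> borel_measurable M" "\<And>z. z \<in> space M \<Longrightarrow> \<bar>g z\<bar> \<le> 1"
  shows "\<bar>cov M f g\<bar> \<le> 1"
proof -
  have var: "integrable M (\<lambda>z. (h z - expectation h)^2) \<and> (\<integral>z. (h z - expectation h)^2 \<partial>M) \<le> 1"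
    if h: "h \<in> borel_measurable M" "\<And>z. z \<in> space M \<Longrightarrow> \<bar>h z\<bar> \<le> 1" for h :: "'a \<Rightarrow> real"
  proof -
    have hi: "integrable M h" by (rule integrable_bounded[OF h])
    have h2: "integrable M (\<lambda>z. (h z)^2)"
      using h by (intro integrable_bounded[where K = 1]) (auto simp: abs_square_le_1)
    have "(\<integral>z. (h z)^2 \<partial>M) \<le> (\<integral>z. 1 \<partial>M)"
      using h h2 by (intro integral_mono) (auto simp: abs_square_le_1)
    then have "(\<integral>z. (h z)^2 \<partial>M) \<le> 1" by (simp add: prob_space)
    moreover have "variance h = (\<integral>z. (h z)^2 \<partial>M) - expectation h^2"
      by (rule variance_eq[OF hi h2])
    moreover have "0 \<le> expectation h^2" by simp
    ultimately have "variance h \<le> 1" by linarith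
    moreover have "integrable M (\<lambda>z. (h z - expectation h)^2)"
      using hi h2 by (simp add: power2_diff)
    ultimately show ?thesis by blast
  qed
  let ?f = "\<lambda>z. f z - expectation f" and ?g = "\<lambda>z. g z - expectation g"
  have "\<bar>cov M f g\<bar> \<le> (\<integral>z. \<bar>?f z * ?g z\<bar> \<partial>M)"
    unfolding cov_def by (rule integral_abs_bound)
  \<comment> \<open>Both variances are at most 1, so the arithmetic-geometric mean inequality gives
    the same constant as Cauchy-Schwarz.\<close>
  also have "\<dots> \<le> (\<integral>z. (?f z)^2 / 2 + (?g z)^2 / 2 \<partial>M)"
  proof (intro integral_mono')
    show "integrable M (\<lambda>z. (?f z)^2 / 2 + (?g z)^2 / 2)" using var[OF f] var[OF g] by auto
    show "\<bar>?f z * ?g z\<bar> \<le> (?f z)^2 / 2 + (?g z)^2 / 2" for z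
    proof -
      have "2 * \<bar>p * q\<bar> \<le> p^2 + q^2" for p q :: real
        using sum_squares_bound[of "\<bar>p\<bar>" "\<bar>q\<bar>"] by (simp add: abs_mult)
      from this[of "?f z" "?g z"] show ?thesis by linarith
    qed
  qed auto
  also have "\<dots> \<le> 1" using var[OF f] var[OF g] by simp
  finally show ?thesis .
qed

text \<open>A feature map into the closed unit ball of a Euclidean space. One notion serves the
  output bases, normalised by the bound 1 on their kernels, and the input functions, normalised by
  M. Every later constant is independent of the size of \<open>T\<close>.\<close>

definition unit_features :: "'a measure \<Rightarrow> 'b set \<Rightarrow> ('b \<Rightarrow> 'a \<Rightarrow> real) \<Rightarrow> bool" where
  "unit_features M T b \<longleftrightarrow> finite T \<and> (\<forall>\<beta>\<in>T. b \<beta> \<in> borel_measurable M) \<and>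
     (\<forall>z\<in>space M. (\<Sum>\<beta>\<in>T. (b \<beta> z)^2) \<le> 1)"

lemma unit_featuresD:
  assumes "unit_features M T b"
  shows "finite T" "\<beta> \<in> T \<Longrightarrow> b \<beta> \<in> borel_measurable M"
    "z \<in> space M \<Longrightarrow> (\<Sum>\<beta>\<in>T. (b \<beta> z)^2) \<le> 1"
    "z \<in> space M \<Longrightarrow> \<beta> \<in> T \<Longrightarrow> \<bar>b \<beta> z\<bar> \<le> 1"
proof -
  show 1: "finite T" "\<beta> \<in> T \<Longrightarrow> b \<beta> \<in> borel_measurable M"
    "z \<in> space M \<Longrightarrow> (\<Sum>\<beta>\<in>T. (b \<beta> z)^2) \<le> 1"
    using assms by (auto simp: unit_features_def)
  assume "z \<in> space M" "\<beta> \<in> T"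
  then have "(b \<beta> z)^2 \<le> 1"
    using 1 member_le_sum[of \<beta> T "\<lambda>\<beta>. (b \<beta> z)^2"] by fastforce
  then show "\<bar>b \<beta> z\<bar> \<le> 1" by (simp add: abs_square_le_1)
qed

lemma (in prob_space) dep_le_1:
  assumes b: "unit_features M T b"
    and f: "f \<in> borel_measurable M" "\<And>z. z \<in> space M \<Longrightarrow> \<bar>f z\<bar> \<le> 1"
  shows "pop_dep M f b T \<le> 1"
proof (cases "pop_dep M f b T = 0")
  case False
  note T = unit_featuresD[OF b]
  let ?s = "\<Sum>\<beta>\<in>T. (cov M f (b \<beta>))^2"
  obtain d where d: "(\<Sum>\<beta>\<in>T. (d \<beta>)^2) = 1" "(\<Sum>\<beta>\<in>T. d \<beta> * cov M f (b \<beta>)) = sqrt ?s"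
    using unit_direction[OF T(1) False] by metis
  have "cov M f (\<lambda>v. \<Sum>\<beta>\<in>T. d \<beta> * b \<beta> v) = sqrt ?s"
    unfolding d(2)[symmetric] using T f by (intro cov_sum_right) auto
  moreover have "\<bar>cov M f (\<lambda>v. \<Sum>\<beta>\<in>T. d \<beta> * b \<beta> v)\<bar> \<le> 1"
    using f d(1) T by (intro cov_abs_le_1 combination_abs_le_1 borel_measurable_sum borel_measurable_times) auto
  ultimately show ?thesis by (simp add: sum_nonneg)
qed simp

text \<open>\<open>p\<close> is the length of the mean feature vector. Centring can enlarge a
  feature vector to length 1 + p, but reduces the total variance to 1 - p^2: the population form of
  the trade-off between large means and small covariances.\<close>

lemma (in prob_space) centered_features:
  assumes b: "unit_features M T b"
  defines "p \<equiv> L2_set (\<lambda>\<beta>. \<integral>z. b \<beta> z \<partial>M) T"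
  shows "0 \<le> p" "p \<le> 1"
    "z \<in> space M \<Longrightarrow> (\<Sum>\<beta>\<in>T. (b \<beta> z - expectation (b \<beta>))^2) \<le> (1 + p)^2"
    "integrable M (\<lambda>z. \<Sum>\<beta>\<in>T. (b \<beta> z - expectation (b \<beta>))^2)"
    "(\<integral>z. (\<Sum>\<beta>\<in>T. (b \<beta> z - expectation (b \<beta>))^2) \<partial>M) \<le> 1 - p^2"
proof -
  let ?V = "\<lambda>z. \<Sum>\<beta>\<in>T. (b \<beta> z - expectation (b \<beta>))^2"
  note T = unit_featuresD[OF b]
  have bi: "integrable M (b \<beta>)" if "\<beta> \<in> T" for \<beta>
    using T that by (intro integrable_bounded[where K = 1]) auto
  have b2: "integrable M (\<lambda>z. (b \<beta> z)^2)" if "\<beta> \<in> T" for \<beta>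
    using T that by (intro integrable_bounded[where K = 1]) (auto simp: abs_square_le_1)
  have bc: "integrable M (\<lambda>z. (b \<beta> z - expectation (b \<beta>))^2)" if "\<beta> \<in> T" for \<beta>
    using bi[OF that] b2[OF that] by (simp add: power2_diff)
  show p0: "0 \<le> p" by (simp add: p_def)
  show "integrable M (\<lambda>z. \<Sum>\<beta>\<in>T. (b \<beta> z - expectation (b \<beta>))^2)"
    using bc by (intro Bochner_Integration.integrable_sum) auto
  have "(\<integral>z. ?V z \<partial>M) = (\<Sum>\<beta>\<in>T. variance (b \<beta>))"
    using bc by (intro Bochner_Integration.integral_sum) auto
  also have "\<dots> = (\<Sum>\<beta>\<in>T. (\<integral>z. (b \<beta> z)^2 \<partial>M)) - p^2"
    using bi b2 by (simp add: variance_eq sum_subtractf p_def L2_set_def sum_nonneg)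
  also have "(\<Sum>\<beta>\<in>T. (\<integral>z. (b \<beta> z)^2 \<partial>M)) = (\<integral>z. (\<Sum>\<beta>\<in>T. (b \<beta> z)^2) \<partial>M)"
    using b2 by (intro Bochner_Integration.integral_sum[symmetric]) auto
  also have "\<dots> \<le> (\<integral>z. 1 \<partial>M)"
    using T b2 by (intro integral_mono Bochner_Integration.integrable_sum) auto
  finally show v: "(\<integral>z. ?V z \<partial>M) \<le> 1 - p^2"
    by (simp add: prob_space)
  moreover have "0 \<le> (\<integral>z. ?V z \<partial>M)"
    by (intro integral_nonneg_AE AE_I2 sum_nonneg) simp
  ultimately have "p^2 \<le> 1" by linarith
  then show "p \<le> 1" using p0 by (simp add: abs_square_le_1)
  assume z: "z \<in> space M"
  have "L2_set (\<lambda>\<beta>. b \<beta> z + - expectation (b \<beta>)) T \<le> L2_set (\<lambda>\<beta>. b \<beta> z) T + L2_set (\<lambda>\<beta>. - expectation (b \<beta>)) T"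
    by (rule L2_set_triangle_ineq)
  also have "L2_set (\<lambda>\<beta>. - expectation (b \<beta>)) T = p" by (simp add: p_def L2_set_def)
  also have "L2_set (\<lambda>\<beta>. b \<beta> z) T \<le> 1" using T(3)[OF z] by (simp add: L2_set_def)
  finally have "(L2_set (\<lambda>\<beta>. b \<beta> z - expectation (b \<beta>)) T)^2 \<le> (1 + p)^2"
    by (intro power_mono) auto
  then show "?V z \<le> (1 + p)^2"
    by (simp add: L2_set_def sum_nonneg)
qed

text \<open>One factor is bounded uniformly and the other in mean. Taking the uniform bound for the
  family with the shorter mean vector allows both lengths to be replaced by the longer one, and the
  polynomial (1 + m)^2 (1 - m^2) reappears.\<close>

lemma (in prob_space) centered_features_product:
  assumes e: "unit_features M S e" and b: "unit_features M T b"
  defines "E \<equiv> \<lambda>z. \<Sum>m\<in>S. (e m z - expectation (e m))^2"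
    and "B \<equiv> \<lambda>z. \<Sum>\<beta>\<in>T. (b \<beta> z - expectation (b \<beta>))^2"
  shows "integrable M (\<lambda>z. E z * B z)" "(\<integral>z. E z * B z \<partial>M) \<le> 1.69"
proof -
  define p q where "p = L2_set (\<lambda>m. \<integral>z. e m z \<partial>M) S" and "q = L2_set (\<lambda>\<beta>. \<integral>z. b \<beta> z \<partial>M) T"
  note P = centered_features[OF e, folded p_def] and Q = centered_features[OF b, folded q_def]
  have E0: "0 \<le> E z" and B0: "0 \<le> B z" for z by (auto simp: E_def B_def intro: sum_nonneg)
  have EB: "E z \<le> (1 + p)^2" "B z \<le> (1 + q)^2" if "z \<in> space M" for z
    using P(3) Q(3) that by (auto simp: E_def B_def)
  have Ei: "integrable M E" and Bi: "integrable M B" using P(4) Q(4) by (auto simp: E_def B_def)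
  have m[measurable]: "E \<in> borel_measurable M" "B \<in> borel_measurable M" using Ei Bi by auto
  show i: "integrable M (\<lambda>z. E z * B z)"
  proof (rule integrable_bounded[where K = "(1 + p)^2 * (1 + q)^2"])
    show "\<bar>E z * B z\<bar> \<le> (1 + p)^2 * (1 + q)^2" if z: "z \<in> space M" for z
      unfolding abs_mult using EB[OF z] E0[of z] B0[of z] by (intro mult_mono) auto
  qed measurable
  show "(\<integral>z. E z * B z \<partial>M) \<le> 1.69"
  proof (cases "q \<le> p")
    case True
    have "(\<integral>z. E z * B z \<partial>M) \<le> (\<integral>z. E z * (1 + q)^2 \<partial>M)"
      using EB(2) E0 Ei i by (intro integral_mono mult_left_mono) auto
    also have "\<dots> \<le> (1 - p^2) * (1 + q)^2" using P(5) by (simp add: E_def mult_right_mono)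
    also have "\<dots> \<le> (1 - p^2) * (1 + p)^2"
      using True P(1,2) Q(1) by (intro mult_left_mono power_mono) (auto simp: abs_square_le_1)
    also have "\<dots> \<le> 1.69" using mean_polynomial_bound[OF P(1,2)] by (simp add: mult.commute)
    finally show ?thesis .
  next
    case False
    have "(\<integral>z. E z * B z \<partial>M) \<le> (\<integral>z. (1 + p)^2 * B z \<partial>M)"
      using EB(1) B0 Bi i by (intro integral_mono mult_right_mono) auto
    also have "\<dots> \<le> (1 + p)^2 * (1 - q^2)" using Q(5) by (simp add: B_def mult_left_mono)
    also have "\<dots> \<le> (1 + q)^2 * (1 - q^2)"
      using False P(1) Q(1,2) by (intro mult_right_mono power_mono) (auto simp: abs_square_le_1)
    also have "\<dots> \<le> 1.69" using mean_polynomial_bound[OF Q(1,2)] .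
    finally show ?thesis .
  qed
qed

section \<open>Expected deviation\<close>

lemma space_PiM_component:
  assumes "z \<in> space (Pi\<^sub>M I (\<lambda>_. M))" "i \<in> I"
  shows "z i \<in> space M"
  using assms by (auto simp: space_PiM)

lemma (in prob_space) sample_mean_second_moment:
  fixes h :: "'a \<Rightarrow> real"
  assumes n: "n > 0" and h: "h \<in> borel_measurable M" "\<And>x. x \<in> space M \<Longrightarrow> \<bar>h x\<bar> \<le> K"
    and h0: "expectation h = 0"
  shows "integrable (samples n M) (\<lambda>z. ((\<Sum>i<n. h (z i)) / real n)^2)"
    and "(\<integral>z. ((\<Sum>i<n. h (z i)) / real n)^2 \<partial>samples n M) = (\<integral>x. (h x)^2 \<partial>M) / real n"
proof -
  interpret Q: prob_space "samples n M" by (intro prob_space_PiM) unfold_locales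
  note [measurable] = h(1)
  show "integrable (samples n M) (\<lambda>z. ((\<Sum>i<n. h (z i)) / real n)^2)"
  proof (rule Q.integrable_bounded[where K = "K^2"])
    fix z assume z: "z \<in> space (samples n M)"
    have "\<bar>\<Sum>i<n. h (z i)\<bar> \<le> (\<Sum>i<n. \<bar>h (z i)\<bar>)" by (rule sum_abs)
    also have "\<dots> \<le> (\<Sum>i<n. K)" using space_PiM_component[OF z] h(2) by (intro sum_mono) auto
    finally have "\<bar>(\<Sum>i<n. h (z i)) / real n\<bar> \<le> K" using n by (simp add: field_simps)
    then have "\<bar>(\<Sum>i<n. h (z i)) / real n\<bar> \<le> \<bar>K\<bar>" by linarith
    then show "\<bar>((\<Sum>i<n. h (z i)) / real n)^2\<bar> \<le> K^2" by (simp only: abs_le_square_iff) simp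
  qed measurable
  have "(\<integral>z. ((\<Sum>i<n. h (z i)) / real n)^2 \<partial>samples n M)
      = (\<integral>z. (\<Sum>i<n. h (z i))^2 \<partial>samples n M) / (real n)^2"
    by (simp add: power_divide)
  also have "\<dots> = real n * (\<integral>x. (h x)^2 \<partial>M) / (real n)^2"
    by (subst PiM_second_moment[OF _ _ h h0]) (auto intro: prob_space_axioms)
  finally show "(\<integral>z. ((\<Sum>i<n. h (z i)) / real n)^2 \<partial>samples n M) = (\<integral>x. (h x)^2 \<partial>M) / real n"
    using n by (simp add: power2_eq_square)
qed

lemma (in prob_space) centered_feature:
  assumes b: "unit_features M T b" and T: "\<beta> \<in> T"
  shows "(\<lambda>z. b \<beta> z - expectation (b \<beta>)) \<in> borel_measurable M"
    "z \<in> space M \<Longrightarrow> \<bar>b \<beta> z - expectation (b \<beta>)\<bar> \<le> 2"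
    "(\<integral>z. b \<beta> z - expectation (b \<beta>) \<partial>M) = 0"
    "\<bar>\<integral>z. b \<beta> z \<partial>M\<bar> \<le> 1"
    "integrable M (\<lambda>z. (b \<beta> z - expectation (b \<beta>))^2)"
proof -
  note D = unit_featuresD[OF b]
  have bi: "integrable M (b \<beta>)" using D T by (intro integrable_bounded[where K = 1]) auto
  show m[measurable]: "(\<lambda>z. b \<beta> z - expectation (b \<beta>)) \<in> borel_measurable M" using D(2)[OF T] by measurable
  have "\<bar>\<integral>z. b \<beta> z \<partial>M\<bar> \<le> (\<integral>z. \<bar>b \<beta> z\<bar> \<partial>M)" by (rule integral_abs_bound)
  also have "\<dots> \<le> (\<integral>z. 1 \<partial>M)" using D T bi by (intro integral_mono) auto
  finally show 1: "\<bar>\<integral>z. b \<beta> z \<partial>M\<bar> \<le> 1" by (simp add: prob_space)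
  show 2: "z \<in> space M \<Longrightarrow> \<bar>b \<beta> z - expectation (b \<beta>)\<bar> \<le> 2" for z using 1 D(4)[of z \<beta>] T by linarith
  show "(\<integral>z. b \<beta> z - expectation (b \<beta>) \<partial>M) = 0" using bi by (simp add: prob_space)
  show "integrable M (\<lambda>z. (b \<beta> z - expectation (b \<beta>))^2)"
  proof (rule integrable_bounded[where K = 4])
    fix z assume "z \<in> space M"
    then show "\<bar>(b \<beta> z - expectation (b \<beta>))^2\<bar> \<le> 4"
      using power_mono[OF 2, of z 2] by simp
  qed measurable
qed

definition mean_error :: "'a measure \<Rightarrow> nat \<Rightarrow> ('a \<Rightarrow> real) \<Rightarrow> (nat \<Rightarrow> 'a) \<Rightarrow> real" where
  "mean_error M n f z = (\<Sum>i<n. f (z i)) / real n - (\<integral>x. f x \<partial>M)"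

lemma (in prob_space) sample_mean_features:
  assumes n: "n > 0" and b: "unit_features M T b"
  shows "integrable (samples n M) (\<lambda>z. \<Sum>\<beta>\<in>T. (mean_error M n (b \<beta>) z)^2)"
    and "(\<integral>z. (\<Sum>\<beta>\<in>T. (mean_error M n (b \<beta>) z)^2) \<partial>samples n M) \<le> 1 / real n"
proof -
  let ?Q = "samples n M"
  have eq: "mean_error M n (b \<beta>) z = (\<Sum>i<n. b \<beta> (z i) - expectation (b \<beta>)) / real n" for z \<beta>
    unfolding mean_error_def using n by (simp add: sum_subtractf field_simps)
  have S: "integrable ?Q (\<lambda>z. (mean_error M n (b \<beta>) z)^2)"
    "(\<integral>z. (mean_error M n (b \<beta>) z)^2 \<partial>?Q)
      = variance (b \<beta>) / real n" if "\<beta> \<in> T" for \<beta>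
    unfolding eq using sample_mean_second_moment[OF n centered_feature(1,2,3)[OF b that]] by auto
  show "integrable ?Q (\<lambda>z. \<Sum>\<beta>\<in>T. (mean_error M n (b \<beta>) z)^2)"
    using S(1) by (intro Bochner_Integration.integrable_sum) auto
  have "(\<integral>z. (\<Sum>\<beta>\<in>T. (mean_error M n (b \<beta>) z)^2) \<partial>?Q)
      = (\<Sum>\<beta>\<in>T. variance (b \<beta>) / real n)"
    using S by (simp add: Bochner_Integration.integral_sum)
  also have "\<dots> = (\<integral>z. (\<Sum>\<beta>\<in>T. (b \<beta> z - expectation (b \<beta>))^2) \<partial>M) / real n"
    using centered_feature(5)[OF b] by (simp add: Bochner_Integration.integral_sum sum_divide_distrib)
  also have "\<dots> \<le> 1 / real n"
    using centered_features(5)[OF b] by (intro divide_right_mono) (smt (verit) zero_le_power2, simp)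
  finally show "(\<integral>z. (\<Sum>\<beta>\<in>T. (mean_error M n (b \<beta>) z)^2) \<partial>?Q) \<le> 1 / real n" .
qed

text \<open>Centring at population means keeps the summands independent and centred; sample means
  would couple them.\<close>

definition cov_error :: "'a measure \<Rightarrow> nat \<Rightarrow> ('a \<Rightarrow> real) \<Rightarrow> ('a \<Rightarrow> real) \<Rightarrow> (nat \<Rightarrow> 'a) \<Rightarrow> real" where
  "cov_error M n f g z =
     (\<Sum>i<n. (f (z i) - (\<integral>x. f x \<partial>M)) * (g (z i) - (\<integral>x. g x \<partial>M)) - cov M f g) / real n"

text \<open>Separates the error of order 1 / sqrt n, an average of independent centred terms, from a
  product of two mean errors, which is of order 1 / n.\<close>

lemma emp_cov_minus_cov:
  assumes "n > 0"
  shows "emp_cov n z z f g - cov M f g = cov_error M n f g z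
    - mean_error M n f z * mean_error M n g z"
  unfolding cov_error_def mean_error_def
  by (subst emp_cov_centered[OF assms, of _ _ _ _ "\<integral>x. f x \<partial>M" "\<integral>x. g x \<partial>M"])
     (use assms in \<open>simp add: sum_subtractf diff_divide_distrib\<close>)

text \<open>The double sum is the squared Hilbert-Schmidt norm of the error of the cross-covariance
  operator. Each entry is a mean of n independent centred terms, so its second moment is a variance
  over n, at most the raw second moment over n.\<close>

lemma (in prob_space) cov_error_features:
  assumes n: "n > 0" and e: "unit_features M S e" and b: "unit_features M T b"
  shows "integrable (samples n M) (\<lambda>z. \<Sum>m\<in>S. \<Sum>\<beta>\<in>T. (cov_error M n (e m) (b \<beta>) z)^2)"
    and "(\<integral>z. (\<Sum>m\<in>S. \<Sum>\<beta>\<in>T. (cov_error M n (e m) (b \<beta>) z)^2) \<partial>samples n M) \<le> 1.69 / real n"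
proof -
  let ?Q = "samples n M"
  define E where "E m z = e m z - expectation (e m)" for m z
  define B where "B \<beta> z = b \<beta> z - expectation (b \<beta>)" for \<beta> z
  have EB: "(\<lambda>z. E m z * B \<beta> z) \<in> borel_measurable M" 
      "\<And>z. z \<in> space M \<Longrightarrow> \<bar>E m z * B \<beta> z\<bar> \<le> 4" if "m \<in> S" "\<beta> \<in> T" for m \<beta>
  proof -
    show "(\<lambda>z. E m z * B \<beta> z) \<in> borel_measurable M"
      using centered_feature(1)[OF e that(1)] centered_feature(1)[OF b that(2)]
      unfolding E_def B_def by measurable
    fix z assume z: "z \<in> space M"
    have "\<bar>E m z\<bar> * \<bar>B \<beta> z\<bar> \<le> 2 * 2"
      using centered_feature(2)[OF e that(1) z] centered_feature(2)[OF b that(2) z]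
      unfolding E_def B_def by (intro mult_mono) auto
    then show "\<bar>E m z * B \<beta> z\<bar> \<le> 4" by (simp add: abs_mult)
  qed
  have EBi: "integrable M (\<lambda>z. E m z * B \<beta> z)" if "m \<in> S" "\<beta> \<in> T" for m \<beta>
    by (rule integrable_bounded[OF EB[OF that]])
  have EB2: "integrable M (\<lambda>z. (E m z * B \<beta> z)^2)" if "m \<in> S" "\<beta> \<in> T" for m \<beta>
  proof (rule integrable_bounded[where K = 16])
    show "(\<lambda>z. (E m z * B \<beta> z)^2) \<in> borel_measurable M"
      using EB(1)[OF that] by measurable
    fix z assume "z \<in> space M"
    then show "\<bar>(E m z * B \<beta> z)^2\<bar> \<le> 16"
      using power_mono[OF EB(2)[OF that], of z 2] by simp
  qed
  have covEB: "cov M (e m) (b \<beta>) = (\<integral>z. E m z * B \<beta> z \<partial>M)" for m \<beta>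
    unfolding cov_def E_def B_def ..
  have Fi: "integrable ?Q (\<lambda>z. (cov_error M n (e m) (b \<beta>) z)^2)"
    and Fl: "(\<integral>z. (cov_error M n (e m) (b \<beta>) z)^2 \<partial>?Q) \<le> (\<integral>z. (E m z * B \<beta> z)^2 \<partial>M) / real n"
    if "m \<in> S" "\<beta> \<in> T" for m \<beta>
  proof -
    let ?c = "cov M (e m) (b \<beta>)"
    have m': "(\<lambda>z. E m z * B \<beta> z - ?c) \<in> borel_measurable M" using EB(1)[OF that] by measurable
    have bd: "\<bar>E m z * B \<beta> z - ?c\<bar> \<le> 4 + \<bar>?c\<bar>" if "z \<in> space M" for z
      using EB(2)[OF \<open>m \<in> S\<close> \<open>\<beta> \<in> T\<close> that] by linarith
    have 0: "(\<integral>z. E m z * B \<beta> z - ?c \<partial>M) = 0"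
      using EBi[OF that] by (simp add: covEB prob_space)
    note sm = sample_mean_second_moment[OF n m' bd 0]
    show "integrable ?Q (\<lambda>z. (cov_error M n (e m) (b \<beta>) z)^2)"
      using sm(1) by (simp add: cov_error_def E_def B_def)
    have "(\<integral>z. (cov_error M n (e m) (b \<beta>) z)^2 \<partial>?Q) = (\<integral>x. (E m x * B \<beta> x - ?c)^2 \<partial>M) / real n"
      using sm(2) by (simp add: cov_error_def E_def B_def)
    also have "\<dots> \<le> (\<integral>z. (E m z * B \<beta> z)^2 \<partial>M) / real n"
    proof (rule divide_right_mono)
      have "(\<integral>x. (E m x * B \<beta> x - ?c)^2 \<partial>M) = (\<integral>z. (E m z * B \<beta> z)^2 \<partial>M) - ?c^2"
        unfolding covEB by (rule variance_eq[OF EBi[OF that] EB2[OF that]])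
      then show "(\<integral>x. (E m x * B \<beta> x - ?c)^2 \<partial>M) \<le> (\<integral>z. (E m z * B \<beta> z)^2 \<partial>M)" by simp
    qed simp
    finally show "(\<integral>z. (cov_error M n (e m) (b \<beta>) z)^2 \<partial>?Q) \<le> (\<integral>z. (E m z * B \<beta> z)^2 \<partial>M) / real n" .
  qed
  show "integrable ?Q (\<lambda>z. \<Sum>m\<in>S. \<Sum>\<beta>\<in>T. (cov_error M n (e m) (b \<beta>) z)^2)"
    using Fi by (intro Bochner_Integration.integrable_sum) auto
  have "(\<integral>z. (\<Sum>m\<in>S. \<Sum>\<beta>\<in>T. (cov_error M n (e m) (b \<beta>) z)^2) \<partial>?Q)
      = (\<Sum>m\<in>S. \<Sum>\<beta>\<in>T. (\<integral>z. (cov_error M n (e m) (b \<beta>) z)^2 \<partial>?Q))"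
    using Fi by (simp add: Bochner_Integration.integral_sum Bochner_Integration.integrable_sum)
  also have "\<dots> \<le> (\<Sum>m\<in>S. \<Sum>\<beta>\<in>T. (\<integral>z. (E m z * B \<beta> z)^2 \<partial>M) / real n)"
    using Fl by (intro sum_mono) auto
  also have "\<dots> = (\<integral>z. (\<Sum>m\<in>S. \<Sum>\<beta>\<in>T. (E m z * B \<beta> z)^2) \<partial>M) / real n"
    using EB2 by (simp add: Bochner_Integration.integral_sum Bochner_Integration.integrable_sum sum_divide_distrib)
  \<comment> \<open>The double sum of squared products factorises at each point. Summing before
    integrating is what replaces the number of pairs by the constant 1.69.\<close>
  also have "\<dots> = (\<integral>z. (\<Sum>m\<in>S. (E m z)^2) * (\<Sum>\<beta>\<in>T. (B \<beta> z)^2) \<partial>M) / real n"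
    by (simp add: power_mult_distrib sum_product)
  also have "\<dots> \<le> 1.69 / real n"
    using centered_features_product(2)[OF e b] unfolding E_def B_def by (intro divide_right_mono) auto
  finally show "(\<integral>z. (\<Sum>m\<in>S. \<Sum>\<beta>\<in>T. (cov_error M n (e m) (b \<beta>) z)^2) \<partial>?Q) \<le> 1.69 / real n" .
qed

text \<open>The sup over the unit ball of coefficients is absorbed into Hilbert-Schmidt norms, which are
  sums over the features and hence have computable expectations.\<close>

lemma (in prob_space) dep_deviation_le:
  fixes a :: "'c \<Rightarrow> real"
  assumes n: "n > 0" and s: "s > 0" and e: "unit_features M S e" and b: "unit_features M T b"
    and a: "(\<Sum>m\<in>S. (a m)^2) \<le> 1" and z: "\<And>i. i < n \<Longrightarrow> z i \<in> space M"
  defines "f \<equiv> \<lambda>x. \<Sum>m\<in>S. a m * e m x"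
  shows "\<bar>emp_dep n z z f b T - pop_dep M f b T\<bar>
    \<le> (\<Sum>m\<in>S. \<Sum>\<beta>\<in>T. (cov_error M n (e m) (b \<beta>) z)^2) / s + s
      + (\<Sum>m\<in>S. (mean_error M n (e m) z)^2)
      + (\<Sum>\<beta>\<in>T. (mean_error M n (b \<beta>) z)^2)"
proof -
  note De = unit_featuresD[OF e] and Db = unit_featuresD[OF b]
  define V where "V = (\<Sum>m\<in>S. \<Sum>\<beta>\<in>T. (cov_error M n (e m) (b \<beta>) z)^2)"
  define ee where "ee m = mean_error M n (e m) z" for m
  define bb where "bb \<beta> = mean_error M n (b \<beta>) z" for \<beta>
  define c where "c = (\<lambda>\<beta>. cov M f (b \<beta>))"
  define c' where "c' = (\<lambda>\<beta>. emp_cov n z z f (b \<beta>))"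
  have fm: "f \<in> borel_measurable M"
    unfolding f_def using De by (intro borel_measurable_sum borel_measurable_times) auto
  have fb: "\<bar>f x\<bar> \<le> 1" if "x \<in> space M" for x
    unfolding f_def using a De(3)[OF that] by (rule combination_abs_le_1)
  have d: "c' \<beta> - c \<beta> = (\<Sum>m\<in>S. a m * cov_error M n (e m) (b \<beta>) z) + - (\<Sum>m\<in>S. a m * ee m) * bb \<beta>"
    if "\<beta> \<in> T" for \<beta>
  proof -
    have "c' \<beta> - c \<beta> = (\<Sum>m\<in>S. a m * (emp_cov n z z (e m) (b \<beta>) - cov M (e m) (b \<beta>)))"
      unfolding c_def c'_def f_def emp_cov_sum_left
      by (subst cov_sum_left[OF De(1) Db(2,4)[OF _] De(2,4)])
         (use that in \<open>auto simp: sum_subtractf right_diff_distrib\<close>)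
    also have "\<dots> = (\<Sum>m\<in>S. a m * (cov_error M n (e m) (b \<beta>) z - ee m * bb \<beta>))"
      by (simp only: emp_cov_minus_cov[OF n] ee_def bb_def)
    finally show ?thesis
      by (simp add: right_diff_distrib sum_subtractf sum_distrib_right mult.assoc)
  qed
  have "L2_set (\<lambda>\<beta>. c' \<beta> - c \<beta>) T = L2_set (\<lambda>\<beta>. (\<Sum>m\<in>S. a m * cov_error M n (e m) (b \<beta>) z) + - (\<Sum>m\<in>S. a m * ee m) * bb \<beta>) T"
    using d by (intro L2_set_cong) auto
  also have "\<dots> \<le> L2_set (\<lambda>\<beta>. \<Sum>m\<in>S. a m * cov_error M n (e m) (b \<beta>) z) T + L2_set (\<lambda>\<beta>. - (\<Sum>m\<in>S. a m * ee m) * bb \<beta>) T"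
    by (rule L2_set_triangle_ineq)
  also have "L2_set (\<lambda>\<beta>. \<Sum>m\<in>S. a m * cov_error M n (e m) (b \<beta>) z) T \<le> sqrt V"
  proof -
    have "(\<Sum>\<beta>\<in>T. (\<Sum>m\<in>S. a m * cov_error M n (e m) (b \<beta>) z)^2) \<le> (\<Sum>\<beta>\<in>T. \<Sum>m\<in>S. (cov_error M n (e m) (b \<beta>) z)^2)"
    proof (rule sum_mono)
      fix \<beta>
      have "(\<Sum>m\<in>S. a m * cov_error M n (e m) (b \<beta>) z)^2 \<le> (\<Sum>m\<in>S. (a m)^2) * (\<Sum>m\<in>S. (cov_error M n (e m) (b \<beta>) z)^2)"
        by (rule Cauchy_Schwarz_ineq_sum)
      also have "\<dots> \<le> 1 * (\<Sum>m\<in>S. (cov_error M n (e m) (b \<beta>) z)^2)"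
        using a by (intro mult_right_mono sum_nonneg) auto
      finally show "(\<Sum>m\<in>S. a m * cov_error M n (e m) (b \<beta>) z)^2 \<le> (\<Sum>m\<in>S. (cov_error M n (e m) (b \<beta>) z)^2)" by simp
    qed
    also have "\<dots> = V" unfolding V_def by (rule sum.swap)
    finally show ?thesis by (simp add: L2_set_def)
  qed
  also have "L2_set (\<lambda>\<beta>. - (\<Sum>m\<in>S. a m * ee m) * bb \<beta>) T \<le> L2_set ee S * L2_set bb T"
  proof -
    have "\<bar>\<Sum>m\<in>S. a m * ee m\<bar> \<le> (\<Sum>m\<in>S. \<bar>a m\<bar> * \<bar>ee m\<bar>)"
      by (rule order_trans[OF sum_abs]) (simp add: abs_mult)
    also have "\<dots> \<le> L2_set a S * L2_set ee S" by (rule L2_set_mult_ineq)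
    also have "\<dots> \<le> 1 * L2_set ee S" using a by (intro mult_right_mono L2_set_nonneg) (simp add: L2_set_def)
    finally have *: "\<bar>\<Sum>m\<in>S. a m * ee m\<bar> \<le> L2_set ee S" by simp
    have "L2_set (\<lambda>\<beta>. - (\<Sum>m\<in>S. a m * ee m) * bb \<beta>) T = \<bar>\<Sum>m\<in>S. a m * ee m\<bar> * L2_set bb T"
      unfolding L2_set_def by (simp add: power_mult_distrib real_sqrt_mult flip: sum_distrib_left)
    also have "\<dots> \<le> L2_set ee S * L2_set bb T" using * by (intro mult_right_mono) auto
    finally show ?thesis .
  qed
  finally have L: "L2_set (\<lambda>\<beta>. c' \<beta> - c \<beta>) T \<le> sqrt V + L2_set ee S * L2_set bb T" by simp
  have c1: "L2_set c T \<le> 1"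
    using dep_le_1[OF b fm fb] by (simp add: L2_set_def c_def)
  have c'1: "L2_set c' T \<le> 1"
    using emp_dep_le_1[OF n Db(1), of f z b z] fb Db(3) z by (simp add: L2_set_def c'_def)
  have "\<bar>(\<Sum>\<beta>\<in>T. (c' \<beta>)^2) - (\<Sum>\<beta>\<in>T. (c \<beta>)^2)\<bar> = \<bar>\<Sum>\<beta>\<in>T. (c' \<beta> - c \<beta>) * (c' \<beta> + c \<beta>)\<bar>"
    by (simp add: sum_subtractf[symmetric] power2_eq_square algebra_simps)
  also have "\<dots> \<le> (\<Sum>\<beta>\<in>T. \<bar>c' \<beta> - c \<beta>\<bar> * \<bar>c' \<beta> + c \<beta>\<bar>)"
    by (rule order_trans[OF sum_abs]) (simp add: abs_mult)
  also have "\<dots> \<le> L2_set (\<lambda>\<beta>. c' \<beta> - c \<beta>) T * L2_set (\<lambda>\<beta>. c' \<beta> + c \<beta>) T"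
    by (rule L2_set_mult_ineq)
  also have "\<dots> \<le> (sqrt V + L2_set ee S * L2_set bb T) * 2"
  proof (rule mult_mono[OF L])
    show "L2_set (\<lambda>\<beta>. c' \<beta> + c \<beta>) T \<le> 2" using L2_set_triangle_ineq[of c' c T] c1 c'1 by linarith
  qed (auto simp: V_def intro!: add_nonneg_nonneg mult_nonneg_nonneg sum_nonneg)
  \<comment> \<open>2 sqrt V is linearised as V / s + s, so that only the expectation of V has to be
    known; \<open>s\<close> stays free and is optimised afterwards.\<close>
  also have "\<dots> \<le> (V / s + s) + ((L2_set ee S)^2 + (L2_set bb T)^2)"
  proof -
    have V0: "0 \<le> V" by (auto simp: V_def intro!: sum_nonneg)
    have "2 * sqrt V * s \<le> V + s * s"
      using sum_squares_bound[of "sqrt V" s] V0 by (simp add: power2_eq_square)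
    then have "2 * sqrt V \<le> V / s + s" using s by (simp add: field_simps)
    moreover have "2 * L2_set ee S * L2_set bb T \<le> (L2_set ee S)^2 + (L2_set bb T)^2"
      by (rule sum_squares_bound)
    ultimately show ?thesis by (simp add: algebra_simps)
  qed
  also have "\<dots> = V / s + s + (\<Sum>m\<in>S. (ee m)^2) + (\<Sum>\<beta>\<in>T. (bb \<beta>)^2)"
    by (simp add: L2_set_def sum_nonneg)
  finally show ?thesis unfolding V_def ee_def bb_def c_def c'_def .
qed

text \<open>\<open>G\<close> does not depend on the coefficients, so its integral bounds the
  expected supremum over the whole unit ball, hence over any number of tuples.\<close>

lemma (in prob_space) dep_deviation_dominated:
  assumes n: "n > 0" and e: "unit_features M S e" and b: "unit_features M T b"
  obtains G where "integrable (samples n M) G"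
    "(\<integral>z. G z \<partial>samples n M) \<le> 2.6 / sqrt (real n) + 2 / real n"
    "\<And>z a. z \<in> space (samples n M) \<Longrightarrow> (\<Sum>m\<in>S. (a m)^2) \<le> 1 \<Longrightarrow>
      \<bar>emp_dep n z z (\<lambda>x. \<Sum>m\<in>S. a m * e m x) b T
        - pop_dep M (\<lambda>x. \<Sum>m\<in>S. a m * e m x) b T\<bar> \<le> G z"
proof
  let ?Q = "samples n M"
  interpret Q: prob_space ?Q by (intro prob_space_PiM) unfold_locales
  \<comment> \<open>This \<open>s\<close> minimises (1.69 / n) / s + s, with minimum 2.6 / sqrt
    n.\<close>
  define s where "s = 1.3 / sqrt (real n)"
  have s: "s > 0" using n by (simp add: s_def)
  define V where "V z = (\<Sum>m\<in>S. \<Sum>\<beta>\<in>T. (cov_error M n (e m) (b \<beta>) z)^2)" for z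
  define E where "E z = (\<Sum>m\<in>S. (mean_error M n (e m) z)^2)" for z
  define B where "B z = (\<Sum>\<beta>\<in>T. (mean_error M n (b \<beta>) z)^2)" for z
  note V = cov_error_features[OF n e b, folded V_def]
  note E = sample_mean_features[OF n e, folded E_def]
  note B = sample_mean_features[OF n b, folded B_def]
  show "integrable ?Q (\<lambda>z. V z / s + s + E z + B z)" using V E B by auto
  have "(\<integral>z. V z / s + s + E z + B z \<partial>?Q) = (\<integral>z. V z \<partial>?Q) / s + s + (\<integral>z. E z \<partial>?Q) + (\<integral>z. B z \<partial>?Q)"
    using V E B by (simp add: Q.prob_space)
  also have "\<dots> \<le> (1.69 / real n) / s + s + 1 / real n + 1 / real n"
    using V E B s by (intro add_mono divide_right_mono) auto
  also have "(1.69 / real n) / s = s"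
  proof -
    have "s * s = 1.69 / (sqrt (real n) * sqrt (real n))" unfolding s_def by simp
    then have "1.69 / real n = s * s" by simp
    then show ?thesis using s by simp
  qed
  finally show "(\<integral>z. V z / s + s + E z + B z \<partial>?Q) \<le> 2.6 / sqrt (real n) + 2 / real n"
    by (simp add: s_def)
  show "\<bar>emp_dep n z z (\<lambda>x. \<Sum>m\<in>S. a m * e m x) b T
        - pop_dep M (\<lambda>x. \<Sum>m\<in>S. a m * e m x) b T\<bar> \<le> V z / s + s + E z + B z"
    if "z \<in> space ?Q" "(\<Sum>m\<in>S. (a m)^2) \<le> 1" for z a
    unfolding V_def E_def B_def
    by (rule dep_deviation_le[OF n s e b that(2)]) (use space_PiM_component[OF that(1)] in auto)
qed

section \<open>Concentration for finite families\<close>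

lemma ln_6_ge: "5/3 \<le> ln (6 :: real)"
proof -
  have "ln (6 :: real) = ln 2 + ln 3" using ln_mult[of 2 "3 :: real"] by simp
  moreover have "ln (exp 1) \<le> ln (3 :: real)"
    using e_less_272 by (subst ln_le_cancel_iff) auto
  ultimately show ?thesis using ln2_ge_two_thirds by simp
qed

text \<open>Multiplied by sqrt n, this is a quadratic inequality in \<open>w\<close> = sqrt (L / 2).
  For n \<ge> 100 the lower-order terms only raise 2.6 to 2.8 and 5.2 to 5.28.\<close>

lemma confidence_radius_bound:
  fixes n :: nat and L :: real
  assumes n: "n \<ge> 100" and L: "L \<ge> 0"
  shows "2.6 / sqrt (real n) + 2 / real n + (5.2 / real n + 8 / (real n)^2) * sqrt (real n * L / 2)
    \<le> sqrt ((ln 6 + L) / (0.22^2 * real n))"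
proof -
  define q where "q = sqrt (real n)"
  define w where "w = sqrt (L / 2)"
  have q: "q \<ge> 10" unfolding q_def using n by (intro real_le_rsqrt) simp
  have nq: "real n = q * q" by (simp add: q_def)
  have ww: "w * w = L / 2" using L by (simp add: w_def)
  have w: "0 \<le> w" "L = 2 * w * w" using L ww by (simp add: w_def, simp)
  have sq: "sqrt (real n * L / 2) = q * w"
    unfolding q_def w_def by (simp add: real_sqrt_mult[symmetric])
  have i: "1 / q \<le> 1 / 10" using q by (intro divide_left_mono) auto
  have i2: "1 / (q * q) \<le> 1 / 100"
    using mult_mono[OF i i] q by simp
  have "2.6 / q + 2 / real n + (5.2 / real n + 8 / (real n)^2) * (q * w)
      = (2.6 + 2 * (1 / q) + (5.2 + 8 * (1 / (q * q))) * w) / q"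
    using q by (simp add: nq field_simps power2_eq_square)
  also have "\<dots> \<le> (2.6 + 2 * (1 / 10) + (5.2 + 8 * (1 / 100)) * w) / q"
    using q i i2 w by (intro divide_right_mono add_mono mult_right_mono mult_left_mono) auto
  also have "\<dots> \<le> sqrt ((ln 6 + L) / 0.22^2) / q"
  proof (intro divide_right_mono real_le_rsqrt)
    \<comment> \<open>Right side minus left side is about 13.4 w^2 - 29.6 w + 26.6, which has no
      real root. For w \<ge> 0 the square 13 (w - 1.14)^2 stays below it in each of the three
      terms.\<close>
    have "0 \<le> 13 * (w - 1.14)^2" by simp
    then have "(2.8 + 5.28 * w)^2 \<le> (5/3 + 2 * w * w) / 0.22^2"
      using w(1) by (simp add: power2_eq_square algebra_simps)
    also have "\<dots> \<le> (ln 6 + L) / 0.22^2"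
      using ln_6_ge w(2) by (intro divide_right_mono) auto
    finally show "(2.6 + 2 * (1 / 10) + (5.2 + 8 * (1 / 100)) * w)^2 \<le> (ln 6 + L) / 0.22^2" by simp
  qed (use q in auto)
  also have "\<dots> = sqrt ((ln 6 + L) / (0.22^2 * real n))"
    by (simp add: q_def flip: real_sqrt_divide)
  finally show ?thesis unfolding sq q_def .
qed

section \<open>Measurability and bounded differences of the empirical terms\<close>

lemma emp_cov_cong:
  assumes "\<And>i. i < n \<Longrightarrow> f (x i) = f' (x' i)" "\<And>i. i < n \<Longrightarrow> g (u i) = g' (u' i)"
  shows "emp_cov n x u f g = emp_cov n x' u' f' g'"
proof -
  have "(\<Sum>i<n. f (x i) * g (u i)) = (\<Sum>i<n. f' (x' i) * g' (u' i))"
    "(\<Sum>i<n. \<Sum>l<n. f (x i) * g (u l)) = (\<Sum>i<n. \<Sum>l<n. f' (x' i) * g' (u' l))"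
    using assms by (auto intro!: sum.cong)
  then show ?thesis unfolding emp_cov_def by simp
qed

lemma cov_cong:
  assumes "\<And>z. z \<in> space M \<Longrightarrow> f z = f' z" "\<And>z. z \<in> space M \<Longrightarrow> g z = g' z"
  shows "cov M f g = cov M f' g'"
proof -
  have "(\<integral>z. f z \<partial>M) = (\<integral>z. f' z \<partial>M)" "(\<integral>z. g z \<partial>M) = (\<integral>z. g' z \<partial>M)"
    using assms by (auto intro: Bochner_Integration.integral_cong)
  then show ?thesis
    unfolding cov_def using assms by (intro Bochner_Integration.integral_cong) auto
qed

lemma emp_cov_measurable:
  assumes "f \<in> borel_measurable M" "g \<in> borel_measurable M"
  shows "(\<lambda>z. emp_cov n z z f g) \<in> borel_measurable (samples n M)"
  unfolding emp_cov_def
  using assms by (intro borel_measurable_diff borel_measurable_times borel_measurable_sum borel_measurable_const)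
    (auto intro: measurable_compose[OF measurable_component_singleton])

lemma emp_dep_update_abs_diff:
  assumes n: "n > 0" and k: "k < n" and b: "unit_features M T b"
    and f: "\<And>x. x \<in> space M \<Longrightarrow> \<bar>f x\<bar> \<le> 1"
    and z: "z \<in> space (samples n M)" and w: "w \<in> space M"
  shows "\<bar>emp_dep n (z(k := w)) (z(k := w)) f b T - emp_dep n z z f b T\<bar>
     \<le> 5.2 / real n + 8 / (real n)^2"
proof -
  note D = unit_featuresD[OF b]
  let ?z = "z(k := w)"
  have zi: "z i \<in> space M" "?z i \<in> space M" if "i < n" for i
    using space_PiM_component[OF z] w that by auto
  have "emp_dep n z z f b T - emp_dep n ?z ?z f b T
      \<le> 5.2 / real n + 8 / (real n)^2"
    by (rule emp_dep_update_diff[OF n k D(1)]) (use f D(3) zi w in auto)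
  \<comment> \<open>The reverse inequality is the same estimate for the updated sample with the old
    point put back.\<close>
  moreover have "emp_dep n ?z ?z f b T -
      emp_dep n (?z(k := z k)) (?z(k := z k)) f b T
      \<le> 5.2 / real n + 8 / (real n)^2"
    by (rule emp_dep_update_diff[OF n k D(1)]) (use f D(3) zi zi(1)[OF k] in \<open>auto simp del: fun_upd_apply\<close>)
  ultimately show ?thesis by simp
qed

lemma abs_convex_combination_le:
  fixes a b c lam :: real
  assumes "0 \<le> lam" "lam \<le> 1" "\<bar>a\<bar> \<le> c" "\<bar>b\<bar> \<le> c'"
  shows "\<bar>(1 - lam) * a - lam * b\<bar> \<le> (1 - lam) * c + lam * c'"
proof -
  have "\<bar>(1 - lam) * a - lam * b\<bar> \<le> (1 - lam) * \<bar>a\<bar> + lam * \<bar>b\<bar>"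
    using abs_triangle_ineq4[of "(1 - lam) * a" "lam * b"] assms by (simp add: abs_mult)
  also have "\<dots> \<le> (1 - lam) * c + lam * c'" using assms by (intro add_mono mult_left_mono) auto
  finally show ?thesis .
qed

lemma abs_Max_diff_le:
  fixes f g :: "'k \<Rightarrow> real"
  assumes K: "finite K" "K \<noteq> {}" and d: "\<And>q. q \<in> K \<Longrightarrow> \<bar>f q - g q\<bar> \<le> c"
  shows "\<bar>Max (f ` K) - Max (g ` K)\<bar> \<le> c"
proof -
  have "Max (f ` K) \<le> Max (g ` K) + c"
    using K d by (subst Max_le_iff) (auto, smt (verit) Max_ge finite_imageI imageI)
  moreover have "Max (g ` K) \<le> Max (f ` K) + c"
    using K d by (subst Max_le_iff) (auto, smt (verit) Max_ge finite_imageI imageI)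
  ultimately show ?thesis by linarith
qed

abbreviation conf_radius :: "nat \<Rightarrow> real \<Rightarrow> real" where
  "conf_radius n \<delta> \<equiv> sqrt (ln (6 / \<delta>) / (0.22^2 * real n))"

definition dep_dev :: "'a measure \<Rightarrow> 'b set \<Rightarrow> ('b \<Rightarrow> 'a \<Rightarrow> real) \<Rightarrow> nat \<Rightarrow> ('a \<Rightarrow> real) \<Rightarrow> (nat \<Rightarrow> 'a) \<Rightarrow> real" where
  "dep_dev M T b n f z = emp_dep n z z f b T - pop_dep M f b T"

text \<open>McDiarmid is applied to the maximum over \<open>K\<close> of the absolute deviations.
  The radius involves neither the number of tuples nor the sizes of \<open>S\<close>,
  \<open>TY\<close> and \<open>TS\<close>, which is what allows all of these to grow later. The
  weights 1 - lam and lam sum to 1, so both dependence terms together cost no more than one.\<close>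

lemma (in prob_space) finite_family_concentration:
  fixes f :: "'k \<Rightarrow> nat \<Rightarrow> 'a \<Rightarrow> real" and a :: "'k \<Rightarrow> nat \<Rightarrow> 'c \<Rightarrow> real"
  assumes n: "n \<ge> 100" and r: "r \<ge> 1" and del: "0 < \<delta>" "\<delta> < 1" and lam: "0 \<le> lam" "lam \<le> 1"
    and K: "finite K" and e: "unit_features M S e"
    and a: "\<And>q j. q \<in> K \<Longrightarrow> j < r \<Longrightarrow> (\<Sum>m\<in>S. (a q j m)^2) \<le> 1"
    and f: "\<And>q j z. q \<in> K \<Longrightarrow> j < r \<Longrightarrow> z \<in> space M \<Longrightarrow> f q j z = (\<Sum>m\<in>S. a q j m * e m z)"
    and bY: "unit_features M TY bY" and bS: "unit_features M TS bS"
  shows "1 - \<delta> \<le> measure (samples n M) {z \<in> space (samples n M).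
      \<forall>q\<in>K. \<bar>(1 - lam) * (\<Sum>j<r. dep_dev M TY bY n (f q j) z) - lam * (\<Sum>j<r. dep_dev M TS bS n (f q j) z)\<bar>
        \<le> real r * conf_radius n \<delta>}"
proof (cases "K = {}")
  \<comment> \<open>The maximum of an empty set is unspecified, so this case is separate.\<close>
  case True
  interpret Q: prob_space "samples n M" by (intro prob_space_PiM) unfold_locales
  show ?thesis unfolding True using del by (simp add: Q.prob_space)
next
  case False
  let ?Q = "samples n M"
  interpret Q: prob_space ?Q by (intro prob_space_PiM) unfold_locales
  have n0: "n > 0" using n by simp
  note De = unit_featuresD[OF e] and DY = unit_featuresD[OF bY] and DS = unit_featuresD[OF bS]
  \<comment> \<open>\<open>f\<close> is tied to the features only on the space of \<open>M\<close>.
    \<open>F\<close> is the combination itself, so measurability and the bound by 1 come from the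
    features.\<close>
  define F where "F q j z = (\<Sum>m\<in>S. a q j m * e m z)" for q j z
  have Fb: "\<bar>F q j z\<bar> \<le> 1" if "q \<in> K" "j < r" "z \<in> space M" for q j z
    unfolding F_def by (rule combination_abs_le_1[OF a[OF that(1,2)] De(3)[OF that(3)]])
  have Fm: "F q j \<in> borel_measurable M" for q j
    unfolding F_def using De by (intro borel_measurable_sum borel_measurable_times) auto
  have devF: "dep_dev M T b n (f q j) z = dep_dev M T b n (F q j) z"
    if "q \<in> K" "j < r" "z \<in> space ?Q" for q j z and T :: "'x set" and b
  proof -
    have "emp_cov n z z (f q j) g = emp_cov n z z (F q j) g" for g
      using space_PiM_component[OF that(3)] f[OF that(1,2)] by (intro emp_cov_cong) (auto simp: F_def)
    moreover have "cov M (f q j) g = cov M (F q j) g" for g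
      using f[OF that(1,2)] by (intro cov_cong) (auto simp: F_def)
    ultimately show ?thesis unfolding dep_dev_def by simp
  qed
  define h where "h q z = (1 - lam) * (\<Sum>j<r. dep_dev M TY bY n (F q j) z) - lam * (\<Sum>j<r. dep_dev M TS bS n (F q j) z)" for q z
  define g where "g z = Max ((\<lambda>q. \<bar>h q z\<bar>) ` K)" for z
  have devm: "dep_dev M T b n (F q j) \<in> borel_measurable ?Q" if b: "unit_features M T b" for q j T and b :: "'x \<Rightarrow> 'a \<Rightarrow> real"
    unfolding dep_dev_def using emp_cov_measurable[OF Fm unit_featuresD(2)[OF b]]
    by (intro borel_measurable_diff borel_measurable_sum borel_measurable_power) auto
  have hm: "h q \<in> borel_measurable ?Q" for q
    unfolding h_def using devm[OF bY] devm[OF bS]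
    by (intro borel_measurable_diff borel_measurable_sum borel_measurable_times) auto
  have gm[measurable]: "g \<in> borel_measurable ?Q"
    unfolding g_def using hm K by (intro borel_measurable_Max borel_measurable_abs) auto
  obtain GY where GY: "integrable ?Q GY" "(\<integral>z. GY z \<partial>?Q) \<le> 2.6 / sqrt (real n) + 2 / real n"
    "\<And>z a. z \<in> space ?Q \<Longrightarrow> (\<Sum>m\<in>S. (a m)^2) \<le> 1 \<Longrightarrow>
      \<bar>dep_dev M TY bY n (\<lambda>x. \<Sum>m\<in>S. a m * e m x) z\<bar> \<le> GY z"
    using dep_deviation_dominated[OF n0 e bY] unfolding dep_dev_def by blast
  obtain GS where GS: "integrable ?Q GS" "(\<integral>z. GS z \<partial>?Q) \<le> 2.6 / sqrt (real n) + 2 / real n"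
    "\<And>z a. z \<in> space ?Q \<Longrightarrow> (\<Sum>m\<in>S. (a m)^2) \<le> 1 \<Longrightarrow>
      \<bar>dep_dev M TS bS n (\<lambda>x. \<Sum>m\<in>S. a m * e m x) z\<bar> \<le> GS z"
    using dep_deviation_dominated[OF n0 e bS] unfolding dep_dev_def by blast
  \<comment> \<open>A common dominating function for all \<open>q\<close>, so the expectation of the
    maximum is bounded without any cost in the size of \<open>K\<close>.\<close>
  define G where "G z = real r * ((1 - lam) * GY z + lam * GS z)" for z
  have hG: "\<bar>h q z\<bar> \<le> G z" if "q \<in> K" "z \<in> space ?Q" for q z
  proof -
    have "\<bar>\<Sum>j<r. dep_dev M TY bY n (F q j) z\<bar> \<le> (\<Sum>j<r. GY z)"
      using GY(3)[OF that(2) a[OF that(1)]] unfolding F_def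
      by (intro order_trans[OF sum_abs] sum_mono) auto
    moreover have "\<bar>\<Sum>j<r. dep_dev M TS bS n (F q j) z\<bar> \<le> (\<Sum>j<r. GS z)"
      using GS(3)[OF that(2) a[OF that(1)]] unfolding F_def
      by (intro order_trans[OF sum_abs] sum_mono) auto
    ultimately have "\<bar>h q z\<bar> \<le> (1 - lam) * (\<Sum>j<r. GY z) + lam * (\<Sum>j<r. GS z)"
      unfolding h_def by (intro abs_convex_combination_le lam)
    then show ?thesis by (simp add: G_def algebra_simps)
  qed
  have dev1: "\<bar>dep_dev M T b n (F q j) z\<bar> \<le> 1" if "q \<in> K" "j < r" "z \<in> space ?Q" and b: "unit_features M T b"
    for q j z T and b :: "'x \<Rightarrow> 'a \<Rightarrow> real"
  proof -
    have "emp_dep n z z (F q j) b T \<le> 1"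
      using space_PiM_component[OF that(3)] Fb[OF that(1,2)] unit_featuresD[OF b]
      by (intro emp_dep_le_1 n0) auto
    moreover have "pop_dep M (F q j) b T \<le> 1"
      by (rule dep_le_1[OF b Fm Fb[OF that(1,2)]])
    moreover have "0 \<le> emp_dep n z z (F q j) b T" "0 \<le> pop_dep M (F q j) b T"
      by (auto intro: sum_nonneg)
    ultimately show ?thesis unfolding dep_dev_def by linarith
  qed
  have h1: "\<bar>h q z\<bar> \<le> real r" if "q \<in> K" "z \<in> space ?Q" for q z
  proof -
    have "\<bar>\<Sum>j<r. dep_dev M TY bY n (F q j) z\<bar> \<le> (\<Sum>j<r. 1)"
      using dev1[OF that(1) _ that(2) bY] by (intro order_trans[OF sum_abs] sum_mono) auto
    moreover have "\<bar>\<Sum>j<r. dep_dev M TS bS n (F q j) z\<bar> \<le> (\<Sum>j<r. 1)"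
      using dev1[OF that(1) _ that(2) bS] by (intro order_trans[OF sum_abs] sum_mono) auto
    ultimately have "\<bar>h q z\<bar> \<le> (1 - lam) * (\<Sum>j<r. 1) + lam * (\<Sum>j<r. 1)"
      unfolding h_def by (intro abs_convex_combination_le lam)
    then show ?thesis by (simp add: algebra_simps)
  qed
  have g_ge: "\<bar>h q z\<bar> \<le> g z" if "q \<in> K" for q z
    unfolding g_def using K that by (intro Max_ge) auto
  have g_le: "g z \<le> c" if "\<And>q. q \<in> K \<Longrightarrow> \<bar>h q z\<bar> \<le> c" for z c
    unfolding g_def using K False that by (subst Max_le_iff) auto
  obtain q0 where k0: "q0 \<in> K" using False by blast
  have g0: "0 \<le> g z" for z using g_ge[OF k0, of z] by linarith
  have gb: "\<bar>g z\<bar> \<le> real r" if "z \<in> space ?Q" for z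
    using g_le[of z "real r"] h1[OF _ that] g0[of z] by simp
  define c0 where "c0 = 5.2 / real n + 8 / (real n)^2"
  have c0: "c0 > 0" using n0 by (simp add: c0_def add_pos_pos)
  have gd: "\<bar>g (z(i := w)) - g z\<bar> \<le> real r * c0"
    if z: "z \<in> space ?Q" and i: "i < n" and w: "w \<in> space M" for z i w
    unfolding g_def
  proof (rule abs_Max_diff_le[OF K False])
    fix q assume k: "q \<in> K"
    have d: "\<bar>dep_dev M T b n (F q j) (z(i := w)) - dep_dev M T b n (F q j) z\<bar> \<le> c0"
      if "j < r" and b: "unit_features M T b" for j T and b :: "'x \<Rightarrow> 'a \<Rightarrow> real"
      using emp_dep_update_abs_diff[OF n0 i b Fb[OF k that(1)] z w]
      unfolding dep_dev_def c0_def by simp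
    have D: "\<bar>(\<Sum>j<r. dep_dev M T b n (F q j) (z(i := w))) - (\<Sum>j<r. dep_dev M T b n (F q j) z)\<bar> \<le> real r * c0"
      if b: "unit_features M T b" for T and b :: "'x \<Rightarrow> 'a \<Rightarrow> real"
    proof -
      have "\<bar>\<Sum>j<r. dep_dev M T b n (F q j) (z(i := w)) - dep_dev M T b n (F q j) z\<bar> \<le> (\<Sum>j<r. c0)"
        using d[OF _ b] by (intro order_trans[OF sum_abs] sum_mono) auto
      then show ?thesis by (simp add: sum_subtractf)
    qed
    have "h q (z(i := w)) - h q z
        = (1 - lam) * ((\<Sum>j<r. dep_dev M TY bY n (F q j) (z(i := w))) - (\<Sum>j<r. dep_dev M TY bY n (F q j) z))
          - lam * ((\<Sum>j<r. dep_dev M TS bS n (F q j) (z(i := w))) - (\<Sum>j<r. dep_dev M TS bS n (F q j) z))"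
      unfolding h_def by (simp add: algebra_simps)
    also have "\<bar>\<dots>\<bar> \<le> (1 - lam) * (real r * c0) + lam * (real r * c0)"
      by (intro abs_convex_combination_le lam D bY bS)
    finally have "\<bar>h q (z(i := w)) - h q z\<bar> \<le> real r * c0" by (simp add: algebra_simps)
    then show "\<bar>\<bar>h q (z(i := w))\<bar> - \<bar>h q z\<bar>\<bar> \<le> real r * c0"
      using abs_triangle_ineq3[of "h q (z(i := w))" "h q z"] by linarith
  qed
  have Eg: "(\<integral>z. g z \<partial>?Q) \<le> real r * (2.6 / sqrt (real n) + 2 / real n)"
  proof -
    have "(\<integral>z. g z \<partial>?Q) \<le> (\<integral>z. G z \<partial>?Q)"
    proof (rule integral_mono)
      show "integrable ?Q g" by (rule Q.integrable_bounded[OF gm gb])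
      show "integrable ?Q G" unfolding G_def using GY GS by auto
    qed (use g_le hG in auto)
    also have "\<dots> = real r * ((1 - lam) * (\<integral>z. GY z \<partial>?Q) + lam * (\<integral>z. GS z \<partial>?Q))"
      unfolding G_def using GY GS by simp
    also have "\<dots> \<le> real r * ((1 - lam) * (2.6 / sqrt (real n) + 2 / real n) + lam * (2.6 / sqrt (real n) + 2 / real n))"
      using GY(2) GS(2) lam by (intro mult_left_mono add_mono) auto
    also have "(1 - lam) * c + lam * c = c" for c :: real by (simp add: algebra_simps)
    finally show ?thesis .
  qed
  define L where "L = ln (1 / \<delta>)"
  have L: "L > 0" using del by (simp add: L_def)
  \<comment> \<open>With this \<open>t\<close> the exponent in McDiarmid's inequality is exactly -
    L, so the failure probability is \<delta>.\<close>
  define t where "t = real r * c0 * sqrt (real n * L / 2)"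
  have t: "t > 0" using r c0 n0 L by (simp add: t_def)
  have "Q.prob {z \<in> space ?Q. g z \<ge> (\<integral>z. g z \<partial>?Q) + t} \<le> exp (- 2 * t^2 / (real n * (real r * c0)^2))"
    using r c0 by (intro mcdiarmid_inequality[OF prob_space_axioms n0 _ t gm gb gd]) auto
  also have "- 2 * t^2 / (real n * (real r * c0)^2) = - L"
    using r c0 n0 L by (simp add: t_def power_mult_distrib field_simps)
  also have "exp (- L) = \<delta>" using del by (simp add: L_def ln_div)
  finally have "1 - \<delta> \<le> 1 - Q.prob {z \<in> space ?Q. g z \<ge> (\<integral>z. g z \<partial>?Q) + t}" by simp
  also have "\<dots> = Q.prob (space ?Q - {z \<in> space ?Q. g z \<ge> (\<integral>z. g z \<partial>?Q) + t})"
    by (rule Q.prob_compl[symmetric]) measurable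
  also have "\<dots> \<le> Q.prob {z \<in> space ?Q. g z \<le> real r * conf_radius n \<delta>}"
  proof (rule Q.finite_measure_mono)
    have ln6: "ln (6 / \<delta>) = ln 6 + L" using del by (simp add: L_def ln_div)
    have "(\<integral>z. g z \<partial>?Q) + t \<le> real r * (2.6 / sqrt (real n) + 2 / real n + c0 * sqrt (real n * L / 2))"
      using Eg by (simp add: t_def algebra_simps)
    also have "\<dots> \<le> real r * conf_radius n \<delta>"
      unfolding ln6 c0_def using confidence_radius_bound[OF n, of L] L by (intro mult_left_mono) auto
    finally show "space ?Q - {z \<in> space ?Q. g z \<ge> (\<integral>z. g z \<partial>?Q) + t}
        \<subseteq> {z \<in> space ?Q. g z \<le> real r * conf_radius n \<delta>}" by auto
  qed measurable
  also have "{z \<in> space ?Q. g z \<le> real r * conf_radius n \<delta>}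
      = {z \<in> space ?Q. \<forall>q\<in>K. \<bar>(1 - lam) * (\<Sum>j<r. dep_dev M TY bY n (f q j) z)
          - lam * (\<Sum>j<r. dep_dev M TS bS n (f q j) z)\<bar> \<le> real r * conf_radius n \<delta>}"
  proof (intro Collect_cong conj_cong refl)
    fix z assume z: "z \<in> space ?Q"
    have sumF: "(\<Sum>j<r. dep_dev M T b n (f q j) z) = (\<Sum>j<r. dep_dev M T b n (F q j) z)"
      if "q \<in> K" for q T and b :: "'x \<Rightarrow> 'a \<Rightarrow> real"
      using devF[OF that _ z] by (intro sum.cong) auto
    have eq: "(1 - lam) * (\<Sum>j<r. dep_dev M TY bY n (f q j) z) - lam * (\<Sum>j<r. dep_dev M TS bS n (f q j) z) = h q z"
      if "q \<in> K" for q using sumF[OF that, of TY bY] sumF[OF that, of TS bS] by (simp add: h_def)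
    show "g z \<le> R \<longleftrightarrow> (\<forall>q\<in>K. \<bar>(1 - lam) * (\<Sum>j<r. dep_dev M TY bY n (f q j) z)
          - lam * (\<Sum>j<r. dep_dev M TS bS n (f q j) z)\<bar> \<le> R)" for R
      using eq unfolding g_def using K False by (subst Max_le_iff) auto
  qed
  finally show ?thesis .
qed

section \<open>Concentration for countable families\<close>

text \<open>An increasing sequence of finite subsets that turns unordered sums into limits of
  sequences, so that countable operations on events and on measurable functions apply.\<close>

definition exhaustion :: "'b set \<Rightarrow> nat \<Rightarrow> 'b set" where
  "exhaustion B k = {\<beta>\<in>B. to_nat_on B \<beta> < k}"

lemma exhaustion:
  assumes "countable B"
  shows "finite (exhaustion B k)" "exhaustion B k \<subseteq> B"
    "\<beta> \<in> B \<Longrightarrow> eventually (\<lambda>k. \<beta> \<in> exhaustion B k) sequentially"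
proof -
  have "inj_on (to_nat_on B) (exhaustion B k)"
    using assms inj_on_to_nat_on by (auto simp: exhaustion_def inj_on_def)
  moreover have "to_nat_on B ` exhaustion B k \<subseteq> {..<k}" by (auto simp: exhaustion_def)
  ultimately show "finite (exhaustion B k)" using finite_imageD finite_subset by blast
  show "exhaustion B k \<subseteq> B" by (auto simp: exhaustion_def)
  show "\<beta> \<in> B \<Longrightarrow> eventually (\<lambda>k. \<beta> \<in> exhaustion B k) sequentially"
    unfolding exhaustion_def using eventually_gt_at_top[of "to_nat_on B \<beta>"] by auto
qed

lemma infsum_exhaustion:
  fixes g :: "'b \<Rightarrow> real"
  assumes B: "countable B" and g: "g summable_on B"
  shows "(\<lambda>k. \<Sum>\<beta>\<in>exhaustion B k. g \<beta>) \<longlonglongrightarrow> (\<Sum>\<^sub>\<infinity>\<beta>\<in>B. g \<beta>)"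
proof -
  have "filterlim (exhaustion B) (finite_subsets_at_top B) sequentially"
    unfolding filterlim_finite_subsets_at_top
  proof (intro allI impI)
    fix X assume X: "finite X \<and> X \<subseteq> B"
    then have "eventually (\<lambda>k. \<forall>\<beta>\<in>X. \<beta> \<in> exhaustion B k) sequentially"
      using exhaustion(3)[OF B] by (subst eventually_ball_finite_distrib) auto
    then show "eventually (\<lambda>k. finite (exhaustion B k) \<and> X \<subseteq> exhaustion B k \<and> exhaustion B k \<subseteq> B) sequentially"
      using exhaustion(1,2)[OF B] by (auto elim: eventually_mono)
  qed
  moreover have "(sum g \<longlongrightarrow> (\<Sum>\<^sub>\<infinity>\<beta>\<in>B. g \<beta>)) (finite_subsets_at_top B)"
    using g has_sum_infsum has_sum_def by blast
  ultimately show ?thesis by (rule filterlim_compose[rotated])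
qed

lemma borel_measurable_infsum:
  fixes F :: "'b \<Rightarrow> 'a \<Rightarrow> real"
  assumes B: "countable B" and F: "\<And>\<beta>. \<beta> \<in> B \<Longrightarrow> F \<beta> \<in> borel_measurable M"
    and s: "\<And>z. z \<in> space M \<Longrightarrow> (\<lambda>\<beta>. F \<beta> z) summable_on B"
  shows "(\<lambda>z. \<Sum>\<^sub>\<infinity>\<beta>\<in>B. F \<beta> z) \<in> borel_measurable M"
proof (rule borel_measurable_LIMSEQ_real)
  show "(\<lambda>k. \<Sum>\<beta>\<in>exhaustion B k. F \<beta> z) \<longlonglongrightarrow> (\<Sum>\<^sub>\<infinity>\<beta>\<in>B. F \<beta> z)" if "z \<in> space M" for z
    by (rule infsum_exhaustion[OF B s[OF that]])
  show "(\<lambda>z. \<Sum>\<beta>\<in>exhaustion B k. F \<beta> z) \<in> borel_measurable M" for k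
    using F exhaustion(2)[OF B] by (intro borel_measurable_sum) auto
qed

text \<open>The tail unions decrease to the limit superior, and each of them contains one of the
  events. No relation between the events is required; those to come arise from different truncations
  of signed expressions and need not be nested.\<close>

lemma (in prob_space) prob_limsup_ge:
  fixes E :: "nat \<Rightarrow> 'a set"
  assumes E: "\<And>k. E k \<in> events" and p: "\<And>k. p \<le> prob (E k)"
  shows "(\<Inter>m. \<Union>k\<in>{m..}. E k) \<in> events" "p \<le> prob (\<Inter>m. \<Union>k\<in>{m..}. E k)"
proof -
  have m: "(\<Union>k\<in>{m..}. E k) \<in> events" for m :: nat using E by auto
  then show "(\<Inter>m. \<Union>k\<in>{m..}. E k) \<in> events" by auto
  have "(\<lambda>m. prob (\<Union>k\<in>{m..}. E k)) \<longlonglongrightarrow> prob (\<Inter>m. \<Union>k\<in>{m..}. E k)"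
    using m by (intro finite_Lim_measure_decseq) (force simp: decseq_def)+
  moreover have "p \<le> prob (\<Union>k\<in>{m..}. E k)" for m
  proof -
    have "prob (E m) \<le> prob (\<Union>k\<in>{m..}. E k)" using m by (intro finite_measure_mono) auto
    then show ?thesis using p[of m] by linarith
  qed
  ultimately show "p \<le> prob (\<Inter>m. \<Union>k\<in>{m..}. E k)" by (intro LIMSEQ_le_const) auto
qed

lemma frequently_abs_le_limit:
  fixes X :: "nat \<Rightarrow> real"
  assumes X: "X \<longlonglongrightarrow> L" and f: "frequently (\<lambda>k. \<bar>X k\<bar> \<le> R) sequentially"
  shows "\<bar>L\<bar> \<le> R"
proof (rule ccontr)
  assume "\<not> \<bar>L\<bar> \<le> R"
  then have "eventually (\<lambda>k. R < \<bar>X k\<bar>) sequentially"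
    using order_tendstoD(1)[OF tendsto_rabs[OF X], of R] by simp
  then show False using f by (simp add: frequently_def not_le)
qed

lemma summable_on_squares:
  fixes c :: "'b \<Rightarrow> real"
  assumes "\<And>T. finite T \<Longrightarrow> T \<subseteq> B \<Longrightarrow> (\<Sum>\<beta>\<in>T. (c \<beta>)^2) \<le> K"
  shows "(\<lambda>\<beta>. (c \<beta>)^2) summable_on B"
  by (rule nonneg_bdd_above_summable_on) (use assms in \<open>auto intro!: bdd_aboveI\<close>)

definition dep_dev_inf :: "'a measure \<Rightarrow> 'b set \<Rightarrow> ('b \<Rightarrow> 'a \<Rightarrow> real) \<Rightarrow> nat \<Rightarrow> ('a \<Rightarrow> real) \<Rightarrow> (nat \<Rightarrow> 'a) \<Rightarrow> real" where
  "dep_dev_inf M B b n f z =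
     (\<Sum>\<^sub>\<infinity>\<beta>\<in>B. (emp_cov n z z f (b \<beta>))^2) - (\<Sum>\<^sub>\<infinity>\<beta>\<in>B. (cov M f (b \<beta>))^2)"

text \<open>Stage k truncates the tuples and both bases at once, and the finite result gives an
  event of probability at least 1 - \<delta>. On the limit superior each tuple meets its bound at
  infinitely many stages, while its truncated deviations converge, so the bound passes to the limit.
  The features may change from stage to stage, because the finite bound does not see them.\<close>

lemma (in prob_space) countable_family_concentration:
  fixes f :: "'k \<Rightarrow> nat \<Rightarrow> 'a \<Rightarrow> real" and bY :: "'y \<Rightarrow> 'a \<Rightarrow> real" and bS :: "'s \<Rightarrow> 'a \<Rightarrow> real"
  assumes n: "n \<ge> 100" and r: "r \<ge> 1" and del: "0 < \<delta>" "\<delta> < 1" and lam: "0 \<le> lam" "lam \<le> 1"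
    and K: "countable K"
    and f: "\<And>q j. q \<in> K \<Longrightarrow> j < r \<Longrightarrow> f q j \<in> borel_measurable M"
      "\<And>q j z. q \<in> K \<Longrightarrow> j < r \<Longrightarrow> z \<in> space M \<Longrightarrow> \<bar>f q j z\<bar> \<le> 1"
    and fe: "\<And>K'. finite K' \<Longrightarrow> K' \<subseteq> K \<Longrightarrow> \<exists>(S :: nat set) e a. unit_features M S e \<and>
        (\<forall>q\<in>K'. \<forall>j<r. (\<Sum>m\<in>S. (a q j m)^2) \<le> 1 \<and> (\<forall>z\<in>space M. f q j z = (\<Sum>m\<in>S. a q j m * e m z)))"
    and BY: "countable BY" "\<And>T. finite T \<Longrightarrow> T \<subseteq> BY \<Longrightarrow> unit_features M T bY"
    and BS: "countable BS" "\<And>T. finite T \<Longrightarrow> T \<subseteq> BS \<Longrightarrow> unit_features M T bS"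
  obtains A where "A \<in> sets (samples n M)" "1 - \<delta> \<le> measure (samples n M) A"
    "\<And>z q. z \<in> A \<Longrightarrow> q \<in> K \<Longrightarrow>
      \<bar>(1 - lam) * (\<Sum>j<r. dep_dev_inf M BY bY n (f q j) z)
        - lam * (\<Sum>j<r. dep_dev_inf M BS bS n (f q j) z)\<bar>
      \<le> real r * conf_radius n \<delta>"
proof -
  let ?Q = "samples n M"
  interpret Q: prob_space ?Q by (intro prob_space_PiM) unfold_locales
  have n0: "n > 0" using n by simp
  define R where "R = real r * conf_radius n \<delta>"
  define h where "h k q z = (1 - lam) * (\<Sum>j<r. dep_dev M (exhaustion BY k) bY n (f q j) z)
    - lam * (\<Sum>j<r. dep_dev M (exhaustion BS k) bS n (f q j) z)" for k q z
  define E where "E k = {z \<in> space ?Q. \<forall>q\<in>exhaustion K k. \<bar>h k q z\<bar> \<le> R}" for k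
  have uY: "unit_features M (exhaustion BY k) bY" and uS: "unit_features M (exhaustion BS k) bS" for k
    by (rule BY(2)[OF exhaustion(1,2)[OF BY(1)]], rule BS(2)[OF exhaustion(1,2)[OF BS(1)]])
  have devm: "dep_dev M T b n (f q j) \<in> borel_measurable ?Q"
    if b: "unit_features M T b" and "q \<in> K" "j < r" for q j T and b :: "'x \<Rightarrow> 'a \<Rightarrow> real"
    unfolding dep_dev_def using emp_cov_measurable[OF f(1)[OF that(2,3)] unit_featuresD(2)[OF b]]
    by (intro borel_measurable_diff borel_measurable_sum borel_measurable_power) auto
  have hm: "h k q \<in> borel_measurable ?Q" if "q \<in> K" for k q
    unfolding h_def using devm[OF uY that] devm[OF uS that]
    by (intro borel_measurable_diff borel_measurable_sum borel_measurable_times) auto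
  have Em: "E k \<in> Q.events" for k
  proof -
    have fin: "finite (exhaustion K k)" by (rule exhaustion(1)[OF K])
    have hm': "h k q \<in> borel_measurable ?Q" if "q \<in> exhaustion K k" for q
      using that exhaustion(2)[OF K] by (intro hm) auto
    show ?thesis unfolding E_def
    proof (rule sets.sets_Collect_finite_All[OF _ fin])
      show "{z \<in> space ?Q. \<bar>h k q z\<bar> \<le> R} \<in> Q.events" if "q \<in> exhaustion K k" for q
        using hm'[OF that] by measurable
    qed
  qed
  have Ep: "1 - \<delta> \<le> Q.prob (E k)" for k
  proof -
    obtain S :: "nat set" and e a where Se: "unit_features M S e"
      "\<And>q j. q \<in> exhaustion K k \<Longrightarrow> j < r \<Longrightarrow> (\<Sum>m\<in>S. (a q j m)^2) \<le> 1"
      "\<And>q j z. q \<in> exhaustion K k \<Longrightarrow> j < r \<Longrightarrow> z \<in> space M \<Longrightarrow> f q j z = (\<Sum>m\<in>S. a q j m * e m z)"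
      using fe[OF exhaustion(1,2)[OF K], of k] by blast
    show ?thesis
      unfolding E_def h_def R_def
      by (rule finite_family_concentration[OF n r del lam exhaustion(1)[OF K] Se uY uS])
  qed
  define A where "A = (\<Inter>m. \<Union>k\<in>{m..}. E k)"
  show ?thesis
  proof (rule that)
    show "A \<in> sets ?Q" "1 - \<delta> \<le> measure ?Q A"
      unfolding A_def by (rule Q.prob_limsup_ge[OF Em Ep])+
    fix z q assume z: "z \<in> A" and k: "q \<in> K"
    have zQ: "z \<in> space ?Q" using z by (auto simp: A_def E_def)
    have zi: "z i \<in> space M" if "i < n" for i using space_PiM_component[OF zQ] that by auto
    have lim: "(\<lambda>k. dep_dev M (exhaustion B k) b n (f q j) z) \<longlonglongrightarrow> dep_dev_inf M B b n (f q j) z"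
      if B: "countable B" "\<And>T. finite T \<Longrightarrow> T \<subseteq> B \<Longrightarrow> unit_features M T b" and j: "j < r"
      for B j and b :: "'x \<Rightarrow> 'a \<Rightarrow> real"
      unfolding dep_dev_def dep_dev_inf_def
    proof (intro tendsto_diff infsum_exhaustion B(1) summable_on_squares)
      fix T assume T: "finite T" "T \<subseteq> B"
      show "emp_dep n z z (f q j) b T \<le> 1"
        using f(2)[OF k j] zi unit_featuresD[OF B(2)[OF T]] by (intro emp_dep_le_1 n0) auto
      show "pop_dep M (f q j) b T \<le> 1"
        by (rule dep_le_1[OF B(2)[OF T] f(1)[OF k j] f(2)[OF k j]])
    qed
    have "(\<lambda>i. h i q z) \<longlonglongrightarrow>
      (1 - lam) * (\<Sum>j<r. dep_dev_inf M BY bY n (f q j) z)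
        - lam * (\<Sum>j<r. dep_dev_inf M BS bS n (f q j) z)"
      unfolding h_def using lim[OF BY] lim[OF BS]
      by (intro tendsto_diff tendsto_mult tendsto_const tendsto_sum) auto
    \<comment> \<open>The sample lies in infinitely many events and \<open>q\<close> belongs to all
      late stages, so both happen together infinitely often.\<close>
    moreover have "frequently (\<lambda>i. \<bar>h i q z\<bar> \<le> R) sequentially"
    proof -
      have "\<exists>i\<ge>m. z \<in> E i" for m using z by (auto simp: A_def)
      then have "frequently (\<lambda>i. z \<in> E i) sequentially" by (simp add: frequently_sequentially)
      from frequently_eventually_conj[OF this exhaustion(3)[OF K k]]
      show ?thesis by (rule frequently_elim1) (auto simp: E_def)
    qed
    ultimately show "\<bar>(1 - lam) * (\<Sum>j<r. dep_dev_inf M BY bY n (f q j) z)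
        - lam * (\<Sum>j<r. dep_dev_inf M BS bS n (f q j) z)\<bar>
      \<le> real r * conf_radius n \<delta>"
      unfolding R_def by (rule frequently_abs_le_limit)
  qed
qed

section \<open>Orthonormal families and universality\<close>

text \<open>Split off from \<open>rkhs\<close> because the space of input functions carries two
  inner products, the original one and the regularised covariance form, and Gram-Schmidt is applied
  to the second.\<close>

locale ip_space =
  fixes H :: "('a \<Rightarrow> real) set" and ip :: "('a \<Rightarrow> real) \<Rightarrow> ('a \<Rightarrow> real) \<Rightarrow> real"
  assumes zero_mem: "(\<lambda>x. 0) \<in> H"
    and add_mem: "f \<in> H \<Longrightarrow> g \<in> H \<Longrightarrow> (\<lambda>x. f x + g x) \<in> H"
    and scale_mem: "f \<in> H \<Longrightarrow> (\<lambda>x. c * f x) \<in> H"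
    and ip_commute: "f \<in> H \<Longrightarrow> g \<in> H \<Longrightarrow> ip f g = ip g f"
    and ip_add: "f \<in> H \<Longrightarrow> g \<in> H \<Longrightarrow> h \<in> H \<Longrightarrow> ip (\<lambda>x. f x + g x) h = ip f h + ip g h"
    and ip_scale: "f \<in> H \<Longrightarrow> g \<in> H \<Longrightarrow> ip (\<lambda>x. c * f x) g = c * ip f g"
    and ip_nonneg: "f \<in> H \<Longrightarrow> 0 \<le> ip f f"
    and ip_definite: "f \<in> H \<Longrightarrow> ip f f = 0 \<Longrightarrow> f = (\<lambda>x. 0)"
begin

lemma ip_zero: "g \<in> H \<Longrightarrow> ip (\<lambda>x. 0) g = 0"
  using ip_scale[of "\<lambda>x. 0" g 0] zero_mem by simp

lemma sum_mem: "(\<And>m. m \<in> S \<Longrightarrow> e m \<in> H) \<Longrightarrow> (\<lambda>x. \<Sum>m\<in>S. c m * e m x) \<in> H"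
proof (induction S rule: infinite_finite_induct)
  case (insert m S)
  then show ?case using add_mem[OF scale_mem[of "e m" "c m"]] by simp
qed (auto simp: zero_mem)

lemma ip_sum:
  assumes "g \<in> H"
  shows "(\<And>m. m \<in> S \<Longrightarrow> e m \<in> H) \<Longrightarrow> ip (\<lambda>x. \<Sum>m\<in>S. c m * e m x) g = (\<Sum>m\<in>S. c m * ip (e m) g)"
proof (induction S rule: infinite_finite_induct)
  case (insert m S)
  have "ip (\<lambda>x. c m * e m x + (\<Sum>m\<in>S. c m * e m x)) g = ip (\<lambda>x. c m * e m x) g + ip (\<lambda>x. \<Sum>m\<in>S. c m * e m x) g"
    using insert.prems assms by (intro ip_add scale_mem sum_mem) auto
  then show ?case using insert assms by (simp add: ip_scale)
qed (auto simp: ip_zero assms)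

definition orthonormal :: "'m set \<Rightarrow> ('m \<Rightarrow> 'a \<Rightarrow> real) \<Rightarrow> bool" where
  "orthonormal S e \<longleftrightarrow> finite S \<and> (\<forall>m\<in>S. e m \<in> H) \<and>
     (\<forall>m\<in>S. \<forall>l\<in>S. ip (e m) (e l) = (if m = l then 1 else 0))"

lemma ip_combination:
  assumes e: "orthonormal S e" and l: "l \<in> S"
  shows "ip (\<lambda>x. \<Sum>m\<in>S. c m * e m x) (e l) = c l"
proof -
  have "ip (\<lambda>x. \<Sum>m\<in>S. c m * e m x) (e l) = (\<Sum>m\<in>S. c m * ip (e m) (e l))"
    using e l by (intro ip_sum) (auto simp: orthonormal_def)
  also have "\<dots> = (\<Sum>m\<in>S. if m = l then c m else 0)"
    using e l by (intro sum.cong) (auto simp: orthonormal_def)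
  also have "\<dots> = c l" using e l by (simp add: orthonormal_def)
  finally show ?thesis .
qed

lemma ip_combination_right:
  assumes e: "orthonormal S e" and l: "l \<in> S"
  shows "ip (e l) (\<lambda>x. \<Sum>m\<in>S. c m * e m x) = c l"
  using ip_combination[OF assms, of c] e l
  by (subst ip_commute) (auto simp: orthonormal_def intro: sum_mem)

lemma ip_combination_self:
  assumes e: "orthonormal S e"
  shows "ip (\<lambda>x. \<Sum>m\<in>S. c m * e m x) (\<lambda>x. \<Sum>m\<in>S. c m * e m x) = (\<Sum>m\<in>S. (c m)^2)"
proof -
  have "ip (\<lambda>x. \<Sum>m\<in>S. c m * e m x) (\<lambda>x. \<Sum>m\<in>S. c m * e m x)
      = (\<Sum>m\<in>S. c m * ip (e m) (\<lambda>x. \<Sum>m\<in>S. c m * e m x))"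
    using e by (intro ip_sum sum_mem) (auto simp: orthonormal_def)
  also have "\<dots> = (\<Sum>m\<in>S. c m * c m)"
    using ip_combination_right[OF e] by (intro sum.cong) auto
  finally show ?thesis by (simp add: power2_eq_square)
qed

text \<open>g minus its orthogonal projection, written as a sum with factor -1 so that closure under
  addition and scaling applies directly.\<close>

definition residual :: "'m set \<Rightarrow> ('m \<Rightarrow> 'a \<Rightarrow> real) \<Rightarrow> ('a \<Rightarrow> real) \<Rightarrow> 'a \<Rightarrow> real" where
  "residual S e g = (\<lambda>x. g x + (-1) * (\<Sum>m\<in>S. ip g (e m) * e m x))"

lemma residual:
  assumes e: "orthonormal S e" and g: "g \<in> H"
  shows "residual S e g \<in> H" "l \<in> S \<Longrightarrow> ip (residual S e g) (e l) = 0"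
    "ip (residual S e g) (residual S e g) = ip g g - (\<Sum>m\<in>S. (ip g (e m))^2)"
    "ip g (residual S e g) = ip (residual S e g) (residual S e g)"
proof -
  let ?p = "\<lambda>x. \<Sum>m\<in>S. ip g (e m) * e m x"
  have eH: "\<And>m. m \<in> S \<Longrightarrow> e m \<in> H" using e by (auto simp: orthonormal_def)
  have p: "?p \<in> H" by (rule sum_mem[OF eH])
  then show r: "residual S e g \<in> H" unfolding residual_def by (intro add_mem g scale_mem)
  have rip: "ip (residual S e g) h = ip g h - ip ?p h" if "h \<in> H" for h
  proof -
    have "ip (residual S e g) h = ip g h + ip (\<lambda>x. (-1) * ?p x) h"
      unfolding residual_def by (rule ip_add[OF g scale_mem[OF p] that])
    also have "ip (\<lambda>x. (-1) * ?p x) h = (-1) * ip ?p h" by (rule ip_scale[OF p that])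
    finally show ?thesis by simp
  qed
  show orth: "ip (residual S e g) (e l) = 0" if "l \<in> S" for l
    using that rip[OF eH] ip_combination[OF e] by simp
  have "ip ?p (residual S e g) = (\<Sum>m\<in>S. ip g (e m) * ip (e m) (residual S e g))"
    by (intro ip_sum r eH)
  also have "\<dots> = 0"
    using orth ip_commute[OF r eH] by (intro sum.neutral) auto
  finally have p0: "ip ?p (residual S e g) = 0" .
  then show gr: "ip g (residual S e g) = ip (residual S e g) (residual S e g)" using rip[OF r] by simp
  have "ip g (residual S e g) = ip g g - ip ?p g"
    using rip[OF g] ip_commute[OF g r] by simp
  also have "ip ?p g = (\<Sum>m\<in>S. ip g (e m) * ip (e m) g)" by (intro ip_sum g eH)
  also have "\<dots> = (\<Sum>m\<in>S. (ip g (e m))^2)"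
    using ip_commute[OF g eH] by (intro sum.cong) (auto simp: power2_eq_square)
  finally show "ip (residual S e g) (residual S e g) = ip g g - (\<Sum>m\<in>S. (ip g (e m))^2)" using gr by simp
qed

lemma bessel:
  assumes "orthonormal S e" "g \<in> H"
  shows "(\<Sum>m\<in>S. (ip g (e m))^2) \<le> ip g g"
  using residual(3)[OF assms] ip_nonneg[OF residual(1)[OF assms]] by linarith

lemma cauchy_schwarz:
  assumes f: "f \<in> H" and g: "g \<in> H"
  shows "(ip f g)^2 \<le> ip f f * ip g g"
proof (cases "ip g g = 0")
  case True
  then have "g = (\<lambda>x. 0)" by (rule ip_definite[OF g])
  then have "ip f g = 0" using ip_zero[OF f] ip_commute[OF f g] by simp
  then show ?thesis using True by simp
next
  case False
  define s where "s = sqrt (ip g g)"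
  have s: "s * s = ip g g" "s \<noteq> 0" using False ip_nonneg[OF g] by (auto simp: s_def)
  define w where "w = (\<lambda>x. 1 / s * g x)"
  have w: "w \<in> H" unfolding w_def by (rule scale_mem[OF g])
  have wip: "ip w h = 1 / s * ip g h" if "h \<in> H" for h unfolding w_def by (rule ip_scale[OF g that])
  have "ip w w = 1 / s * (1 / s * (s * s))"
    using wip[OF w] wip[OF g] ip_commute[OF g w] s(1) by simp
  \<comment> \<open>Cauchy-Schwarz is Bessel's inequality for the one-element family consisting of
    the normalised \<open>g\<close>.\<close>
  then have "orthonormal {()} (\<lambda>_. w)"
    using w s(2) by (simp add: orthonormal_def)
  from bessel[OF this f] have "(ip f w)^2 \<le> ip f f" by simp
  moreover have "ip f w = ip f g / s"
    using ip_commute[OF f w] wip[OF f] ip_commute[OF f g] by simp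
  ultimately have "(ip f g)^2 / (s * s) \<le> ip f f" by (simp add: power_divide power2_eq_square)
  then show ?thesis using s ip_nonneg[OF g] False by (simp add: divide_simps split: if_splits)
qed

text \<open>One Gram-Schmidt step: the residual of \<open>g\<close> is nonzero by definiteness, and
  its normalisation becomes vector number \<open>N\<close>.\<close>

lemma orthonormal_extend:
  fixes N :: nat
  assumes e: "orthonormal {..<N} e" and g: "g \<in> H"
    and ne: "g \<noteq> (\<lambda>x. \<Sum>m<N. ip g (e m) * e m x)"
  obtains e' where "orthonormal {..<Suc N} (e(N := e'))"
    "g = (\<lambda>x. \<Sum>m<Suc N. ip g ((e(N := e')) m) * (e(N := e')) m x)"
proof -
  define h where "h = residual {..<N} e g"
  note R = residual[OF e g, folded h_def]
  have "ip h h \<noteq> 0"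
  proof
    assume "ip h h = 0"
    then have "h = (\<lambda>x. 0)" by (rule ip_definite[OF R(1)])
    then have "g x = (\<Sum>m<N. ip g (e m) * e m x)" for x by (simp add: h_def residual_def fun_eq_iff)
    then show False using ne by auto
  qed
  define s where "s = sqrt (ip h h)"
  have s: "s * s = ip h h" "s \<noteq> 0" using \<open>ip h h \<noteq> 0\<close> ip_nonneg[OF R(1)] by (auto simp: s_def)
  define e' where "e' = (\<lambda>x. 1 / s * h x)"
  have e'H: "e' \<in> H" unfolding e'_def by (rule scale_mem[OF R(1)])
  have ip_e': "ip f e' = ip f h / s" if "f \<in> H" for f
    using ip_commute[OF that e'H] ip_scale[OF R(1) that, of "1 / s"] ip_commute[OF that R(1)] by (simp add: e'_def)
  have "ip e' h = ip h h / s" using ip_scale[OF R(1) R(1), of "1 / s"] by (simp add: e'_def)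
  then have e'1: "ip e' e' = 1" using ip_e'[OF e'H] s(2) by (simp flip: s(1))
  have eH: "\<And>m. m < N \<Longrightarrow> e m \<in> H" using e by (auto simp: orthonormal_def)
  have e'0: "ip (e m) e' = 0" "ip e' (e m) = 0" if "m < N" for m
    using ip_e'[OF eH[OF that]] R(2)[of m] ip_commute[OF R(1) eH[OF that]] ip_commute[OF e'H eH[OF that]] that by auto
  have ge': "ip g e' = s" using ip_e'[OF g] R(4) s(2) by (simp flip: s(1))
  show ?thesis
  proof (rule that[of e'])
    show "orthonormal {..<Suc N} (e(N := e'))"
      using e e'H e'1 e'0 by (auto simp: orthonormal_def less_Suc_eq)
    have "g x = (\<Sum>m<Suc N. ip g ((e(N := e')) m) * (e(N := e')) m x)" for x
      using s(2) by (simp add: ge') (simp add: e'_def h_def residual_def)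
    then show "g = (\<lambda>x. \<Sum>m<Suc N. ip g ((e(N := e')) m) * (e(N := e')) m x)" by auto
  qed
qed

lemma finite_orthonormal_span:
  assumes "finite F" "F \<subseteq> H"
  shows "\<exists>(N :: nat) e. orthonormal {..<N} e \<and> (\<forall>f\<in>F. \<exists>a. f = (\<lambda>x. \<Sum>m<N. a m * e m x))"
  using assms
proof (induction F rule: finite_induct)
  case empty
  show ?case by (intro exI[of _ 0]) (auto simp: orthonormal_def)
next
  case (insert g F)
  then obtain N :: nat and e where e: "orthonormal {..<N} e" "\<And>f. f \<in> F \<Longrightarrow> \<exists>a. f = (\<lambda>x. \<Sum>m<N. a m * e m x)"
    by auto
  show ?case
  proof (cases "g = (\<lambda>x. \<Sum>m<N. ip g (e m) * e m x)")
    case True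
    then have "\<exists>a. g = (\<lambda>x. \<Sum>m<N. a m * e m x)" by (intro exI[of _ "\<lambda>m. ip g (e m)"])
    then show ?thesis using e by (intro exI[of _ N] exI[of _ e]) auto
  next
    case False
    obtain e' where e': "orthonormal {..<Suc N} (e(N := e'))"
      "g = (\<lambda>x. \<Sum>m<Suc N. ip g ((e(N := e')) m) * (e(N := e')) m x)"
      using orthonormal_extend[OF e(1) _ False] insert.prems by blast
    have "\<exists>a. f = (\<lambda>x. \<Sum>m<Suc N. a m * (e(N := e')) m x)" if f: "f \<in> F" for f
    proof -
      obtain a where "f = (\<lambda>x. \<Sum>m<N. a m * e m x)" using e(2)[OF f] by blast
      \<comment> \<open>The coefficient at \<open>N\<close> has to be reset to 0, since
        \<open>a\<close> is arbitrary outside the old index range.\<close>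
      then have "f = (\<lambda>x. \<Sum>m<Suc N. (a(N := 0)) m * (e(N := e')) m x)" by (auto simp: fun_eq_iff)
      then show ?thesis by blast
    qed
    moreover have "\<exists>a. g = (\<lambda>x. \<Sum>m<Suc N. a m * (e(N := e')) m x)"
      by (rule exI[of _ "\<lambda>m. ip g ((e(N := e')) m)"]) (rule e'(2))
    ultimately show ?thesis using e'(1) by blast
  qed
qed

lemma orthonormal_extension:
  fixes N r :: nat
  assumes inf: "\<And>p e. \<exists>g\<in>H. \<forall>a. g \<noteq> (\<lambda>x. \<Sum>m<(p::nat). a m * e m x)"
    and e: "orthonormal {..<N} e"
  shows "\<exists>e'. orthonormal {..<N + r} e' \<and> (\<forall>m<N. e' m = e m)"
proof (induction r)
  case 0
  then show ?case using e by auto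
next
  case (Suc r)
  then obtain e' where e': "orthonormal {..<N + r} e'" "\<And>m. m < N \<Longrightarrow> e' m = e m" by auto
  obtain g where g: "g \<in> H" "\<And>a. g \<noteq> (\<lambda>x. \<Sum>m<N + r. a m * e' m x)" using inf[of e' "N + r"] by blast
  obtain e'' where "orthonormal {..<Suc (N + r)} (e'(N + r := e''))"
    using orthonormal_extend[OF e'(1) g(1) g(2)] by blast
  then have "orthonormal {..<N + Suc r} (e'(N + r := e''))" by (simp del: fun_upd_apply)
  moreover have "\<forall>m<N. (e'(N + r := e'')) m = e m" using e'(2) by auto
  ultimately show ?case by blast
qed

end

lemma rkhs_ip_space:
  assumes "rkhs D H ip k"
  shows "ip_space H ip"
proof -
  interpret R: rkhs D H ip k by fact
  show ?thesis
    by (rule ip_space.intro)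
       (fact R.zero_mem R.add_mem R.scale_mem R.ip_commute R.ip_add R.ip_scale R.ip_nonneg R.ip_definite)+
qed

section \<open>Infinite dimension of universal spaces\<close>

lemma homogeneous_system_nontrivial_solution:
  fixes a :: "nat \<Rightarrow> 'l \<Rightarrow> real"
  assumes "finite L" "p < card L"
  shows "\<exists>v. (\<exists>l\<in>L. v l \<noteq> 0) \<and> (\<forall>i<p. (\<Sum>l\<in>L. v l * a i l) = 0)"
  using assms
proof (induction p arbitrary: L a)
  case 0
  then have "L \<noteq> {}" by auto
  then show ?case by (intro exI[of _ "\<lambda>_. 1"]) auto
next
  case (Suc p)
  show ?case
  proof (cases "\<forall>l\<in>L. a p l = 0")
    case True
    obtain v where v: "\<exists>l\<in>L. v l \<noteq> 0" "\<forall>i<p. (\<Sum>l\<in>L. v l * a i l) = 0" using Suc.IH[of L a] Suc.prems by auto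
    then show ?thesis using True by (intro exI[of _ v]) (auto simp: less_Suc_eq)
  next
    case False
    then obtain q where q: "q \<in> L" "a p q \<noteq> 0" by blast
    \<comment> \<open>Gaussian elimination: equation \<open>p\<close> is solved for the unknown
      \<open>q\<close>, whose coefficient is nonzero, and \<open>a'\<close> is the system after
      substitution, with one equation and one unknown fewer.\<close>
    define a' where "a' i l = a i l - a i q * a p l / a p q" for i l
    have card: "finite (L - {q})" "p < card (L - {q})"
      using Suc.prems q(1) by (auto simp: card_Diff_singleton)
    obtain v where v: "\<exists>l\<in>L - {q}. v l \<noteq> 0" "\<And>i. i < p \<Longrightarrow> (\<Sum>l\<in>L - {q}. v l * a' i l) = 0"
      using Suc.IH[of "L - {q}" a'] card by auto
    define c where "c = - (\<Sum>l\<in>L - {q}. v l * a p l) / a p q"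
    have eq: "(\<Sum>l\<in>L. (v(q := c)) l * a i l) = (\<Sum>l\<in>L - {q}. v l * a i l) + c * a i q" for i
      using Suc.prems(1) q(1) by (subst sum.remove[of L q]) (auto intro: sum.cong)
    have "(\<Sum>l\<in>L - {q}. v l * a' i l) = (\<Sum>l\<in>L - {q}. v l * a i l) + c * a i q" for i
      unfolding a'_def c_def
      by (simp add: right_diff_distrib sum_subtractf sum_distrib_left sum_divide_distrib mult_ac)
    with v(2) eq have "(\<Sum>l\<in>L. (v(q := c)) l * a i l) = 0" if "i < p" for i using that by simp
    moreover have "(\<Sum>l\<in>L. (v(q := c)) l * a p l) = 0" using eq[of p] q(2) by (simp add: c_def del: fun_upd_apply)
    moreover have "\<exists>l\<in>L. (v(q := c)) l \<noteq> 0" using v(1) by auto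
    ultimately show ?thesis by (intro exI[of _ "v(q := c)"]) (auto simp: less_Suc_eq simp del: fun_upd_apply)
  qed
qed

text \<open>On N + 1 distinct points all functions in the span of N functions satisfy a common
  nontrivial linear relation \<open>v\<close>. Universality yields an \<open>h\<close> close to
  \<open>v\<close> itself on these points, and the relation applied to \<open>h\<close> would then
  be close to the positive sum of squares of \<open>v\<close>.\<close>

lemma universal_not_finitely_spanned:
  fixes H :: "('a::euclidean_space \<Rightarrow> real) set" and N :: nat
  assumes U: "universal_rkhs H"
  shows "\<exists>g\<in>H. \<forall>a. g \<noteq> (\<lambda>x. \<Sum>m<N. a m * e m x)"
proof (rule ccontr)
  assume "\<not> ?thesis"
  then have span: "\<exists>a. h = (\<lambda>x. \<Sum>m<N. a m * e m x)" if "h \<in> H" for h using that by blast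
  obtain b :: 'a where b: "b \<noteq> 0" using nonempty_Basis nonzero_Basis by blast
  define L where "L = (\<lambda>l. real l *\<^sub>R b) ` {..N}"
  have "inj_on (\<lambda>l. real l *\<^sub>R b) {..N}" using b by (auto simp: inj_on_def)
  then have L: "finite L" "N < card L" by (auto simp: L_def card_image)
  obtain v where v: "\<exists>l\<in>L. v l \<noteq> 0" "\<And>i. i < N \<Longrightarrow> (\<Sum>l\<in>L. v l * e i l) = 0"
    using homogeneous_system_nontrivial_solution[OF L, of e] by blast
  define s where "s = (\<Sum>l\<in>L. (v l)^2)"
  define t where "t = (\<Sum>l\<in>L. \<bar>v l\<bar>)"
  have s: "s > 0" unfolding s_def using v(1) L(1) by (auto intro: sum_pos2)
  have t: "t \<ge> 0" unfolding t_def by (auto intro: sum_nonneg)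
  have "compact L" "continuous_on L v"
    using L(1) by (auto intro: finite_imp_compact continuous_on_finite)
  \<comment> \<open>The total error is at most t times the tolerance. The added 1 keeps the quotient
    defined and makes t s / (t + 1) strictly smaller than s.\<close>
  then obtain h where h: "h \<in> H" "\<And>x. x \<in> L \<Longrightarrow> \<bar>h x - v x\<bar> < s / (t + 1)"
    using U s t unfolding universal_rkhs_def by (metis add_nonneg_pos divide_pos_pos zero_less_one)
  obtain a where a: "h = (\<lambda>x. \<Sum>m<N. a m * e m x)" using span[OF h(1)] by blast
  have "(\<Sum>l\<in>L. v l * h l) = (\<Sum>m<N. a m * (\<Sum>l\<in>L. v l * e m l))"
    unfolding a by (simp add: sum_distrib_left mult.left_commute) (rule sum.swap)
  then have 0: "(\<Sum>l\<in>L. v l * h l) = 0" using v(2) by simp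
  have "s = \<bar>\<Sum>l\<in>L. v l * (h l - v l)\<bar>"
    using s 0 by (simp add: right_diff_distrib sum_subtractf s_def power2_eq_square)
  also have "\<dots> \<le> (\<Sum>l\<in>L. \<bar>v l\<bar> * (s / (t + 1)))"
  proof (intro order_trans[OF sum_abs] sum_mono)
    show "\<bar>v l * (h l - v l)\<bar> \<le> \<bar>v l\<bar> * (s / (t + 1))" if "l \<in> L" for l
      unfolding abs_mult using h(2)[OF that] by (intro mult_left_mono) auto
  qed
  also have "\<dots> = t * (s / (t + 1))" by (simp only: t_def sum_distrib_right)
  also have "\<dots> < s" using s t by (simp add: field_simps)
  finally show False by simp
qed

text \<open>A countable network for the topology of pointwise convergence: conditions on the values of f
  on finitely many basic open sets, with rational bounds.\<close>

lemma countable_pointwise_dense: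
  fixes A :: "('j::countable \<Rightarrow> 'a::second_countable_topology \<Rightarrow> real) set"
  assumes cont: "\<And>f j. f \<in> A \<Longrightarrow> j \<in> I \<Longrightarrow> continuous_on UNIV (f j)"
  obtains A0 where "countable A0" "A0 \<subseteq> A"
    "\<And>f X eps. f \<in> A \<Longrightarrow> finite X \<Longrightarrow> finite I \<Longrightarrow> eps > 0 \<Longrightarrow> \<exists>f'\<in>A0. \<forall>j\<in>I. \<forall>x\<in>X. \<bar>f j x - f' j x\<bar> < eps"
proof -
  obtain \<B> :: "'a set set" where \<B>: "countable \<B>" "topological_basis \<B>" using ex_countable_basis by blast
  define C :: "('j \<times> 'a set \<times> real \<times> real) set" where "C = UNIV \<times> \<B> \<times> \<rat> \<times> \<rat>"
  have C: "countable C" unfolding C_def using \<B>(1) countable_rat by (intro countable_SIGMA) auto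
  define sat where "sat W f \<longleftrightarrow> f \<in> A \<and> (\<forall>(j, B, p, q)\<in>W. \<forall>x\<in>B. p < f j x \<and> f j x < q)"
    for W :: "('j \<times> 'a set \<times> real \<times> real) set" and f
  \<comment> \<open>One tuple is chosen for each satisfiable finite set of conditions. Membership in
    \<open>A\<close> is part of \<open>sat\<close>, so the chosen tuples belong to the family itself
    and not just to its closure.\<close>
  define A0 where "A0 = (\<lambda>W. SOME f. sat W f) ` {W. finite W \<and> W \<subseteq> C \<and> Ex (sat W)}"
  have S: "sat W (SOME f. sat W f)" if "Ex (sat W)" for W using that by (rule someI_ex)
  show ?thesis
  proof (rule that[of A0])
    have "countable {W. finite W \<and> W \<subseteq> C}" by (rule countable_Collect_finite_subset[OF C])
    then show "countable A0"
      unfolding A0_def by (intro countable_image) (auto elim: countable_subset[rotated])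
    show "A0 \<subseteq> A" using S by (auto simp: A0_def sat_def)
    fix f and X :: "'a set" and eps :: real assume f: "f \<in> A" and X: "finite X" and I: "finite I" and eps: "eps > 0"
    have "\<exists>B p q. B \<in> \<B> \<and> p \<in> \<rat> \<and> q \<in> \<rat> \<and> x \<in> B \<and> q - p < eps \<and> (\<forall>y\<in>B. p < f j y \<and> f j y < q)"
      if j: "j \<in> I" for j x
    proof -
      obtain p where p: "p \<in> \<rat>" "f j x - eps / 2 < p" "p < f j x" using Rats_dense_in_real[of "f j x - eps / 2" "f j x"] eps by auto
      obtain q where q: "q \<in> \<rat>" "f j x < q" "q < f j x + eps / 2" using Rats_dense_in_real[of "f j x" "f j x + eps / 2"] eps by auto
      have "open (f j -` {p<..<q})"
        using cont[OF f j] by (intro open_vimage) auto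
      moreover have "x \<in> f j -` {p<..<q}" using p q by simp
      ultimately obtain B where "B \<in> \<B>" "x \<in> B" "B \<subseteq> f j -` {p<..<q}"
        by (rule topological_basisE[OF \<B>(2)])
      then show ?thesis using p q by (intro exI[of _ B] exI[of _ p] exI[of _ q]) auto
    qed
    then obtain B p q where Bpq: "\<And>j x. j \<in> I \<Longrightarrow> B j x \<in> \<B> \<and> p j x \<in> \<rat> \<and> q j x \<in> \<rat> \<and> x \<in> B j x \<and> q j x - p j x < eps \<and> (\<forall>y\<in>B j x. p j x < f j y \<and> f j y < q j x)"
      by metis
    define W where "W = (\<lambda>(j, x). (j, B j x, p j x, q j x)) ` (I \<times> X)"
    have W: "finite W" "W \<subseteq> C" "sat W f"
      using f X I Bpq by (auto simp: W_def C_def sat_def)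
    define f' where "f' = (SOME f. sat W f)"
    have f': "sat W f'" unfolding f'_def using W(3) by (intro S) auto
    have "f' \<in> A0" unfolding A0_def f'_def using W by blast
    moreover have "\<bar>f j x - f' j x\<bar> < eps" if "j \<in> I" "x \<in> X" for j x
    proof -
      have "(j, B j x, p j x, q j x) \<in> W" using that by (auto simp: W_def)
      then have "\<forall>y\<in>B j x. p j x < f' j y \<and> f' j y < q j x" using f' by (auto simp: sat_def)
      then have "p j x < f' j x" "f' j x < q j x" "p j x < f j x" "f j x < q j x" "q j x - p j x < eps" using Bpq[OF that(1), of x] by auto
      then show ?thesis by linarith
    qed
    ultimately show "\<exists>f'\<in>A0. \<forall>j\<in>I. \<forall>x\<in>X. \<bar>f j x - f' j x\<bar> < eps" by blast
  qed
qed

section \<open>Admissible tuples\<close>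

lemma emp_cov_scale: "emp_cov n x u (\<lambda>v. c * f v) g = c * emp_cov n x u f g"
  using emp_cov_sum_left[of n x u "\<lambda>_. c" "\<lambda>_. f" "{()}" g] by simp

lemma emp_cov_diff: "emp_cov n x u (\<lambda>v. f v - f' v) g = emp_cov n x u f g - emp_cov n x u f' g"
  using emp_cov_sum_left[of n x u "\<lambda>m. if m then 1 else -1" "\<lambda>m. if m then f else f'" UNIV g]
  by (simp add: UNIV_bool)

lemma cov_scale: "cov M (\<lambda>z. c * f z) g = c * cov M f g"
proof -
  have "cov M (\<lambda>z. c * f z) g = (\<integral>z. c * ((f z - (\<integral>z. f z \<partial>M)) * (g z - (\<integral>z. g z \<partial>M))) \<partial>M)"
    unfolding cov_def by (simp add: algebra_simps)
  then show ?thesis unfolding cov_def by simp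
qed

lemma emp_dep_le:
  assumes n: "n > 0" and T: "finite T" and F: "F > 0"
    and f: "\<And>i. i < n \<Longrightarrow> \<bar>f (x i)\<bar> \<le> F"
    and b: "\<And>i. i < n \<Longrightarrow> (\<Sum>\<beta>\<in>T. (b \<beta> (u i))^2) \<le> 1"
  shows "emp_dep n x u f b T \<le> F^2"
proof -
  have "emp_cov n x u f g = F * emp_cov n x u (\<lambda>v. 1 / F * f v) g" for g
    using F by (simp only: emp_cov_scale) simp
  then have "emp_dep n x u f b T = F^2 * emp_dep n x u (\<lambda>v. 1 / F * f v) b T"
    by (simp only: power_mult_distrib sum_distrib_left)
  also have "\<dots> \<le> F^2 * 1"
    using F f by (intro mult_left_mono emp_dep_le_1 n T b) (auto simp: abs_mult)
  finally show ?thesis by simp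
qed

lemma (in prob_space) dep_le:
  assumes b: "unit_features M T b" and F: "F > 0"
    and f: "f \<in> borel_measurable M" "\<And>z. z \<in> space M \<Longrightarrow> \<bar>f z\<bar> \<le> F"
  shows "pop_dep M f b T \<le> F^2"
proof -
  have "cov M f g = F * cov M (\<lambda>v. 1 / F * f v) g" for g
    using F by (simp only: cov_scale) simp
  then have "pop_dep M f b T = F^2 * pop_dep M (\<lambda>v. 1 / F * f v) b T"
    by (simp only: power_mult_distrib sum_distrib_left)
  also have "\<dots> \<le> F^2 * 1"
    using F f by (intro mult_left_mono dep_le_1 b) (auto simp: abs_mult)
  finally show ?thesis by simp
qed

text \<open>The covariance vector is linear in the function: that of the difference has length at
  most \<open>eps\<close>, that of the sum at most 2 F, and the product of the two lengths bounds
  the difference of squares. Only values at sample points enter, so approximation on finite sets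
  controls the empirical term.\<close>

lemma emp_dep_lipschitz:
  assumes n: "n > 0" and B: "countable B" and F: "F > 0" and eps: "eps > 0"
    and f: "\<And>i. i < n \<Longrightarrow> \<bar>f (x i)\<bar> \<le> F" and f': "\<And>i. i < n \<Longrightarrow> \<bar>f' (x i)\<bar> \<le> F"
    and d: "\<And>i. i < n \<Longrightarrow> \<bar>f (x i) - f' (x i)\<bar> \<le> eps"
    and b: "\<And>i T. i < n \<Longrightarrow> finite T \<Longrightarrow> T \<subseteq> B \<Longrightarrow> (\<Sum>\<beta>\<in>T. (b \<beta> (u i))^2) \<le> 1"
  shows "\<bar>(\<Sum>\<^sub>\<infinity>\<beta>\<in>B. (emp_cov n x u f (b \<beta>))^2) - (\<Sum>\<^sub>\<infinity>\<beta>\<in>B. (emp_cov n x u f' (b \<beta>))^2)\<bar> \<le> 2 * F * eps"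
proof -
  define c where "c \<beta> = emp_cov n x u f (b \<beta>)" for \<beta>
  define c' where "c' \<beta> = emp_cov n x u f' (b \<beta>)" for \<beta>
  have le: "\<bar>(\<Sum>\<beta>\<in>T. (c \<beta>)^2) - (\<Sum>\<beta>\<in>T. (c' \<beta>)^2)\<bar> \<le> 2 * F * eps" if T: "finite T" "T \<subseteq> B" for T
  proof -
    have "\<bar>(\<Sum>\<beta>\<in>T. (c \<beta>)^2) - (\<Sum>\<beta>\<in>T. (c' \<beta>)^2)\<bar> = \<bar>\<Sum>\<beta>\<in>T. (c \<beta> - c' \<beta>) * (c \<beta> + c' \<beta>)\<bar>"
      by (simp add: sum_subtractf[symmetric] power2_eq_square algebra_simps)
    also have "\<dots> \<le> (\<Sum>\<beta>\<in>T. \<bar>c \<beta> - c' \<beta>\<bar> * \<bar>c \<beta> + c' \<beta>\<bar>)"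
      by (rule order_trans[OF sum_abs]) (simp add: abs_mult)
    also have "\<dots> \<le> L2_set (\<lambda>\<beta>. c \<beta> - c' \<beta>) T * L2_set (\<lambda>\<beta>. c \<beta> + c' \<beta>) T"
      by (rule L2_set_mult_ineq)
    also have "\<dots> \<le> eps * (F + F)"
    proof (rule mult_mono)
      have "(\<Sum>\<beta>\<in>T. (c \<beta> - c' \<beta>)^2) \<le> eps^2"
        unfolding c_def c'_def emp_cov_diff[symmetric]
        by (intro emp_dep_le n T(1) eps d b T)
      then show "L2_set (\<lambda>\<beta>. c \<beta> - c' \<beta>) T \<le> eps" unfolding L2_set_def using eps by (intro real_le_lsqrt) auto
      have "L2_set c T \<le> F" "L2_set c' T \<le> F"
        unfolding L2_set_def c_def c'_def using F
        by (auto intro!: real_le_lsqrt emp_dep_le n T(1) f f' b T)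
      then show "L2_set (\<lambda>\<beta>. c \<beta> + c' \<beta>) T \<le> F + F"
        using L2_set_triangle_ineq[of c c' T] by linarith
    qed (use eps in auto)
    finally show ?thesis by (simp add: algebra_simps)
  qed
  have s: "(\<lambda>\<beta>. (c \<beta>)^2) summable_on B" "(\<lambda>\<beta>. (c' \<beta>)^2) summable_on B"
    unfolding c_def c'_def
    by (rule summable_on_squares[where K = "F^2"], intro emp_dep_le n F f f' b; assumption)+
  have "(\<lambda>k. (\<Sum>\<beta>\<in>exhaustion B k. (c \<beta>)^2) - (\<Sum>\<beta>\<in>exhaustion B k. (c' \<beta>)^2))
      \<longlonglongrightarrow> (\<Sum>\<^sub>\<infinity>\<beta>\<in>B. (c \<beta>)^2) - (\<Sum>\<^sub>\<infinity>\<beta>\<in>B. (c' \<beta>)^2)"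
    by (intro tendsto_diff infsum_exhaustion B s)
  then have "\<bar>(\<Sum>\<^sub>\<infinity>\<beta>\<in>B. (c \<beta>)^2) - (\<Sum>\<^sub>\<infinity>\<beta>\<in>B. (c' \<beta>)^2)\<bar> \<le> 2 * F * eps"
  proof (rule frequently_abs_le_limit)
    have "eventually (\<lambda>k. \<bar>(\<Sum>\<beta>\<in>exhaustion B k. (c \<beta>)^2) - (\<Sum>\<beta>\<in>exhaustion B k. (c' \<beta>)^2)\<bar> \<le> 2 * F * eps) sequentially"
      by (intro always_eventually allI le exhaustion(1,2)[OF B])
    then show "frequently (\<lambda>k. \<bar>(\<Sum>\<beta>\<in>exhaustion B k. (c \<beta>)^2) - (\<Sum>\<beta>\<in>exhaustion B k. (c' \<beta>)^2)\<bar> \<le> 2 * F * eps) sequentially"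
      by (rule eventually_frequently[rotated]) simp
  qed
  then show ?thesis unfolding c_def c'_def .
qed

lemma infsum_squares_le:
  fixes c :: "'b \<Rightarrow> real"
  assumes "\<And>T. finite T \<Longrightarrow> T \<subseteq> B \<Longrightarrow> (\<Sum>\<beta>\<in>T. (c \<beta>)^2) \<le> K"
  shows "\<bar>\<Sum>\<^sub>\<infinity>\<beta>\<in>B. (c \<beta>)^2\<bar> \<le> K"
proof -
  have "0 \<le> (\<Sum>\<^sub>\<infinity>\<beta>\<in>B. (c \<beta>)^2)" by (intro infsum_nonneg) simp
  moreover have "(\<Sum>\<^sub>\<infinity>\<beta>\<in>B. (c \<beta>)^2) \<le> K"
    by (rule infsum_le_finite_sums[OF summable_on_squares[OF assms] assms])
  ultimately show ?thesis by simp
qed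

text \<open>\<open>A1\<close> is a maximising sequence. The conclusion covers every intermediate set
  so that \<open>A1\<close> can be merged with a second countable family that serves another
  purpose.\<close>

lemma countable_subset_same_SUP:
  fixes g :: "'b \<Rightarrow> real"
  assumes A: "A \<noteq> {}" and bdd: "bdd_above (g ` A)"
  obtains A1 where "countable A1" "A1 \<subseteq> A"
    "\<And>A'. A1 \<subseteq> A' \<Longrightarrow> A' \<subseteq> A \<Longrightarrow> (SUP f\<in>A'. g f) = (SUP f\<in>A. g f)"
proof -
  have "\<exists>f\<in>A. (SUP f\<in>A. g f) - 1 / real (Suc q) < g f" for q
    using less_cSUP_iff[OF A bdd, of "(SUP f\<in>A. g f) - 1 / real (Suc q)"] by simp
  then obtain F where F: "\<And>q. F q \<in> A" "\<And>q. (SUP f\<in>A. g f) - 1 / real (Suc q) < g (F q)" by metis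
  show ?thesis
  proof (rule that[of "range F"])
    show "range F \<subseteq> A" using F by auto
    fix A' assume A': "range F \<subseteq> A'" "A' \<subseteq> A"
    have bdd': "bdd_above (g ` A')" by (rule bdd_above_mono[OF bdd]) (use A' in auto)
    have "(SUP f\<in>A. g f) \<le> (SUP f\<in>A'. g f)"
    proof (rule field_le_epsilon)
      fix e :: real assume "e > 0"
      then obtain q where q: "1 / real (Suc q) < e" using nat_approx_posE by metis
      have "g (F q) \<le> (SUP f\<in>A'. g f)" using A' by (intro cSUP_upper bdd') auto
      then show "(SUP f\<in>A. g f) \<le> (SUP f\<in>A'. g f) + e" using F(2)[of q] q by linarith
    qed
    moreover have "(SUP f\<in>A'. g f) \<le> (SUP f\<in>A. g f)"
      using A' by (intro cSUP_subset_mono bdd) auto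
    ultimately show "(SUP f\<in>A'. g f) = (SUP f\<in>A. g f)" by simp
  qed auto
qed

lemma abs_SUP_le:
  fixes g :: "'b \<Rightarrow> real"
  assumes "A \<noteq> {}" and h: "\<And>f. f \<in> A \<Longrightarrow> \<bar>g f\<bar> \<le> K"
  shows "\<bar>SUP f\<in>A. g f\<bar> \<le> K"
proof -
  obtain f where f: "f \<in> A" using assms(1) by blast
  have "bdd_above (g ` A)" using h by (intro bdd_aboveI2[where M = K]) (auto simp: abs_le_iff)
  then have "g f \<le> (SUP f\<in>A. g f)" by (intro cSUP_upper f)
  moreover have "(SUP f\<in>A. g f) \<le> K" using assms by (intro cSUP_least) (auto simp: abs_le_iff)
  moreover have "- K \<le> g f" using h[OF f] by linarith
  ultimately show ?thesis by linarith
qed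

lemma abs_SUP_diff_le:
  fixes g h :: "'b \<Rightarrow> real"
  assumes A: "A \<noteq> {}" and bdd: "bdd_above (g ` A)" "bdd_above (h ` A)"
    and d: "\<And>f. f \<in> A \<Longrightarrow> \<bar>g f - h f\<bar> \<le> c"
  shows "\<bar>(SUP f\<in>A. g f) - (SUP f\<in>A. h f)\<bar> \<le> c"
proof -
  have "(SUP f\<in>A. g f) \<le> (SUP f\<in>A. h f) + c"
  proof (rule cSUP_least[OF A])
    fix f assume f: "f \<in> A"
    show "g f \<le> (SUP f\<in>A. h f) + c" using d[OF f] cSUP_upper[OF f bdd(2)] by linarith
  qed
  moreover have "(SUP f\<in>A. h f) \<le> (SUP f\<in>A. g f) + c"
  proof (rule cSUP_least[OF A])
    fix f assume f: "f \<in> A"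
    show "h f \<le> (SUP f\<in>A. g f) + c" using d[OF f] cSUP_upper[OF f bdd(1)] by linarith
  qed
  ultimately show ?thesis by linarith
qed

text \<open>Of the output kernels nothing is kept but the pointwise normalisation of finite parts of
  their bases, so Y and S are treated alike over arbitrary measurable spaces. The input kernel
  contributes the bound \<open>b\<close> on its diagonal.\<close>

locale representation_setting = prob_space P
  for P :: "'w measure" +
  fixes X :: "'w \<Rightarrow> 'x::euclidean_space" and Y :: "'w \<Rightarrow> 'y" and S :: "'w \<Rightarrow> 's"
    and NY :: "'y measure" and NS :: "'s measure"
    and HX :: "('x \<Rightarrow> real) set" and ipX :: "('x \<Rightarrow> real) \<Rightarrow> ('x \<Rightarrow> real) \<Rightarrow> real"
    and kX :: "'x \<Rightarrow> 'x \<Rightarrow> real" and BY :: "('y \<Rightarrow> real) set" and BS :: "('s \<Rightarrow> real) set"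
    and r :: nat and \<gamma> lam b :: real
  assumes X[measurable]: "X \<in> P \<rightarrow>\<^sub>M borel" and Y[measurable]: "Y \<in> P \<rightarrow>\<^sub>M NY" and S[measurable]: "S \<in> P \<rightarrow>\<^sub>M NS"
    and rkhsX: "rkhs UNIV HX ipX kX" and universal: "universal_rkhs HX"
    and kX_le: "\<And>u. kX u u \<le> b" and b_pos: "b > 0"
    and BY: "countable BY" "\<And>T. finite T \<Longrightarrow> T \<subseteq> BY \<Longrightarrow> unit_features NY T (\<lambda>\<beta>. \<beta>)"
    and BS: "countable BS" "\<And>T. finite T \<Longrightarrow> T \<subseteq> BS \<Longrightarrow> unit_features NS T (\<lambda>\<beta>. \<beta>)"
    and \<gamma>: "\<gamma> > 0" and r: "r \<ge> 1" and lam: "0 \<le> lam" "lam \<le> 1"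
begin

sublocale RX: rkhs UNIV HX ipX kX by (rule rkhsX)
sublocale IX: ip_space HX ipX by (rule rkhs_ip_space[OF rkhsX])

lemma HX_continuous: "f \<in> HX \<Longrightarrow> continuous_on UNIV f"
  using universal by (auto simp: universal_rkhs_def)

lemma HX_borel: "f \<in> HX \<Longrightarrow> f \<in> borel_measurable borel"
  by (rule borel_measurable_continuous_onI[OF HX_continuous])

lemma HX_measurable: "f \<in> HX \<Longrightarrow> (\<lambda>\<omega>. f (X \<omega>)) \<in> borel_measurable P"
  by (rule measurable_compose[OF X HX_borel])

lemma HX_bounded:
  assumes f: "f \<in> HX"
  shows "(f x)^2 \<le> b * ipX f f"
proof -
  have k: "kX x \<in> HX" by (rule RX.kernel_mem) simp
  have "(f x)^2 = (ipX f (kX x))^2" using RX.reproducing[OF f, of x] by simp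
  also have "\<dots> \<le> ipX f f * ipX (kX x) (kX x)" by (rule IX.cauchy_schwarz[OF f k])
  also have "ipX (kX x) (kX x) = kX x x" using RX.reproducing[OF k, of x] by simp
  also have "ipX f f * kX x x \<le> ipX f f * b" using kX_le IX.ip_nonneg[OF f] by (intro mult_left_mono)
  finally show ?thesis by (simp add: mult.commute)
qed

lemma HX_abs_le:
  assumes f: "f \<in> HX"
  shows "\<bar>f x\<bar> \<le> sqrt (b * ipX f f)"
  using real_sqrt_le_mono[OF HX_bounded[OF f, of x]] by simp

lemma HX_integrable: "f \<in> HX \<Longrightarrow> integrable P (\<lambda>\<omega>. f (X \<omega>))"
  by (rule integrable_bounded[OF HX_measurable HX_abs_le])

lemma HX_integrable_mult:
  assumes "f \<in> HX" "g \<in> HX"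
  shows "integrable P (\<lambda>\<omega>. f (X \<omega>) * g (X \<omega>))"
proof (rule integrable_bounded[where K = "sqrt (b * ipX f f) * sqrt (b * ipX g g)"])
  show "(\<lambda>\<omega>. f (X \<omega>) * g (X \<omega>)) \<in> borel_measurable P"
    using assms by (intro borel_measurable_times HX_measurable)
  show "\<bar>f (X \<omega>) * g (X \<omega>)\<bar> \<le> sqrt (b * ipX f f) * sqrt (b * ipX g g)" for \<omega>
    unfolding abs_mult using HX_abs_le[OF assms(1)] HX_abs_le[OF assms(2)]
    by (rule mult_mono) (use order_trans[OF abs_ge_zero HX_abs_le[OF assms(1)]] in auto)
qed

text \<open>The form in the constraint on admissible tuples. It is an inner product because
  \<open>\<gamma>\<close> is positive, and the admissible tuples are exactly its orthonormal systems
  of length r.\<close>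

definition ipB :: "('x \<Rightarrow> real) \<Rightarrow> ('x \<Rightarrow> real) \<Rightarrow> real" where
  "ipB f g = cov P (\<lambda>\<omega>. f (X \<omega>)) (\<lambda>\<omega>. g (X \<omega>)) + \<gamma> * ipX f g"

lemma cov_HX:
  assumes "f \<in> HX" "g \<in> HX"
  shows "cov P (\<lambda>\<omega>. f (X \<omega>)) (\<lambda>\<omega>. g (X \<omega>))
    = (\<integral>\<omega>. f (X \<omega>) * g (X \<omega>) \<partial>P) - (\<integral>\<omega>. f (X \<omega>) \<partial>P) * (\<integral>\<omega>. g (X \<omega>) \<partial>P)"
  using assms by (intro cov_eq HX_integrable HX_integrable_mult)

lemma cov_self_nonneg: "0 \<le> cov P f f"
  unfolding cov_def by (intro integral_nonneg_AE) simp

sublocale IB: ip_space HX ipB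
proof
  show "(\<lambda>x. 0) \<in> HX" by (rule IX.zero_mem)
  show "(\<lambda>x. f x + g x) \<in> HX" if "f \<in> HX" "g \<in> HX" for f g using that by (rule IX.add_mem)
  show "(\<lambda>x. c * f x) \<in> HX" if "f \<in> HX" for c f using that by (rule IX.scale_mem)
  show "ipB f g = ipB g f" if "f \<in> HX" "g \<in> HX" for f g
    unfolding ipB_def cov_commute[of P "\<lambda>\<omega>. f (X \<omega>)"] IX.ip_commute[OF that] ..
  show "ipB (\<lambda>x. f x + g x) h = ipB f h + ipB g h" if fgh: "f \<in> HX" "g \<in> HX" "h \<in> HX" for f g h
  proof -
    have "cov P (\<lambda>\<omega>. f (X \<omega>) + g (X \<omega>)) (\<lambda>\<omega>. h (X \<omega>))
        = cov P (\<lambda>\<omega>. f (X \<omega>)) (\<lambda>\<omega>. h (X \<omega>)) + cov P (\<lambda>\<omega>. g (X \<omega>)) (\<lambda>\<omega>. h (X \<omega>))"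
      using cov_HX[OF IX.add_mem[OF fgh(1,2)] fgh(3)] cov_HX[OF fgh(1,3)] cov_HX[OF fgh(2,3)]
        HX_integrable[OF fgh(1)] HX_integrable[OF fgh(2)]
        HX_integrable_mult[OF fgh(1,3)] HX_integrable_mult[OF fgh(2,3)]
      by (simp add: distrib_right)
    then show ?thesis unfolding ipB_def IX.ip_add[OF fgh] by (simp add: distrib_left)
  qed
  show "ipB (\<lambda>x. c * f x) g = c * ipB f g" if "f \<in> HX" "g \<in> HX" for c f g
    unfolding ipB_def IX.ip_scale[OF that] cov_scale by (simp add: algebra_simps)
  show "0 \<le> ipB f f" if "f \<in> HX" for f
    unfolding ipB_def using cov_self_nonneg IX.ip_nonneg[OF that] \<gamma> by simp
  show "f = (\<lambda>x. 0)" if "f \<in> HX" "ipB f f = 0" for f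
  proof (rule IX.ip_definite[OF that(1)])
    have "0 \<le> \<gamma> * ipX f f" using IX.ip_nonneg[OF that(1)] \<gamma> by simp
    then have "\<gamma> * ipX f f = 0" using that(2) cov_self_nonneg[of "\<lambda>\<omega>. f (X \<omega>)"] unfolding ipB_def by linarith
    then show "ipX f f = 0" using \<gamma> by simp
  qed
qed

definition A where "A = admissible P X HX ipX \<gamma> r"

lemma A_iff: "f \<in> A \<longleftrightarrow> f \<in> {..<r} \<rightarrow>\<^sub>E HX \<and> IB.orthonormal {..<r} f"
  unfolding A_def admissible_def IB.orthonormal_def ipB_def by (auto simp: PiE_def Pi_def)

lemma A_mem: "f \<in> A \<Longrightarrow> j < r \<Longrightarrow> f j \<in> HX"
  by (auto simp: A_iff)

text \<open>A bound on admissible functions at every point: \<open>\<gamma>\<close> times the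
  squared norm is at most 1, and the kernel bound turns norms into values. M, in contrast, speaks
  only of sample points and only almost surely. \<open>F\<close> keeps all suprema finite and
  supplies the trivial bound for small n.\<close>

definition F where "F = sqrt (b / \<gamma>)"

lemma F_pos: "F > 0"
  using b_pos \<gamma> by (simp add: F_def)

lemma A_bounded:
  assumes f: "f \<in> A" and j: "j < r"
  shows "\<bar>f j x\<bar> \<le> F"
proof -
  have fj: "f j \<in> HX" by (rule A_mem[OF f j])
  have "ipB (f j) (f j) = 1" using f j by (auto simp: A_iff IB.orthonormal_def)
  then have "\<gamma> * ipX (f j) (f j) \<le> 1"
    using cov_self_nonneg[of "\<lambda>\<omega>. f j (X \<omega>)"] unfolding ipB_def by linarith
  then have "ipX (f j) (f j) \<le> 1 / \<gamma>" using \<gamma> by (simp add: field_simps)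
  then have "b * ipX (f j) (f j) \<le> b / \<gamma>" using mult_left_mono[of _ "1 / \<gamma>" b] b_pos by simp
  then have "sqrt (b * ipX (f j) (f j)) \<le> F" unfolding F_def by (rule real_sqrt_le_mono)
  then show ?thesis using HX_abs_le[OF fj, of x] by linarith
qed

text \<open>Universality makes the space infinite-dimensional, so every unit vector is the first
  component of an admissible tuple.\<close>

lemma unit_vector_in_A:
  assumes v: "v \<in> HX" "ipB v v = 1"
  shows "\<exists>f\<in>A. f 0 = v"
proof -
  have "IB.orthonormal {..<(1::nat)} (\<lambda>_. v)" using v by (auto simp: IB.orthonormal_def)
  from IB.orthonormal_extension[OF universal_not_finitely_spanned[OF universal] this, of "r - 1"]
  obtain e where e: "IB.orthonormal {..<r} e" "e 0 = v" using r by auto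
  have "restrict e {..<r} \<in> A"
    using e(1) unfolding A_iff by (auto simp: IB.orthonormal_def)
  moreover have "restrict e {..<r} 0 = v" using e(2) r by auto
  ultimately show ?thesis by blast
qed

lemma A_nonempty: "A \<noteq> {}"
proof -
  have "IB.orthonormal {..<0::nat} (\<lambda>_ _. 0)" by (auto simp: IB.orthonormal_def)
  from IB.orthonormal_extension[OF universal_not_finitely_spanned[OF universal] this, of 1]
  obtain e :: "nat \<Rightarrow> 'x \<Rightarrow> real" where "IB.orthonormal {..<1} e" by auto
  then have "e 0 \<in> HX" "ipB (e 0) (e 0) = 1" by (auto simp: IB.orthonormal_def)
  then show ?thesis using unit_vector_in_A by blast
qed

lemma unit_features_BY: "finite T \<Longrightarrow> T \<subseteq> BY \<Longrightarrow> u \<in> space NY \<Longrightarrow> (\<Sum>\<beta>\<in>T. (\<beta> u)^2) \<le> 1"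
  using unit_featuresD(3)[OF BY(2)] by blast

lemma unit_features_BS: "finite T \<Longrightarrow> T \<subseteq> BS \<Longrightarrow> u \<in> space NS \<Longrightarrow> (\<Sum>\<beta>\<in>T. (\<beta> u)^2) \<le> 1"
  using unit_featuresD(3)[OF BS(2)] by blast

lemma abs_sum_components_le:
  fixes c :: "nat \<Rightarrow> real"
  assumes "\<And>j. j < r \<Longrightarrow> \<bar>c j\<bar> \<le> K"
  shows "\<bar>\<Sum>j<r. c j\<bar> \<le> real r * K"
proof -
  have "\<bar>\<Sum>j<r. c j\<bar> \<le> (\<Sum>j<r. K)" using assms by (intro order_trans[OF sum_abs] sum_mono) auto
  then show ?thesis by simp
qed

lemma convex_same: "(1 - lam) * c + lam * c = (c :: real)"
  by (simp add: algebra_simps)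

abbreviation "Jt f \<equiv> J P X Y S BY BS r f lam"

abbreviation "Jt_emp n x y s f \<equiv> J_emp n x y s BY BS r f lam"

section \<open>Bounds on the objectives and a countable skeleton of the admissible set\<close>

lemma J_bounded:
  assumes f: "f \<in> A"
  shows "\<bar>Jt f\<bar> \<le> real r * F^2"
proof -
  have D: "\<bar>Dep P r f X B U\<bar> \<le> real r * F^2"
    if U: "U \<in> P \<rightarrow>\<^sub>M N" and B: "\<And>T. finite T \<Longrightarrow> T \<subseteq> B \<Longrightarrow> unit_features N T (\<lambda>\<beta>. \<beta>)" for U N and B :: "('u \<Rightarrow> real) set"
    unfolding Dep_def
  proof (intro abs_sum_components_le infsum_squares_le)
    fix j T assume j: "j < r" and T: "finite T" "T \<subseteq> B"
    have "unit_features P T (\<lambda>\<beta> \<omega>. \<beta> (U \<omega>))"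
      using unit_featuresD(1,3)[OF B[OF T]] measurable_compose[OF U unit_featuresD(2)[OF B[OF T]]]
        measurable_space[OF U]
      unfolding unit_features_def by blast
    then show "(\<Sum>\<beta>\<in>T. (cov P (\<lambda>\<omega>. f j (X \<omega>)) (\<lambda>\<omega>. \<beta> (U \<omega>)))^2) \<le> F^2"
      by (rule dep_le[OF _ F_pos HX_measurable[OF A_mem[OF f j]] A_bounded[OF f j]])
  qed
  show ?thesis unfolding J_def
    using abs_convex_combination_le[OF lam D[OF Y BY(2)] D[OF S BS(2)]] by (simp only: convex_same)
qed

lemma J_emp_bounded:
  assumes n: "n > 0" and f: "f \<in> A"
    and y: "\<And>i. i < n \<Longrightarrow> y i \<in> space NY" and s: "\<And>i. i < n \<Longrightarrow> s i \<in> space NS"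
  shows "\<bar>Jt_emp n x y s f\<bar> \<le> real r * F^2"
proof -
  have "\<bar>Dep_emp n r f x BY y\<bar> \<le> real r * F^2"
    unfolding Dep_emp_def
    by (intro abs_sum_components_le infsum_squares_le emp_dep_le n F_pos A_bounded[OF f] unit_features_BY y)
  moreover have "\<bar>Dep_emp n r f x BS s\<bar> \<le> real r * F^2"
    unfolding Dep_emp_def
    by (intro abs_sum_components_le infsum_squares_le emp_dep_le n F_pos A_bounded[OF f] unit_features_BS s)
  ultimately show ?thesis unfolding J_emp_def
    using abs_convex_combination_le[OF lam] by (metis convex_same)
qed

lemma J_emp_lipschitz:
  assumes n: "n > 0" and f: "f \<in> A" "f' \<in> A" and eps: "eps > 0"
    and d: "\<And>i j. i < n \<Longrightarrow> j < r \<Longrightarrow> \<bar>f j (x i) - f' j (x i)\<bar> \<le> eps"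
    and y: "\<And>i. i < n \<Longrightarrow> y i \<in> space NY" and s: "\<And>i. i < n \<Longrightarrow> s i \<in> space NS"
  shows "\<bar>Jt_emp n x y s f - Jt_emp n x y s f'\<bar> \<le> real r * (2 * F * eps)"
proof -
  have 1: "\<bar>Dep_emp n r f x BY y - Dep_emp n r f' x BY y\<bar> \<le> real r * (2 * F * eps)"
    unfolding Dep_emp_def sum_subtractf[symmetric]
    by (intro abs_sum_components_le emp_dep_lipschitz n F_pos eps A_bounded f d unit_features_BY y BY(1))
  have 2: "\<bar>Dep_emp n r f x BS s - Dep_emp n r f' x BS s\<bar> \<le> real r * (2 * F * eps)"
    unfolding Dep_emp_def sum_subtractf[symmetric]
    by (intro abs_sum_components_le emp_dep_lipschitz n F_pos eps A_bounded f d unit_features_BS s BS(1))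
  have "Jt_emp n x y s f - Jt_emp n x y s f'
      = (1 - lam) * (Dep_emp n r f x BY y - Dep_emp n r f' x BY y) - lam * (Dep_emp n r f x BS s - Dep_emp n r f' x BS s)"
    unfolding J_emp_def by (simp add: algebra_simps)
  then show ?thesis using abs_convex_combination_le[OF lam 1 2] by (simp only: convex_same)
qed

text \<open>The two suprema need different families: a maximising sequence for the population
  objective, and a family pointwise dense on finite sets for the empirical ones. The second is
  chosen before the sample, hence serves all of the uncountably many samples at once. Their union
  keeps both suprema.\<close>

lemma countable_skeleton:
  obtains A0 where "countable A0" "A0 \<subseteq> A" "A0 \<noteq> {}"
    "(SUP f\<in>A0. Jt f) = (SUP f\<in>A. Jt f)"
    "\<And>n x y s. n > 0 \<Longrightarrow> (\<And>i. i < n \<Longrightarrow> y i \<in> space NY) \<Longrightarrow> (\<And>i. i < n \<Longrightarrow> s i \<in> space NS) \<Longrightarrow>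
      (SUP f\<in>A0. Jt_emp n x y s f) = (SUP f\<in>A. Jt_emp n x y s f)"
proof -
  have "bdd_above ((\<lambda>f. Jt f) ` A)"
    using J_bounded by (intro bdd_aboveI2[where M = "real r * F^2"]) (auto simp: abs_le_iff)
  then obtain A1 where A1: "countable A1" "A1 \<subseteq> A"
    "\<And>A'. A1 \<subseteq> A' \<Longrightarrow> A' \<subseteq> A \<Longrightarrow>
      (SUP f\<in>A'. Jt f) = (SUP f\<in>A. Jt f)"
    using countable_subset_same_SUP[OF A_nonempty] by blast
  have "continuous_on UNIV (f j)" if "f \<in> A" "j \<in> {..<r}" for f j
    using that by (intro HX_continuous A_mem) auto
  then obtain A2 where A2: "countable A2" "A2 \<subseteq> A"
    "\<And>f V eps. f \<in> A \<Longrightarrow> finite V \<Longrightarrow> finite {..<r} \<Longrightarrow> eps > 0 \<Longrightarrow> \<exists>f'\<in>A2. \<forall>j\<in>{..<r}. \<forall>x\<in>V. \<bar>f j x - f' j x\<bar> < eps"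
    using countable_pointwise_dense[of A "{..<r}"] by blast
  let ?A0 = "A1 \<union> A2"
  have sub: "?A0 \<subseteq> A" using A1 A2 by blast
  obtain f0 where "f0 \<in> A" using A_nonempty by blast
  then have ne: "?A0 \<noteq> {}" using A2(3)[of f0 "{}" 1] by auto
  show ?thesis
  proof (rule that[of ?A0])
    show "countable ?A0" using A1 A2 by simp
    show "(SUP f\<in>?A0. Jt f) = (SUP f\<in>A. Jt f)"
      using sub by (intro A1(3)) auto
    fix n :: nat and x :: "nat \<Rightarrow> 'x" and y s
    assume n: "n > 0" and y: "\<And>i. i < n \<Longrightarrow> y i \<in> space NY" and s: "\<And>i. i < n \<Longrightarrow> s i \<in> space NS"
    let ?J = "\<lambda>f. Jt_emp n x y s f"
    have bdd: "bdd_above (?J ` A)"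
      using J_emp_bounded[OF n _ y s] by (intro bdd_aboveI2[where M = "real r * F^2"]) (auto simp: abs_le_iff)
    have bdd0: "bdd_above (?J ` ?A0)" by (rule bdd_above_mono[OF bdd]) (use sub in auto)
    have "(SUP f\<in>A. ?J f) \<le> (SUP f\<in>?A0. ?J f)"
    proof (rule cSUP_least[OF A_nonempty], rule field_le_epsilon)
      fix f and e :: real assume f: "f \<in> A" and e: "e > 0"
      \<comment> \<open>The reciprocal of the Lipschitz constant r (2 F) of the empirical objective,
        times the allowed error.\<close>
      define eps where "eps = e / (real r * (2 * F))"
      have eps: "eps > 0" "real r * (2 * F * eps) = e" using e r F_pos by (auto simp: eps_def)
      obtain f' where f': "f' \<in> A2" "\<And>j v. j < r \<Longrightarrow> v \<in> x ` {..<n} \<Longrightarrow> \<bar>f j v - f' j v\<bar> < eps"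
        using A2(3)[OF f, of "x ` {..<n}" eps] eps by auto
      have "f' \<in> A" using f' A2 by blast
      then have "\<bar>?J f - ?J f'\<bar> \<le> e"
        unfolding eps(2)[symmetric] by (intro J_emp_lipschitz n f eps(1) y s less_imp_le[OF f'(2)]) auto
      moreover have "?J f' \<le> (SUP f\<in>?A0. ?J f)" using f' by (intro cSUP_upper bdd0) auto
      ultimately show "?J f \<le> (SUP f\<in>?A0. ?J f) + e" by linarith
    qed
    moreover have "(SUP f\<in>?A0. ?J f) \<le> (SUP f\<in>A. ?J f)"
      by (rule cSUP_subset_mono[OF ne bdd sub]) simp
    ultimately show "(SUP f\<in>?A0. ?J f) = (SUP f\<in>A. ?J f)" by simp
  qed (use sub ne in auto)
qed

end

section \<open>Sampling\<close>

context representation_setting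
begin

abbreviation "N \<equiv> borel \<Otimes>\<^sub>M NY \<Otimes>\<^sub>M NS"

abbreviation "JA \<equiv> (SUP f\<in>A. Jt f)"

abbreviation "JA_emp n x y s \<equiv> (SUP f\<in>A. Jt_emp n x y s f)"

abbreviation "Jt_sample n x y s \<omega> \<equiv> Jt_emp n (\<lambda>i. x i \<omega>) (\<lambda>i. y i \<omega>) (\<lambda>i. s i \<omega>)"

abbreviation "JA_sample n x y s \<omega> \<equiv> JA_emp n (\<lambda>i. x i \<omega>) (\<lambda>i. y i \<omega>) (\<lambda>i. s i \<omega>)"

text \<open>\<open>measure\<close> is 0 on nonmeasurable sets, so a lower bound on a probability
  includes the measurability of its event. Over the uncountable admissible set it comes from the
  countable skeleton, which has the same supremum for every sample.\<close>

lemma JA_emp_measurable: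
  fixes x :: "nat \<Rightarrow> 'w \<Rightarrow> 'x"
  assumes n: "n > 0" and x: "\<And>i. i < n \<Longrightarrow> x i \<in> P \<rightarrow>\<^sub>M borel"
    and y: "\<And>i. i < n \<Longrightarrow> y i \<in> P \<rightarrow>\<^sub>M NY" and s: "\<And>i. i < n \<Longrightarrow> s i \<in> P \<rightarrow>\<^sub>M NS"
  shows "(\<lambda>\<omega>. JA_sample n x y s \<omega>) \<in> borel_measurable P"
proof -
  obtain A0 where A0: "countable A0" "A0 \<subseteq> A" "A0 \<noteq> {}"
    "\<And>n x y s. n > 0 \<Longrightarrow> (\<And>i. i < n \<Longrightarrow> y i \<in> space NY) \<Longrightarrow> (\<And>i. i < n \<Longrightarrow> s i \<in> space NS) \<Longrightarrow>
      (SUP f\<in>A0. Jt_emp n x y s f) = JA_emp n x y s"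
    by (rule countable_skeleton) blast
  have ys: "y i \<omega> \<in> space NY" "s i \<omega> \<in> space NS" if "\<omega> \<in> space P" "i < n" for i \<omega>
    using measurable_space[OF y] measurable_space[OF s] that by auto
  have fx: "(\<lambda>\<omega>. f j (x i \<omega>)) \<in> borel_measurable P" if "f \<in> A" "j < r" "i < n" for f j i
    by (rule measurable_compose[OF x[OF that(3)] HX_borel[OF A_mem[OF that(1,2)]]])
  have emp: "(\<lambda>\<omega>. emp_cov n (\<lambda>i. x i \<omega>) (\<lambda>i. u i \<omega>) (f j) \<beta>) \<in> borel_measurable P"
    if "f \<in> A" "j < r" and u: "\<And>i. i < n \<Longrightarrow> u i \<in> P \<rightarrow>\<^sub>M NU" and "\<beta> \<in> borel_measurable NU"
    for f j \<beta> NU and u :: "nat \<Rightarrow> 'w \<Rightarrow> 'u"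
    unfolding emp_cov_def
    using fx[OF that(1,2)] measurable_compose[OF u that(4)]
    by (intro borel_measurable_diff borel_measurable_times borel_measurable_sum borel_measurable_const) auto
  have dep: "(\<lambda>\<omega>. Dep_emp n r f (\<lambda>i. x i \<omega>) B (\<lambda>i. u i \<omega>)) \<in> borel_measurable P"
    if f: "f \<in> A" and u: "\<And>i. i < n \<Longrightarrow> u i \<in> P \<rightarrow>\<^sub>M NU" and B: "countable B"
      "\<And>T. finite T \<Longrightarrow> T \<subseteq> B \<Longrightarrow> unit_features NU T (\<lambda>\<beta>. \<beta>)"
    for f NU B and u :: "nat \<Rightarrow> 'w \<Rightarrow> 'u"
    unfolding Dep_emp_def
  proof (intro borel_measurable_sum borel_measurable_infsum B(1) borel_measurable_power summable_on_squares)
    fix j assume j: "j \<in> {..<r}"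
    show "(\<lambda>\<omega>. emp_cov n (\<lambda>i. x i \<omega>) (\<lambda>i. u i \<omega>) (f j) \<beta>) \<in> borel_measurable P" if "\<beta> \<in> B" for \<beta>
      using unit_featuresD(2)[OF B(2)[of "{\<beta>}"]] that j by (intro emp[OF f _ u]) auto
    fix \<omega> T assume \<omega>: "\<omega> \<in> space P" and T: "finite T" "T \<subseteq> B"
    show "(\<Sum>\<beta>\<in>T. (emp_cov n (\<lambda>i. x i \<omega>) (\<lambda>i. u i \<omega>) (f j) \<beta>)^2) \<le> F^2"
      using j measurable_space[OF u \<omega>] unit_featuresD(3)[OF B(2)[OF T]]
      by (intro emp_dep_le n T(1) F_pos A_bounded[OF f]) auto
  qed
  have "(\<lambda>\<omega>. SUP f\<in>A0. Jt_sample n x y s \<omega> f) \<in> borel_measurable P"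
  proof (rule borel_measurable_cSUP[OF A0(1)])
    show "(\<lambda>\<omega>. Jt_sample n x y s \<omega> f) \<in> borel_measurable P"
      if "f \<in> A0" for f
      unfolding J_emp_def using that A0(2)
      by (intro borel_measurable_diff borel_measurable_times borel_measurable_const
          dep[OF _ y BY] dep[OF _ s BS]) auto
    show "bdd_above ((\<lambda>f. Jt_sample n x y s \<omega> f) ` A0)"
      if "\<omega> \<in> space P" for \<omega>
    proof (rule bdd_aboveI2[where M = "real r * F^2"])
      fix f assume "f \<in> A0"
      then have "f \<in> A" using A0(2) by blast
      then show "Jt_sample n x y s \<omega> f \<le> real r * F^2"
        using J_emp_bounded[OF n _ ys(1)[OF that] ys(2)[OF that]] by (simp add: abs_le_iff)
    qed
  qed
  then show ?thesis
    by (subst measurable_cong[where g = "\<lambda>\<omega>. SUP f\<in>A0. Jt_sample n x y s \<omega> f"])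
       (auto simp: A0(4)[OF n ys])
qed

lemma JA_minus_JA_emp_le:
  assumes n: "n > 0" and ys: "\<And>i. i < n \<Longrightarrow> y i \<in> space NY" "\<And>i. i < n \<Longrightarrow> s i \<in> space NS"
  shows "\<bar>JA - JA_emp n x y s\<bar> \<le> 2 * (real r * F^2)"
  using abs_SUP_le[OF A_nonempty, of "\<lambda>f. Jt f" "real r * F^2"]
    abs_SUP_le[OF A_nonempty, of "\<lambda>f. Jt_emp n x y s f" "real r * F^2"]
    J_bounded J_emp_bounded[OF n _ ys] by fastforce

text \<open>The input points at which the bound M holds for all admissible tuples. As an
  intersection of closed sets it is Borel although the admissible set is uncountable, so an almost
  sure statement about the sample can be transported to X through the common law.\<close>

definition G :: "real \<Rightarrow> 'x set" where
  "G M = {v. \<forall>f\<in>A. \<forall>j<r. (f j v)^2 \<le> M}"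

lemma G_closed: "closed (G M)"
proof -
  have "G M = (\<Inter>f\<in>A. \<Inter>j\<in>{..<r}. {v. (f j v)^2 \<le> M})" by (auto simp: G_def)
  moreover have "closed {v. (f j v)^2 \<le> M}" if "f \<in> A" "j < r" for f j
    using HX_continuous[OF A_mem[OF that]]
    by (intro closed_Collect_le continuous_on_power continuous_on_const) auto
  ultimately show ?thesis by (auto intro!: closed_INT)
qed

lemma G_borel[measurable]: "G M \<in> sets borel"
  by (rule borel_closed[OF G_closed])

text \<open>The cut-off outside \<open>G M\<close> turns almost sure bounds into bounds at every
  point, as feature maps and bounded differences require. It is linear in \<open>g\<close>, so
  expansions in a basis keep their coefficients.\<close>

definition normalized :: "real \<Rightarrow> ('x \<Rightarrow> real) \<Rightarrow> 'x \<times> 'y \<times> 's \<Rightarrow> real" where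
  "normalized M g z = (if fst z \<in> G M then g (fst z) / sqrt M else 0)"

lemma normalized_measurable:
  assumes "g \<in> HX"
  shows "normalized M g \<in> borel_measurable N"
proof -
  have [measurable]: "g \<in> borel_measurable borel" by (rule HX_borel[OF assms])
  show ?thesis unfolding normalized_def by measurable
qed

lemma normalized_abs_le_1:
  assumes M: "M \<ge> 0" and f: "f \<in> A" "j < r"
  shows "\<bar>normalized M (f j) z\<bar> \<le> 1"
proof (cases "fst z \<in> G M \<and> M > 0")
  case True
  then have "(f j (fst z))^2 \<le> M" using f by (auto simp: G_def)
  then have "\<bar>f j (fst z)\<bar> \<le> sqrt M" using real_sqrt_le_mono by fastforce
  then show ?thesis using True by (simp add: normalized_def)
qed (use M in \<open>auto simp: normalized_def\<close>)

text \<open>For \<open>M = 0\<close> the division by \<open>sqrt M\<close> is junk, but then the functions vanish on \<open>G M\<close>.\<close>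

lemma normalized_scale:
  assumes M: "M \<ge> 0" and f: "f \<in> A" "j < r" and z: "fst z \<in> G M"
  shows "f j (fst z) = sqrt M * normalized M (f j) z"
proof (cases "M = 0")
  case True
  then have "(f j (fst z))^2 \<le> 0" using z f by (auto simp: G_def)
  then show ?thesis using True by simp
qed (use z in \<open>simp add: normalized_def\<close>)

text \<open>At a fixed point the sum of squares of the basis functions is the squared value of one
  unit combination of them. That combination is a unit vector for \<open>ipB\<close>, hence a
  component of an admissible tuple, and on \<open>G M\<close> its square is at most M.\<close>

lemma orthonormal_unit_features:
  assumes M: "M \<ge> 0" and e: "IB.orthonormal I e" and sN: "sets \<mu> = sets N"
  shows "unit_features \<mu> I (\<lambda>m. normalized M (e m))"
  unfolding unit_features_def
proof (intro conjI ballI)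
  show fin: "finite I" using e by (simp add: IB.orthonormal_def)
  show "normalized M (e m) \<in> borel_measurable \<mu>" if "m \<in> I" for m
    using e that normalized_measurable[of "e m" M] measurable_cong_sets[OF sN refl]
    by (auto simp: IB.orthonormal_def)
  fix z :: "'x \<times> 'y \<times> 's"
  show "(\<Sum>m\<in>I. (normalized M (e m) z)^2) \<le> 1"
  proof (cases "fst z \<in> G M \<and> M > 0")
    case True
    define t where "t = (\<Sum>m\<in>I. (e m (fst z))^2)"
    have "t \<le> M"
    proof (cases "t = 0")
      case False
      obtain d where d: "(\<Sum>m\<in>I. (d m)^2) = 1" "(\<Sum>m\<in>I. d m * e m (fst z)) = sqrt t"
        using unit_direction[OF fin, of "\<lambda>m. e m (fst z)"] False unfolding t_def by blast
      define v where "v = (\<lambda>x. \<Sum>m\<in>I. d m * e m x)"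
      have "v \<in> HX" unfolding v_def using e by (intro IX.sum_mem) (auto simp: IB.orthonormal_def)
      moreover have "ipB v v = 1" unfolding v_def IB.ip_combination_self[OF e] by (rule d(1))
      ultimately obtain f where f: "f \<in> A" "f 0 = v" using unit_vector_in_A by blast
      have "(v (fst z))^2 \<le> M" using True f r by (auto simp: G_def)
      then show ?thesis unfolding v_def d(2) by (simp add: t_def sum_nonneg)
    qed (use True in simp)
    moreover have "(\<Sum>m\<in>I. (normalized M (e m) z)^2) = t / M"
      using True by (simp add: normalized_def power_divide t_def sum_divide_distrib)
    ultimately show ?thesis using True by simp
  next
    case False
    \<comment> \<open>Outside \<open>G M\<close> by the cut-off, and for M = 0 because division by
      zero gives 0.\<close>
    then have "normalized M g z = 0" for g using M by (cases "fst z \<in> G M") (auto simp: normalized_def)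
    then show ?thesis by simp
  qed
qed

text \<open>Gram-Schmidt for \<open>ipB\<close> on the finitely many components. These are unit
  vectors, so their coefficient vectors have length exactly 1, and the linear cut-off carries the
  expansion over to the normalised functions.\<close>

lemma normalized_tuples_features:
  assumes M: "M \<ge> 0" and sN: "sets \<mu> = sets N" and K: "finite K" "K \<subseteq> A"
  shows "\<exists>(I :: nat set) e a. unit_features \<mu> I e \<and>
     (\<forall>f\<in>K. \<forall>j<r. (\<Sum>m\<in>I. (a f j m)^2) \<le> 1 \<and> (\<forall>z\<in>space \<mu>. normalized M (f j) z = (\<Sum>m\<in>I. a f j m * e m z)))"
proof -
  define V where "V = (\<lambda>(f, j). f j) ` (K \<times> {..<r})"
  have "finite V" "V \<subseteq> HX" unfolding V_def using K A_mem by auto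
  from IB.finite_orthonormal_span[OF this] obtain p :: nat and e where e: "IB.orthonormal {..<p} e"
    and span: "\<forall>h\<in>V. \<exists>a. h = (\<lambda>x. \<Sum>m<p. a m * e m x)"
    by (elim exE conjE)
  have "\<exists>a. f j = (\<lambda>x. \<Sum>m<p. a m * e m x)" if "f \<in> K" "j < r" for f j
  proof -
    have "f j \<in> V" unfolding V_def using that by force
    then show ?thesis by (rule bspec[OF span])
  qed
  then have "\<forall>f\<in>K. \<forall>j\<in>{..<r}. \<exists>a. f j = (\<lambda>x. \<Sum>m<p. a m * e m x)" by simp
  then obtain a where "\<forall>f\<in>K. \<forall>j\<in>{..<r}. f j = (\<lambda>x. \<Sum>m<p. a f j m * e m x)"
    unfolding bchoice_iff by (elim exE)
  then have a: "f j = (\<lambda>x. \<Sum>m<p. a f j m * e m x)" if "f \<in> K" "j < r" for f j using that by simp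
  have "(\<Sum>m<p. (a f j m)^2) \<le> 1" if fj: "f \<in> K" "j < r" for f j
  proof -
    have "ipB (f j) (f j) = 1" using fj K(2) by (auto simp: A_iff IB.orthonormal_def)
    moreover have "ipB (f j) (f j) = (\<Sum>m<p. (a f j m)^2)"
      using IB.ip_combination_self[OF e(1), of "a f j"] by (simp only: a[OF fj, symmetric])
    ultimately show ?thesis by simp
  qed
  moreover have "normalized M (f j) z = (\<Sum>m<p. a f j m * normalized M (e m) z)" if fj: "f \<in> K" "j < r" for f j z
  proof -
    have "f j (fst z) = (\<Sum>m<p. a f j m * e m (fst z))" using fun_cong[OF a[OF fj], of "fst z"] .
    then show ?thesis by (simp add: normalized_def sum_divide_distrib)
  qed
  ultimately show ?thesis
    by (intro exI[of _ "{..<p}"] exI[of _ "\<lambda>m. normalized M (e m)"] exI[of _ a] conjI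
        orthonormal_unit_features[OF M e(1) sN]) auto
qed

section \<open>From the law of the sample to the sample itself\<close>

lemma sample_bound_nonneg:
  fixes x :: "nat \<Rightarrow> 'w \<Rightarrow> 'x"
  assumes n: "n > 0" and bdd: "AE \<omega> in P. \<forall>f\<in>A. \<forall>j<r. \<forall>i<n. (f j (x i \<omega>))^2 \<le> M"
  shows "M \<ge> 0"
proof -
  obtain f where f: "f \<in> A" using A_nonempty by blast
  have "AE \<omega> in P. M \<ge> 0"
    using bdd
  proof eventually_elim
    case (elim \<omega>)
    then have "(f 0 (x 0 \<omega>))^2 \<le> M" using f r n by auto
    then show ?case by (smt (verit) zero_le_power2)
  qed
  then show ?thesis by simp
qed

lemma sample_measurable:
  assumes iid: "iid_copies P N n W (\<lambda>i \<omega>. (x i \<omega>, y i \<omega>, s i \<omega>))" and i: "i < n"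
  shows "x i \<in> P \<rightarrow>\<^sub>M borel" "y i \<in> P \<rightarrow>\<^sub>M NY" "s i \<in> P \<rightarrow>\<^sub>M NS"
proof -
  have z: "(\<lambda>\<omega>. (x i \<omega>, y i \<omega>, s i \<omega>)) \<in> P \<rightarrow>\<^sub>M N"
    using iid i by (auto simp: iid_copies_def indep_vars_def)
  show "x i \<in> P \<rightarrow>\<^sub>M borel" "y i \<in> P \<rightarrow>\<^sub>M NY" "s i \<in> P \<rightarrow>\<^sub>M NS"
    using measurable_compose[OF z measurable_fst]
      measurable_compose[OF measurable_compose[OF z measurable_snd] measurable_fst]
      measurable_compose[OF measurable_compose[OF z measurable_snd] measurable_snd]
    by simp_all
qed

text \<open>Everything is moved to the common law \<open>\<mu>\<close> of the triples, where the
  normalised functions satisfy the countable result, and pulled back along the sample vector. The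
  normalisation costs a factor sqrt M in each covariance, hence M in each dependence term.
  \<open>C\<close> is an arbitrary nonnegative slack, to be filled with the remainder term.\<close>

lemma concentration:
  fixes x :: "nat \<Rightarrow> 'w \<Rightarrow> 'x"
  assumes n: "n \<ge> 100" and del: "0 < \<delta>" "\<delta> < 1"
    and iid: "iid_copies P N n (\<lambda>\<omega>. (X \<omega>, Y \<omega>, S \<omega>)) (\<lambda>i \<omega>. (x i \<omega>, y i \<omega>, s i \<omega>))"
    and bdd: "AE \<omega> in P. \<forall>f\<in>A. \<forall>j<r. \<forall>i<n. (f j (x i \<omega>))^2 \<le> M"
    and C: "C \<ge> 0"
  shows "1 - \<delta> \<le> prob {\<omega> \<in> space P. \<bar>JA - JA_sample n x y s \<omega>\<bar>
      \<le> real r * M * conf_radius n \<delta> + C}"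
proof -
  have n0: "n > 0" using n by simp
  define Z where "Z \<omega> = (X \<omega>, Y \<omega>, S \<omega>)" for \<omega>
  define z where "z i \<omega> = (x i \<omega>, y i \<omega>, s i \<omega>)" for i \<omega>
  have Zm: "Z \<in> P \<rightarrow>\<^sub>M N" unfolding Z_def by measurable
  have indep: "indep_vars (\<lambda>_. N) z {..<n}" and dist: "\<And>i. i < n \<Longrightarrow> distr P N (z i) = distr P N Z"
    using iid unfolding iid_copies_def z_def Z_def by auto
  have zm: "z i \<in> P \<rightarrow>\<^sub>M N" if "i < n" for i using indep that by (auto simp: indep_vars_def)
  note xm = sample_measurable(1)[OF iid] and ym = sample_measurable(2)[OF iid] and sm = sample_measurable(3)[OF iid]
  have xG: "AE \<omega> in P. \<forall>i<n. x i \<omega> \<in> G M" using bdd by eventually_elim (auto simp: G_def)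
  have M: "M \<ge> 0" by (rule sample_bound_nonneg[OF n0 bdd])
  define \<mu> where "\<mu> = distr P N Z"
  have sets\<mu>: "sets \<mu> = sets N" by (simp add: \<mu>_def)
  interpret \<mu>: prob_space \<mu> unfolding \<mu>_def by (rule prob_space_distr[OF Zm])
  \<comment> \<open>The hypothesis speaks of the sample only. X lies almost surely in the Borel set
    \<open>G M\<close> because the first sample point has the same law.\<close>
  have XG: "AE \<omega> in P. X \<omega> \<in> G M"
  proof -
    have Gm: "{w \<in> space N. fst w \<in> G M} \<in> sets N" by measurable
    have "AE \<omega> in P. fst (z 0 \<omega>) \<in> G M" using xG by eventually_elim (use n0 in \<open>auto simp: z_def\<close>)
    then have "AE w in distr P N (z 0). fst w \<in> G M" by (subst AE_distr_iff[OF zm[OF n0] Gm])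
    then have "AE w in distr P N Z. fst w \<in> G M" by (simp only: dist[OF n0])
    then show ?thesis unfolding AE_distr_iff[OF Zm Gm] by (simp add: Z_def)
  qed
  define bY :: "('y \<Rightarrow> real) \<Rightarrow> 'x \<times> 'y \<times> 's \<Rightarrow> real" where "bY = (\<lambda>\<beta> w. \<beta> (fst (snd w)))"
  define bS :: "('s \<Rightarrow> real) \<Rightarrow> 'x \<times> 'y \<times> 's \<Rightarrow> real" where "bS = (\<lambda>\<beta> w. \<beta> (snd (snd w)))"
  have bm: "(\<lambda>w. \<beta> (\<pi> w)) \<in> borel_measurable N"
    if "\<beta> \<in> B" "\<pi> \<in> N \<rightarrow>\<^sub>M NU" "\<And>T. finite T \<Longrightarrow> T \<subseteq> B \<Longrightarrow> unit_features NU T (\<lambda>\<beta>. \<beta>)"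
    for \<beta> \<pi> NU and B :: "('u \<Rightarrow> real) set"
    using unit_featuresD(2)[OF that(3)[of "{\<beta>}"]] that(1,2) by (auto intro: measurable_compose)
  have N\<mu>: "borel_measurable \<mu> = borel_measurable N" by (rule measurable_cong_sets[OF sets\<mu> refl])
  have u: "unit_features \<mu> T (\<lambda>\<beta> w. \<beta> (\<pi> w))"
    if \<pi>: "\<pi> \<in> N \<rightarrow>\<^sub>M NU" and B: "\<And>T. finite T \<Longrightarrow> T \<subseteq> B \<Longrightarrow> unit_features NU T (\<lambda>\<beta>. \<beta>)"
      and T: "finite T" "T \<subseteq> B"
    for \<pi> NU T and B :: "('u \<Rightarrow> real) set"
    using unit_featuresD[OF B[OF T]] bm[OF _ \<pi> B] measurable_space[OF \<pi>] T(2)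
    unfolding unit_features_def N\<mu> by (auto simp: \<mu>_def)
  have pY: "(\<lambda>w. fst (snd w)) \<in> N \<rightarrow>\<^sub>M NY" and pS: "(\<lambda>w. snd (snd w)) \<in> N \<rightarrow>\<^sub>M NS" by measurable
  have uY: "unit_features \<mu> T bY" if "finite T" "T \<subseteq> BY" for T
    unfolding bY_def by (rule u[OF pY BY(2) that])
  have uS: "unit_features \<mu> T bS" if "finite T" "T \<subseteq> BS" for T
    unfolding bS_def by (rule u[OF pS BS(2) that])
  obtain A0 where A0: "countable A0" "A0 \<subseteq> A" "A0 \<noteq> {}"
    "(SUP f\<in>A0. Jt f) = JA"
    "\<And>n x y s. n > 0 \<Longrightarrow> (\<And>i. i < n \<Longrightarrow> y i \<in> space NY) \<Longrightarrow> (\<And>i. i < n \<Longrightarrow> s i \<in> space NS) \<Longrightarrow>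
      (SUP f\<in>A0. Jt_emp n x y s f) = JA_emp n x y s"
    by (rule countable_skeleton) blast
  define R where "R = real r * conf_radius n \<delta>"
  define \<phi> where "\<phi> f j = normalized M (f j)" for f :: "nat \<Rightarrow> 'x \<Rightarrow> real" and j
  let ?Q = "samples n \<mu>"
  have \<phi>m: "\<phi> f j \<in> borel_measurable \<mu>" if "f \<in> A0" "j < r" for f j
    unfolding \<phi>_def N\<mu> using that A0(2) by (intro normalized_measurable A_mem) auto
  have \<phi>1: "\<bar>\<phi> f j w\<bar> \<le> 1" if "f \<in> A0" "j < r" for f j w
    unfolding \<phi>_def using that A0(2) by (intro normalized_abs_le_1 M) auto
  have \<phi>e: "\<exists>(I :: nat set) e a. unit_features \<mu> I e \<and>
      (\<forall>f\<in>K. \<forall>j<r. (\<Sum>m\<in>I. (a f j m)^2) \<le> 1 \<and> (\<forall>w\<in>space \<mu>. \<phi> f j w = (\<Sum>m\<in>I. a f j m * e m w)))"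
    if "finite K" "K \<subseteq> A0" for K
    unfolding \<phi>_def using that A0(2) by (intro normalized_tuples_features M sets\<mu>) auto
  obtain E where E: "E \<in> sets ?Q" "1 - \<delta> \<le> measure ?Q E"
    "\<And>w f. w \<in> E \<Longrightarrow> f \<in> A0 \<Longrightarrow>
      \<bar>(1 - lam) * (\<Sum>j<r. dep_dev_inf \<mu> BY bY n (\<phi> f j) w)
        - lam * (\<Sum>j<r. dep_dev_inf \<mu> BS bS n (\<phi> f j) w)\<bar>
      \<le> R"
    using \<mu>.countable_family_concentration[OF n r del lam A0(1) \<phi>m \<phi>1 \<phi>e BY(1) uY BS(1) uS, folded R_def]
    by blast
  \<comment> \<open>Off \<open>G M\<close> the function and its rescaled normalisation differ, so
    the population covariances agree through almost sure equality under the law of X, unlike the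
    empirical ones, where the values at the sample points agree exactly.\<close>
  have pop: "cov P (\<lambda>\<omega>. f j (X \<omega>)) (\<lambda>\<omega>. \<beta> (Z \<omega>)) = sqrt M * cov \<mu> (\<phi> f j) \<beta>"
    if f: "f \<in> A" "j < r" and \<beta>: "\<beta> \<in> borel_measurable N" for f j \<beta>
  proof -
    have fm: "(\<lambda>\<omega>. f j (X \<omega>)) \<in> borel_measurable P" by (rule HX_measurable[OF A_mem[OF f]])
    have \<phi>m: "\<phi> f j \<in> borel_measurable N" unfolding \<phi>_def by (rule normalized_measurable[OF A_mem[OF f]])
    have \<phi>Z: "(\<lambda>\<omega>. \<phi> f j (Z \<omega>)) \<in> borel_measurable P" and \<beta>Z: "(\<lambda>\<omega>. \<beta> (Z \<omega>)) \<in> borel_measurable P"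
      by (rule measurable_compose[OF Zm \<phi>m], rule measurable_compose[OF Zm \<beta>])
    have ae: "AE \<omega> in P. f j (X \<omega>) = sqrt M * \<phi> f j (Z \<omega>)"
      using XG
    proof eventually_elim
      case (elim \<omega>)
      then show ?case using normalized_scale[OF M f, of "Z \<omega>"] unfolding \<phi>_def by (simp add: Z_def)
    qed
    have int: "(\<integral>\<omega>. f j (X \<omega>) \<partial>P) = (\<integral>\<omega>. sqrt M * \<phi> f j (Z \<omega>) \<partial>P)"
      using fm \<phi>Z ae by (intro integral_cong_AE borel_measurable_times borel_measurable_const)
    have "cov P (\<lambda>\<omega>. f j (X \<omega>)) (\<lambda>\<omega>. \<beta> (Z \<omega>)) = cov P (\<lambda>\<omega>. sqrt M * \<phi> f j (Z \<omega>)) (\<lambda>\<omega>. \<beta> (Z \<omega>))"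
      unfolding cov_def int
    proof (rule integral_cong_AE)
      show "AE \<omega> in P. (f j (X \<omega>) - (\<integral>\<omega>. sqrt M * \<phi> f j (Z \<omega>) \<partial>P)) * (\<beta> (Z \<omega>) - (\<integral>\<omega>. \<beta> (Z \<omega>) \<partial>P))
          = (sqrt M * \<phi> f j (Z \<omega>) - (\<integral>\<omega>. sqrt M * \<phi> f j (Z \<omega>) \<partial>P)) * (\<beta> (Z \<omega>) - (\<integral>\<omega>. \<beta> (Z \<omega>) \<partial>P))"
        using ae by eventually_elim simp
    qed (use fm \<phi>Z \<beta>Z in measurable)
    also have "\<dots> = sqrt M * cov P (\<lambda>\<omega>. \<phi> f j (Z \<omega>)) (\<lambda>\<omega>. \<beta> (Z \<omega>))" by (rule cov_scale)
    also have "cov P (\<lambda>\<omega>. \<phi> f j (Z \<omega>)) (\<lambda>\<omega>. \<beta> (Z \<omega>)) = cov \<mu> (\<phi> f j) \<beta>"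
      unfolding cov_def \<mu>_def using Zm \<phi>m \<beta> by (simp add: integral_distr)
    finally show ?thesis .
  qed
  have dep: "Dep P r f X B U = M * (\<Sum>j<r. \<Sum>\<^sub>\<infinity>\<beta>\<in>B. (cov \<mu> (\<phi> f j) (\<lambda>w. \<beta> (\<pi> w)))^2)"
    if f: "f \<in> A" and B: "\<And>\<beta>. \<beta> \<in> B \<Longrightarrow> (\<lambda>w. \<beta> (\<pi> w)) \<in> borel_measurable N" and U: "U = (\<lambda>\<omega>. \<pi> (Z \<omega>))"
    for f U \<pi> and B :: "('u \<Rightarrow> real) set"
  proof -
    have "(\<Sum>\<^sub>\<infinity>\<beta>\<in>B. (cov P (\<lambda>\<omega>. f j (X \<omega>)) (\<lambda>\<omega>. \<beta> (U \<omega>)))^2) = (\<Sum>\<^sub>\<infinity>\<beta>\<in>B. M * (cov \<mu> (\<phi> f j) (\<lambda>w. \<beta> (\<pi> w)))^2)"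
      if "j < r" for j
      using pop[OF f that B] M unfolding U by (intro infsum_cong) (simp add: power_mult_distrib)
    then show ?thesis unfolding Dep_def by (simp add: infsum_cmult_right' sum_distrib_left)
  qed
  define \<Phi> where "\<Phi> f = (\<Sum>j<r. \<Sum>\<^sub>\<infinity>\<beta>\<in>BY. (cov \<mu> (\<phi> f j) (bY \<beta>))^2)" for f
  define \<Psi> where "\<Psi> f = (\<Sum>j<r. \<Sum>\<^sub>\<infinity>\<beta>\<in>BS. (cov \<mu> (\<phi> f j) (bS \<beta>))^2)" for f
  have DepY: "Dep P r f X BY Y = M * \<Phi> f" if f: "f \<in> A" for f
    unfolding \<Phi>_def bY_def by (rule dep[OF f bm[OF _ pY BY(2)]]) (auto simp: Z_def)
  have DepS: "Dep P r f X BS S = M * \<Psi> f" if f: "f \<in> A" for f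
    unfolding \<Psi>_def bS_def by (rule dep[OF f bm[OF _ pS BS(2)]]) (auto simp: Z_def)
  \<comment> \<open>The restriction to the first n indices places the sample vector in the
    extensional product space. By independence and equality of laws its distribution is the product
    of n copies of \<open>\<mu>\<close>.\<close>
  define W where "W \<omega> = (\<lambda>i\<in>{..<n}. z i \<omega>)" for \<omega>
  have Wm: "W \<in> P \<rightarrow>\<^sub>M samples n N" unfolding W_def using zm by (intro measurable_restrict) auto
  have ys: "y i \<omega> \<in> space NY" "s i \<omega> \<in> space NS" if "\<omega> \<in> space P" "i < n" for i \<omega>
    using measurable_space[OF ym] measurable_space[OF sm] that by auto
  have emp: "Dep_emp n r f (\<lambda>i. x i \<omega>) B u
      = M * (\<Sum>j<r. \<Sum>\<^sub>\<infinity>\<beta>\<in>B. (emp_cov n (W \<omega>) (W \<omega>) (\<phi> f j) (\<lambda>w. \<beta> (\<pi> w)))^2)"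
    if f: "f \<in> A" and xi: "\<And>i. i < n \<Longrightarrow> x i \<omega> \<in> G M" and u: "\<And>i. i < n \<Longrightarrow> u i = \<pi> (z i \<omega>)"
    for f \<omega> \<pi> B and u :: "nat \<Rightarrow> 'u"
  proof -
    have "emp_cov n (\<lambda>i. x i \<omega>) u (f j) \<beta> = sqrt M * emp_cov n (W \<omega>) (W \<omega>) (\<phi> f j) (\<lambda>w. \<beta> (\<pi> w))"
      if j: "j < r" for j \<beta>
    proof -
      have "emp_cov n (\<lambda>i. x i \<omega>) u (f j) \<beta> = emp_cov n (W \<omega>) (W \<omega>) (\<lambda>w. sqrt M * \<phi> f j w) (\<lambda>w. \<beta> (\<pi> w))"
      proof (rule emp_cov_cong)
        fix i assume i: "i < n"
        show "f j (x i \<omega>) = sqrt M * \<phi> f j (W \<omega> i)"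
          using normalized_scale[OF M f j, of "z i \<omega>"] xi[OF i] i unfolding \<phi>_def by (simp add: z_def W_def)
        show "\<beta> (u i) = \<beta> (\<pi> (W \<omega> i))" using u[OF i] i by (simp add: W_def)
      qed
      then show ?thesis by (simp only: emp_cov_scale)
    qed
    then show ?thesis using M unfolding Dep_emp_def
      by (simp add: power_mult_distrib infsum_cmult_right' sum_distrib_left)
  qed
  have key: "\<bar>JA - JA_sample n x y s \<omega>\<bar> \<le> M * R"
    if \<omega>: "\<omega> \<in> space P" and WE: "W \<omega> \<in> E" and xi: "\<And>i. i < n \<Longrightarrow> x i \<omega> \<in> G M" for \<omega>
  proof -
    let ?J = "\<lambda>f. Jt f"
    let ?Je = "\<lambda>f. Jt_sample n x y s \<omega> f"
    have Je_le: "\<bar>?Je f\<bar> \<le> real r * F^2" if "f \<in> A" for f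
      using ys[OF \<omega>] by (intro J_emp_bounded n0 that)
    have "\<bar>(SUP f\<in>A0. ?J f) - (SUP f\<in>A0. ?Je f)\<bar> \<le> M * R"
    proof (rule abs_SUP_diff_le[OF A0(3)])
      show "bdd_above (?J ` A0)"
        using J_bounded A0(2) by (intro bdd_aboveI2[where M = "real r * F^2"]) (auto simp: abs_le_iff)
      show "bdd_above (?Je ` A0)"
        using Je_le A0(2) by (intro bdd_aboveI2[where M = "real r * F^2"]) (auto simp: abs_le_iff)
      fix f assume f0: "f \<in> A0"
      then have f: "f \<in> A" using A0(2) by blast
      define \<Phi>' where "\<Phi>' = (\<Sum>j<r. \<Sum>\<^sub>\<infinity>\<beta>\<in>BY. (emp_cov n (W \<omega>) (W \<omega>) (\<phi> f j) (bY \<beta>))^2)"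
      define \<Psi>' where "\<Psi>' = (\<Sum>j<r. \<Sum>\<^sub>\<infinity>\<beta>\<in>BS. (emp_cov n (W \<omega>) (W \<omega>) (\<phi> f j) (bS \<beta>))^2)"
      have eY: "Dep_emp n r f (\<lambda>i. x i \<omega>) BY (\<lambda>i. y i \<omega>) = M * \<Phi>'"
        unfolding \<Phi>'_def bY_def by (rule emp[OF f xi]) (auto simp: z_def)
      have eS: "Dep_emp n r f (\<lambda>i. x i \<omega>) BS (\<lambda>i. s i \<omega>) = M * \<Psi>'"
        unfolding \<Psi>'_def bS_def by (rule emp[OF f xi]) (auto simp: z_def)
      have "\<bar>(1 - lam) * (\<Phi>' - \<Phi> f) - lam * (\<Psi>' - \<Psi> f)\<bar> \<le> R"
        using E(3)[OF WE f0] unfolding \<Phi>'_def \<Phi>_def \<Psi>'_def \<Psi>_def dep_dev_inf_def by (simp only: sum_subtractf)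
      then have "M * \<bar>(1 - lam) * (\<Phi>' - \<Phi> f) - lam * (\<Psi>' - \<Psi> f)\<bar> \<le> M * R"
        using M by (rule mult_left_mono)
      moreover have "?J f - ?Je f = - (M * ((1 - lam) * (\<Phi>' - \<Phi> f) - lam * (\<Psi>' - \<Psi> f)))"
        unfolding J_def J_emp_def DepY[OF f] DepS[OF f] eY eS by (simp add: algebra_simps)
      ultimately show "\<bar>?J f - ?Je f\<bar> \<le> M * R"
        using M by (simp add: abs_mult)
    qed
    moreover have "(SUP f\<in>A0. ?Je f) = JA_sample n x y s \<omega>"
      by (rule A0(5)[OF n0 ys[OF \<omega>]])
    ultimately show ?thesis by (simp only: A0(4))
  qed
  have "distr P (samples n N) W = Pi\<^sub>M {..<n} (\<lambda>i. distr P N (z i))"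
    unfolding W_def using indep n0 zm by (subst indep_vars_iff_distr_eq_PiM'[symmetric]) auto
  also have "\<dots> = ?Q" using dist by (intro PiM_cong) (auto simp: \<mu>_def)
  finally have distrW: "distr P (samples n N) W = ?Q" .
  have EN: "E \<in> sets (samples n N)"
    using E(1) sets_PiM_cong[OF refl sets\<mu>] by blast
  have "1 - \<delta> \<le> measure (distr P (samples n N) W) E" unfolding distrW by (rule E(2))
  also have "\<dots> = prob (W -` E \<inter> space P)" by (rule measure_distr[OF Wm EN])
  also have "\<dots> \<le> prob {\<omega> \<in> space P. \<bar>JA - JA_sample n x y s \<omega>\<bar>
      \<le> real r * M * conf_radius n \<delta> + C}"
  proof (rule finite_measure_mono_AE)
    have MR: "M * R = real r * M * conf_radius n \<delta>" by (simp add: R_def)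
    show "AE \<omega> in P. \<omega> \<in> W -` E \<inter> space P \<longrightarrow> \<omega> \<in> {\<omega> \<in> space P.
        \<bar>JA - JA_sample n x y s \<omega>\<bar>
        \<le> real r * M * conf_radius n \<delta> + C}"
      using xG
    proof eventually_elim
      case (elim \<omega>)
      then show ?case using key[of \<omega>] C unfolding MR by fastforce
    qed
    \<comment> \<open>The inclusion of events holds only almost surely, so monotonicity of the
      measure asks for a measurable target.\<close>
    have [measurable]: "(\<lambda>\<omega>. JA_sample n x y s \<omega>) \<in> borel_measurable P"
      by (rule JA_emp_measurable[OF n0 xm ym sm])
    show "{\<omega> \<in> space P. \<bar>JA - JA_sample n x y s \<omega>\<bar>
        \<le> real r * M * conf_radius n \<delta> + C} \<in> events"
      by measurable
  qed
  finally show ?thesis .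
qed

end

text \<open>The value of a basis function at u is its inner product with the kernel section
  \<open>k u\<close>. Bessel's inequality bounds the sum of squares by the squared norm of that
  section, which is \<open>k u u\<close>.\<close>

lemma orthonormal_basis_unit_features:
  assumes H: "rkhs D H ip k" and meas: "H \<subseteq> borel_measurable N" and D: "space N = D"
    and k: "\<forall>u\<in>D. \<forall>v\<in>D. \<bar>k u v\<bar> \<le> 1"
    and B: "orthonormal_basis H ip B" and T: "finite T" "T \<subseteq> B"
  shows "unit_features N T (\<lambda>\<beta>. \<beta>)"
  unfolding unit_features_def
proof (intro conjI ballI)
  interpret R: rkhs D H ip k by fact
  interpret I: ip_space H ip by (rule rkhs_ip_space[OF H])
  have BH: "B \<subseteq> H" using B by (simp add: orthonormal_basis_def)
  show "finite T" by fact
  show "\<beta> \<in> borel_measurable N" if "\<beta> \<in> T" for \<beta> using that T BH meas by blast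
  fix u assume "u \<in> space N"
  then have u: "u \<in> D" by (simp add: D)
  have ku: "k u \<in> H" by (rule R.kernel_mem[OF u])
  have on: "I.orthonormal T (\<lambda>\<beta>. \<beta>)"
    using B T BH unfolding I.orthonormal_def orthonormal_basis_def by blast
  have "(\<Sum>\<beta>\<in>T. (\<beta> u)^2) = (\<Sum>\<beta>\<in>T. (ip (k u) \<beta>)^2)"
  proof (rule sum.cong[OF refl])
    fix \<beta> assume "\<beta> \<in> T"
    then have "\<beta> \<in> H" using T BH by blast
    then show "(\<beta> u)^2 = (ip (k u) \<beta>)^2" using R.reproducing[of \<beta> u] u I.ip_commute[OF ku, of \<beta>] by simp
  qed
  also have "\<dots> \<le> ip (k u) (k u)" by (rule I.bessel[OF on ku])
  also have "\<dots> = k u u" using R.reproducing[OF ku u] by simp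
  also have "\<dots> \<le> 1" using k u by (auto simp: abs_le_iff)
  finally show "(\<Sum>\<beta>\<in>T. (\<beta> u)^2) \<le> 1" .
qed

theorem theorem5:
  fixes P :: "'w measure"
    and X :: "'w \<Rightarrow> real ^ 'dx" and Y :: "'w \<Rightarrow> real ^ 'dy" and S :: "'w \<Rightarrow> real ^ 'ds"
    and RY :: "(real ^ 'dy) set" and RS :: "(real ^ 'ds) set"
    and HX :: "(real ^ 'dx \<Rightarrow> real) set" and HY :: "(real ^ 'dy \<Rightarrow> real) set"
    and HS :: "(real ^ 'ds \<Rightarrow> real) set"
    and ipX :: "(real ^ 'dx \<Rightarrow> real) \<Rightarrow> (real ^ 'dx \<Rightarrow> real) \<Rightarrow> real"
    and ipY :: "(real ^ 'dy \<Rightarrow> real) \<Rightarrow> (real ^ 'dy \<Rightarrow> real) \<Rightarrow> real"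
    and ipS :: "(real ^ 'ds \<Rightarrow> real) \<Rightarrow> (real ^ 'ds \<Rightarrow> real) \<Rightarrow> real"
    and kX :: "real ^ 'dx \<Rightarrow> real ^ 'dx \<Rightarrow> real"
    and kY :: "real ^ 'dy \<Rightarrow> real ^ 'dy \<Rightarrow> real"
    and kS :: "real ^ 'ds \<Rightarrow> real ^ 'ds \<Rightarrow> real"
    and BY :: "(real ^ 'dy \<Rightarrow> real) set" and BS :: "(real ^ 'ds \<Rightarrow> real) set"
    and r :: nat and \<gamma> lam M :: real
  defines "NY \<equiv> restrict_space borel RY"
    and "NS \<equiv> restrict_space borel RS"
    and "A \<equiv> admissible P X HX ipX \<gamma> r"
  assumes "prob_space P"
    and "X \<in> P \<rightarrow>\<^sub>M borel" and "Y \<in> P \<rightarrow>\<^sub>M NY" and "S \<in> P \<rightarrow>\<^sub>M NS"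
    and "rkhs UNIV HX ipX kX" and "universal_rkhs HX"
    and "rkhs RY HY ipY kY" and "HY \<subseteq> borel_measurable NY"
    and "rkhs RS HS ipS kS" and "HS \<subseteq> borel_measurable NS"
    and "countable BY" and "orthonormal_basis HY ipY BY"
    and "countable BS" and "orthonormal_basis HS ipS BS"
    and "\<exists>b. \<forall>u v. \<bar>kX u v\<bar> \<le> b"
    and "integrable P (\<lambda>\<omega>. kX (X \<omega>) (X \<omega>))"
    and "integrable P (\<lambda>\<omega>. kY (Y \<omega>) (Y \<omega>))"
    and "integrable P (\<lambda>\<omega>. kS (S \<omega>) (S \<omega>))"
    and "\<forall>u\<in>RY. \<forall>v\<in>RY. \<bar>kY u v\<bar> \<le> 1"
    and "\<forall>u\<in>RS. \<forall>v\<in>RS. \<bar>kS u v\<bar> \<le> 1"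
    and "\<gamma> > 0" and "r \<ge> 1" and "0 \<le> lam" and "lam < 1"
  shows "\<exists>C. \<forall>n>1. \<forall>\<delta>. 0 < \<delta> \<and> \<delta> < 1 \<longrightarrow>
    (\<forall>x y s.
       iid_copies P (borel \<Otimes>\<^sub>M NY \<Otimes>\<^sub>M NS) n
         (\<lambda>\<omega>. (X \<omega>, Y \<omega>, S \<omega>)) (\<lambda>i \<omega>. (x i \<omega>, y i \<omega>, s i \<omega>)) \<and>
       (AE \<omega> in P. \<forall>f\<in>A. \<forall>j<r. \<forall>i<n. (f j (x i \<omega>))\<^sup>2 \<le> M) \<longrightarrow>
       measure P {\<omega> \<in> space P.
           \<bar>(SUP f\<in>A. J P X Y S BY BS r f lam)
            - (SUP f\<in>A. J_emp n (\<lambda>i. x i \<omega>) (\<lambda>i. y i \<omega>) (\<lambda>i. s i \<omega>) BY BS r f lam)\<bar>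
           \<le> real r * M * sqrt (ln (6 / \<delta>) / (0.22\<^sup>2 * real n)) + C / real n}
         \<ge> 1 - \<delta>)"
proof -
  obtain b0 where b0: "\<And>u v. \<bar>kX u v\<bar> \<le> b0" using \<open>\<exists>b. \<forall>u v. \<bar>kX u v\<bar> \<le> b\<close> by blast
  \<comment> \<open>The maximum with 1 makes the bound positive, and with it
    \<open>F\<close>.\<close>
  define b where "b = max b0 1"
  have b: "kX u u \<le> b" for u using b0[of u u] unfolding b_def by linarith
  have "b > 0" by (simp add: b_def)
  have NY: "space NY = RY" and NS: "space NS = RS" by (simp_all add: NY_def NS_def space_restrict_space)
  interpret P: prob_space P by fact
  interpret E: representation_setting P X Y S NY NS HX ipX kX BY BS r \<gamma> lam b
  proof (rule representation_setting.intro[OF \<open>prob_space P\<close> representation_setting_axioms.intro])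
    show "unit_features NY T (\<lambda>\<beta>. \<beta>)" if "finite T" "T \<subseteq> BY" for T
      by (rule orthonormal_basis_unit_features[OF \<open>rkhs RY HY ipY kY\<close> \<open>HY \<subseteq> borel_measurable NY\<close> NY
            \<open>\<forall>u\<in>RY. \<forall>v\<in>RY. \<bar>kY u v\<bar> \<le> 1\<close> \<open>orthonormal_basis HY ipY BY\<close> that])
    show "unit_features NS T (\<lambda>\<beta>. \<beta>)" if "finite T" "T \<subseteq> BS" for T
      by (rule orthonormal_basis_unit_features[OF \<open>rkhs RS HS ipS kS\<close> \<open>HS \<subseteq> borel_measurable NS\<close> NS
            \<open>\<forall>u\<in>RS. \<forall>v\<in>RS. \<bar>kS u v\<bar> \<le> 1\<close> \<open>orthonormal_basis HS ipS BS\<close> that])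
    show "lam \<le> 1" using \<open>lam < 1\<close> by simp
  qed fact+
  have A: "A = E.A" by (simp add: A_def E.A_def)
  \<comment> \<open>For every sample the suprema differ by at most 2 r F^2; the factor 100 makes C /
    n at least that for all n below 100. C depends only on r, the kernel bound and
    \<open>\<gamma>\<close>, so it serves every n, \<delta> and sample.\<close>
  define C where "C = 200 * (real r * E.F^2)"
  have "C \<ge> 0" by (simp add: C_def)
  show ?thesis
  proof (intro exI[of _ C] allI impI)
    fix n :: nat and \<delta> :: real and x y s
    assume n: "1 < n" and del: "0 < \<delta> \<and> \<delta> < 1"
      and iid: "iid_copies P (borel \<Otimes>\<^sub>M NY \<Otimes>\<^sub>M NS) n
         (\<lambda>\<omega>. (X \<omega>, Y \<omega>, S \<omega>)) (\<lambda>i \<omega>. (x i \<omega>, y i \<omega>, s i \<omega>)) \<and>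
       (AE \<omega> in P. \<forall>f\<in>A. \<forall>j<r. \<forall>i<n. (f j (x i \<omega>))^2 \<le> M)"
    show "1 - \<delta> \<le> measure P {\<omega> \<in> space P.
           \<bar>(SUP f\<in>A. J P X Y S BY BS r f lam)
            - (SUP f\<in>A. J_emp n (\<lambda>i. x i \<omega>) (\<lambda>i. y i \<omega>) (\<lambda>i. s i \<omega>) BY BS r f lam)\<bar>
           \<le> real r * M * sqrt (ln (6 / \<delta>) / (0.22^2 * real n)) + C / real n}"
    proof (cases "n \<ge> 100")
      case True
      show ?thesis unfolding A
        using E.concentration[OF True _ _ conjunct1[OF iid] conjunct2[OF iid, unfolded A], of \<delta> "C / real n"]
          del \<open>C \<ge> 0\<close> by simp
    next
      case False
      have n0: "n > 0" using n by simp
      \<comment> \<open>For negative M the radius term would be negative and could outweigh C / n;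
        the sample hypothesis excludes this, as squares are nonnegative.\<close>
      have M: "M \<ge> 0" by (rule E.sample_bound_nonneg[OF n0 conjunct2[OF iid, unfolded A]])
      have "0 \<le> ln (6 / \<delta>)" using del by simp
      then have radius: "0 \<le> real r * M * sqrt (ln (6 / \<delta>) / (0.22^2 * real n))" using M by simp
      have "2 * (real r * E.F^2) * real n \<le> 2 * (real r * E.F^2) * 100"
        using False by (intro mult_left_mono) auto
      then have small: "2 * (real r * E.F^2) \<le> C / real n"
        using n0 by (simp add: C_def field_simps)
      have "{\<omega> \<in> space P.
           \<bar>(SUP f\<in>A. J P X Y S BY BS r f lam)
            - (SUP f\<in>A. J_emp n (\<lambda>i. x i \<omega>) (\<lambda>i. y i \<omega>) (\<lambda>i. s i \<omega>) BY BS r f lam)\<bar>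
           \<le> real r * M * sqrt (ln (6 / \<delta>) / (0.22^2 * real n)) + C / real n} = space P"
      proof (intro equalityI subsetI CollectI conjI)
        fix \<omega> assume \<omega>: "\<omega> \<in> space P"
        have ys: "y i \<omega> \<in> space NY" "s i \<omega> \<in> space NS" if "i < n" for i
          using E.sample_measurable(2,3)[OF conjunct1[OF iid] that] \<omega> by (auto dest: measurable_space)
        show "\<bar>(SUP f\<in>A. J P X Y S BY BS r f lam)
            - (SUP f\<in>A. J_emp n (\<lambda>i. x i \<omega>) (\<lambda>i. y i \<omega>) (\<lambda>i. s i \<omega>) BY BS r f lam)\<bar>
           \<le> real r * M * sqrt (ln (6 / \<delta>) / (0.22^2 * real n)) + C / real n"
          unfolding A
          using E.JA_minus_JA_emp_le[where x = "\<lambda>i. x i \<omega>" and y = "\<lambda>i. y i \<omega>" and s = "\<lambda>i. s i \<omega>", OF n0 ys]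
            radius small by linarith
      qed auto
      then show ?thesis using del by (simp add: P.prob_space)
    qed
  qed
qed

end
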